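(* For any LF context, kind, type or canonical term $E$ and any substitution $\theta$, it is decidable whether there is an $E'$ such that $[\theta]E = E'$ is derivable; moreover there is at most one $E'$ for which it is derivable. Similarly, for any atomic term $R$ and substitution $\theta$, it is decidable whether there is an atomic term $R'$, or a canonical term $M'$ and arity type $\alpha'$, such that $[\theta]_r R = R'$, respectively $[\theta]_r R = M' : \alpha'$, is derivable; at most one of these two kinds of judgement is derivable, and that for a unique $R'$, respectively a unique pair $M'$, $\alpha'$.
   Context: Canonical LF syntax: kinds $K ::= \mathrm{Type} \mid \Pi x{:}A.K$; canonical types $A,B ::= P \mid \Pi x{:}A.B$; atomic types $P ::= a \mid P\,M$; canonical terms $M,N ::= R \mid \lambda x.M$; atomic terms $R ::= c \mid x \mid R\,M$; contexts $\Gamma ::= \cdot \mid \Gamma, x{:}A$. Here $c$ ranges over term constants, $a$ over type constants, $x,y$ over variables; expressions are identified up to renaming of bound variables. Arity types are generated from the constant $o$ by the binary constructor $\rightarrow$. A substitution $\theta$ is a finite set $\{\langle x_1,M_1,\alpha_1\rangle,\ldots,\langle x_n,M_n,\alpha_n\rangle\}$ with the $x_i$ distinct variables, $M_i$ canonical terms and $\alpha_i$ arity types; $\mathrm{dom}(\theta)=\{x_1,\ldots,x_n\}$, $\mathrm{rng}(\theta)=\{M_1,\ldots,M_n\}$. Hereditary substitution is given by the least relations closed under the following rules. Canonical terms: if $[\theta]_r R = R'$ then $[\theta]R = R'$; if $[\theta]_r R = M':\alpha'$ then $[\theta]R = M'$; if $x\notin\mathrm{dom}(\theta)$, $x$ is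 not free in any term of $\mathrm{rng}(\theta)$, and $[\theta]M=M'$, then $[\theta](\lambda x.M)=\lambda x.M'$. Atomic terms with canonical result: if $\langle x,M,\alpha\rangle\in\theta$ then $[\theta]_r x = M:\alpha$; if $[\theta]_r R = \lambda x.M' : \alpha'\rightarrow\alpha''$, $[\theta]M = M''$ and $[\{\langle x,M'',\alpha'\rangle\}]M' = M'''$ then $[\theta]_r(R\,M) = M''':\alpha''$. Atomic terms with atomic result: $[\theta]_r c = c$; if $x\notin\mathrm{dom}(\theta)$ then $[\theta]_r x = x$; if $[\theta]_r R=R'$ and $[\theta]M=M'$ then $[\theta]_r(R\,M)=R'\,M'$. Types: $[\theta]a=a$; if $[\theta]P=P'$ and $[\theta]M=M'$ then $[\theta](P\,M)=P'\,M'$; if $x$ is not in $\mathrm{dom}(\theta)$ nor free in $\mathrm{rng}(\theta)$, $[\theta]A_1=A_1'$ and $[\theta]A_2=A_2'$, then $[\theta](\Pi x{:}A_1.A_2)=\Pi x{:}A_1'.A_2'$. Kinds: $[\theta]\mathrm{Type}=\mathrm{Type}$ and the analogous $\Pi$ rule. Contexts: $[\theta]\cdot=\cdot$; if $x$ is not in $\mathrm{dom}(\theta)$ nor free in $\mathrm{rng}(\theta)$, $[\theta]\Gamma=\Gamma'$ and $[\theta]A=A'$, then $[\theta](\Gamma,x{:}A)=\Gamma',x{:}A'$. *)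

theory Defs
  imports Main "HOL-Library.Nat_Bijection" "HOL-Combinatorics.Transposition"
begin

section \<open>Raw syntax\<close>

text \<open>
  Raw expressions carry named binders and are not yet identified up to renaming. They are
  polymorphic in the names only so that the datatype package supplies the map functions
  (renaming of all occurrences, binding ones included) and the set functions (all names
  that occur, binding ones included).
\<close>

type_synonym var = nat

datatype arity = Base | Arr arity arity

datatype 'v rtm = RAtom "'v ratm" | RLam 'v "'v rtm"
  and 'v ratm = RConst nat | RVar 'v | RApp "'v ratm" "'v rtm"

datatype 'v raty = RTConst nat | RTApp "'v raty" "'v rtm"

datatype 'v rty = RTAtom "'v raty" | RPi 'v "'v rty" "'v rty"

datatype 'v rkind = RType | RKPi 'v "'v rty" "'v rkind"

primrec fv_rtm :: "'v rtm \<Rightarrow> 'v set" and fv_ratm :: "'v ratm \<Rightarrow> 'v set" where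
  "fv_rtm (RAtom R) = fv_ratm R"
| "fv_rtm (RLam x M) = fv_rtm M - {x}"
| "fv_ratm (RConst c) = {}"
| "fv_ratm (RVar x) = {x}"
| "fv_ratm (RApp R M) = fv_ratm R \<union> fv_rtm M"


section \<open>Renaming of bound variables\<close>

text \<open>
  Each relation is the least congruence containing the renaming of a bound variable \<open>x\<close>
  to a name \<open>y\<close> that does not occur at all in its scope. As \<open>y\<close> does not occur,
  transposing \<open>x\<close> and \<open>y\<close> just replaces \<open>x\<close> by \<open>y\<close>.
\<close>

inductive alpha_tm :: "var rtm \<Rightarrow> var rtm \<Rightarrow> bool"
  and alpha_atm :: "var ratm \<Rightarrow> var ratm \<Rightarrow> bool" where
  alpha_tm_refl: "alpha_tm M M"
| alpha_tm_sym: "alpha_tm M N \<Longrightarrow> alpha_tm N M"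
| alpha_tm_trans: "alpha_tm M N \<Longrightarrow> alpha_tm N P \<Longrightarrow> alpha_tm M P"
| alpha_tm_rename: "y \<notin> set_rtm M \<Longrightarrow>
    alpha_tm (RLam x M) (RLam y (map_rtm (transpose x y) M))"
| alpha_tm_Atom: "alpha_atm R R' \<Longrightarrow> alpha_tm (RAtom R) (RAtom R')"
| alpha_tm_Lam: "alpha_tm M M' \<Longrightarrow> alpha_tm (RLam x M) (RLam x M')"
| alpha_atm_refl: "alpha_atm R R"
| alpha_atm_sym: "alpha_atm R S \<Longrightarrow> alpha_atm S R"
| alpha_atm_trans: "alpha_atm R S \<Longrightarrow> alpha_atm S T \<Longrightarrow> alpha_atm R T"
| alpha_atm_App: "alpha_atm R R' \<Longrightarrow> alpha_tm M M' \<Longrightarrow>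
    alpha_atm (RApp R M) (RApp R' M')"

inductive alpha_aty :: "var raty \<Rightarrow> var raty \<Rightarrow> bool" where
  alpha_aty_refl: "alpha_aty P P"
| alpha_aty_sym: "alpha_aty P Q \<Longrightarrow> alpha_aty Q P"
| alpha_aty_trans: "alpha_aty P Q \<Longrightarrow> alpha_aty Q S \<Longrightarrow> alpha_aty P S"
| alpha_aty_App: "alpha_aty P P' \<Longrightarrow> alpha_tm M M' \<Longrightarrow>
    alpha_aty (RTApp P M) (RTApp P' M')"

inductive alpha_ty :: "var rty \<Rightarrow> var rty \<Rightarrow> bool" where
  alpha_ty_refl: "alpha_ty A A"
| alpha_ty_sym: "alpha_ty A B \<Longrightarrow> alpha_ty B A"
| alpha_ty_trans: "alpha_ty A B \<Longrightarrow> alpha_ty B C \<Longrightarrow> alpha_ty A C"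
| alpha_ty_rename: "y \<notin> set_rty B \<Longrightarrow>
    alpha_ty (RPi x A B) (RPi y A (map_rty (transpose x y) B))"
| alpha_ty_Atom: "alpha_aty P P' \<Longrightarrow> alpha_ty (RTAtom P) (RTAtom P')"
| alpha_ty_Pi: "alpha_ty A A' \<Longrightarrow> alpha_ty B B' \<Longrightarrow> alpha_ty (RPi x A B) (RPi x A' B')"

inductive alpha_kind :: "var rkind \<Rightarrow> var rkind \<Rightarrow> bool" where
  alpha_kind_refl: "alpha_kind K K"
| alpha_kind_sym: "alpha_kind K L \<Longrightarrow> alpha_kind L K"
| alpha_kind_trans: "alpha_kind K L \<Longrightarrow> alpha_kind L J \<Longrightarrow> alpha_kind K J"
| alpha_kind_rename: "y \<notin> set_rkind K \<Longrightarrow>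
    alpha_kind (RKPi x A K) (RKPi y A (map_rkind (transpose x y) K))"
| alpha_kind_Pi: "alpha_ty A A' \<Longrightarrow> alpha_kind K K' \<Longrightarrow>
    alpha_kind (RKPi x A K) (RKPi x A' K')"

lemma fv_map_transpose:
  fixes M :: "var rtm" and R :: "var ratm"
  shows "fv_rtm (map_rtm (transpose x y) M) = transpose x y ` fv_rtm M"
    and "fv_ratm (map_ratm (transpose x y) R) = transpose x y ` fv_ratm R"
  by (induction M and R rule: rtm.induct ratm.induct)
     (auto simp: image_Un image_set_diff[OF inj_transpose])

lemma fv_subset_set:
  fixes M :: "'v rtm" and R :: "'v ratm"
  shows "fv_rtm M \<subseteq> set_rtm M" and "fv_ratm R \<subseteq> set_ratm R"
  by (induction M and R rule: rtm.induct ratm.induct) auto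

lemma fv_alpha:
  shows "alpha_tm M N \<Longrightarrow> fv_rtm M = fv_rtm N"
    and "alpha_atm R S \<Longrightarrow> fv_ratm R = fv_ratm S"
proof (induction rule: alpha_tm_alpha_atm.inducts)
  case (alpha_tm_rename y M x)
  then have "y \<notin> fv_rtm M" using fv_subset_set(1)[of M] by blast
  then show ?case
    by (auto simp: fv_map_transpose transpose_def image_iff split: if_splits)
qed auto


section \<open>Expressions\<close>

quotient_type tm = "var rtm" / alpha_tm
  by (rule equivpI)
     (auto intro!: reflpI sympI transpI intro: alpha_tm_alpha_atm.intros)

quotient_type atm = "var ratm" / alpha_atm
  by (rule equivpI)
     (auto intro!: reflpI sympI transpI intro: alpha_tm_alpha_atm.intros)

quotient_type aty = "var raty" / alpha_aty
  by (rule equivpI) (auto intro!: reflpI sympI transpI intro: alpha_aty.intros)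

quotient_type ty = "var rty" / alpha_ty
  by (rule equivpI) (auto intro!: reflpI sympI transpI intro: alpha_ty.intros)

quotient_type kind = "var rkind" / alpha_kind
  by (rule equivpI) (auto intro!: reflpI sympI transpI intro: alpha_kind.intros)

lift_definition Atom :: "atm \<Rightarrow> tm" is RAtom by (rule alpha_tm_Atom)
lift_definition Lam :: "var \<Rightarrow> tm \<Rightarrow> tm" is RLam by (rule alpha_tm_Lam)

lift_definition Const :: "nat \<Rightarrow> atm" is RConst .
lift_definition Var :: "var \<Rightarrow> atm" is RVar .
lift_definition App :: "atm \<Rightarrow> tm \<Rightarrow> atm" is RApp by (rule alpha_atm_App)

lift_definition TConst :: "nat \<Rightarrow> aty" is RTConst .
lift_definition TApp :: "aty \<Rightarrow> tm \<Rightarrow> aty" is RTApp by (rule alpha_aty_App)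

lift_definition TAtom :: "aty \<Rightarrow> ty" is RTAtom by (rule alpha_ty_Atom)
lift_definition Pi :: "var \<Rightarrow> ty \<Rightarrow> ty \<Rightarrow> ty" is RPi by (rule alpha_ty_Pi)

lift_definition Type :: kind is RType .
lift_definition KPi :: "var \<Rightarrow> ty \<Rightarrow> kind \<Rightarrow> kind" is RKPi by (rule alpha_kind_Pi)

lift_definition fv :: "tm \<Rightarrow> var set" is fv_rtm by (rule fv_alpha)

text \<open>
  The head of the list is the declaration added last. A context does not bind its
  variables: their names matter, and no condition is imposed on them.
\<close>

type_synonym ctx = "(var \<times> ty) list"


section \<open>Hereditary substitution\<close>

type_synonym subst = "(var \<times> tm \<times> arity) set"

definition is_subst :: "subst \<Rightarrow> bool" where
  "is_subst \<theta> \<longleftrightarrow> finite \<theta> \<and> inj_on fst \<theta>"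

definition sdom :: "subst \<Rightarrow> var set" where
  "sdom \<theta> = {x. \<exists>M \<alpha>. (x, M, \<alpha>) \<in> \<theta>}"

definition srng :: "subst \<Rightarrow> tm set" where
  "srng \<theta> = {M. \<exists>x \<alpha>. (x, M, \<alpha>) \<in> \<theta>}"

definition sfresh :: "var \<Rightarrow> subst \<Rightarrow> bool" where
  "sfresh x \<theta> \<longleftrightarrow> x \<notin> sdom \<theta> \<and> (\<forall>M \<in> srng \<theta>. x \<notin> fv M)"

text \<open>
  \<open>hsub_can \<theta> R M \<alpha>\<close> is the judgement on atomic terms with a canonical result,
  \<open>hsub_atm \<theta> R R'\<close> the one with an atomic result.
\<close>

inductive hsub_tm :: "subst \<Rightarrow> tm \<Rightarrow> tm \<Rightarrow> bool"
  and hsub_can :: "subst \<Rightarrow> atm \<Rightarrow> tm \<Rightarrow> arity \<Rightarrow> bool"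
  and hsub_atm :: "subst \<Rightarrow> atm \<Rightarrow> atm \<Rightarrow> bool" where
  hsub_tm_atm: "hsub_atm \<theta> R R' \<Longrightarrow> hsub_tm \<theta> (Atom R) (Atom R')"
| hsub_tm_can: "hsub_can \<theta> R M' \<alpha>' \<Longrightarrow> hsub_tm \<theta> (Atom R) M'"
| hsub_tm_Lam: "sfresh x \<theta> \<Longrightarrow> hsub_tm \<theta> M M' \<Longrightarrow> hsub_tm \<theta> (Lam x M) (Lam x M')"
| hsub_can_Var: "(x, M, \<alpha>) \<in> \<theta> \<Longrightarrow> hsub_can \<theta> (Var x) M \<alpha>"
| hsub_can_App: "hsub_can \<theta> R (Lam x M') (Arr \<alpha>' \<alpha>'') \<Longrightarrow> hsub_tm \<theta> M M'' \<Longrightarrow>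
    hsub_tm {(x, M'', \<alpha>')} M' M''' \<Longrightarrow> hsub_can \<theta> (App R M) M''' \<alpha>''"
| hsub_atm_Const: "hsub_atm \<theta> (Const c) (Const c)"
| hsub_atm_Var: "x \<notin> sdom \<theta> \<Longrightarrow> hsub_atm \<theta> (Var x) (Var x)"
| hsub_atm_App: "hsub_atm \<theta> R R' \<Longrightarrow> hsub_tm \<theta> M M' \<Longrightarrow>
    hsub_atm \<theta> (App R M) (App R' M')"

inductive hsub_aty :: "subst \<Rightarrow> aty \<Rightarrow> aty \<Rightarrow> bool" where
  hsub_aty_Const: "hsub_aty \<theta> (TConst a) (TConst a)"
| hsub_aty_App: "hsub_aty \<theta> P P' \<Longrightarrow> hsub_tm \<theta> M M' \<Longrightarrow>
    hsub_aty \<theta> (TApp P M) (TApp P' M')"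

inductive hsub_ty :: "subst \<Rightarrow> ty \<Rightarrow> ty \<Rightarrow> bool" where
  hsub_ty_Atom: "hsub_aty \<theta> P P' \<Longrightarrow> hsub_ty \<theta> (TAtom P) (TAtom P')"
| hsub_ty_Pi: "sfresh x \<theta> \<Longrightarrow> hsub_ty \<theta> A A' \<Longrightarrow> hsub_ty \<theta> B B' \<Longrightarrow>
    hsub_ty \<theta> (Pi x A B) (Pi x A' B')"

inductive hsub_kind :: "subst \<Rightarrow> kind \<Rightarrow> kind \<Rightarrow> bool" where
  hsub_kind_Type: "hsub_kind \<theta> Type Type"
| hsub_kind_Pi: "sfresh x \<theta> \<Longrightarrow> hsub_ty \<theta> A A' \<Longrightarrow> hsub_kind \<theta> K K' \<Longrightarrow>
    hsub_kind \<theta> (KPi x A K) (KPi x A' K')"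

inductive hsub_ctx :: "subst \<Rightarrow> ctx \<Rightarrow> ctx \<Rightarrow> bool" where
  hsub_ctx_Nil: "hsub_ctx \<theta> [] []"
| hsub_ctx_Cons: "sfresh x \<theta> \<Longrightarrow> hsub_ctx \<theta> \<Gamma> \<Gamma>' \<Longrightarrow> hsub_ty \<theta> A A' \<Longrightarrow>
    hsub_ctx \<theta> ((x, A) # \<Gamma>) ((x, A') # \<Gamma>')"


section \<open>Total recursive functions\<close>

text \<open>
  \<open>recursive n f\<close>: on lists of length \<open>n\<close>, \<open>f\<close> is a general recursive function of \<open>n\<close>
  arguments, i.e. it arises from the initial functions by composition, primitive
  recursion and minimization of regular functions. Values of \<open>f\<close> on lists of any other
  length are irrelevant, which is what the last rule says.
\<close>

inductive recursive :: "nat \<Rightarrow> (nat list \<Rightarrow> nat) \<Rightarrow> bool" where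
  rec_zero: "recursive n (\<lambda>xs. 0)"
| rec_succ: "recursive 1 (\<lambda>xs. Suc (xs ! 0))"
| rec_proj: "i < n \<Longrightarrow> recursive n (\<lambda>xs. xs ! i)"
| rec_comp: "recursive (length gs) f \<Longrightarrow> (\<forall>g \<in> set gs. recursive n g) \<Longrightarrow>
    recursive n (\<lambda>xs. f (map (\<lambda>g. g xs) gs))"
| rec_prim: "recursive n f \<Longrightarrow> recursive (Suc (Suc n)) g \<Longrightarrow>
    recursive (Suc n) (\<lambda>xs. rec_nat (f (tl xs)) (\<lambda>k r. g (k # r # tl xs)) (hd xs))"
| rec_mu: "recursive (Suc n) f \<Longrightarrow> (\<forall>xs. length xs = n \<longrightarrow> (\<exists>k. f (k # xs) = 0)) \<Longrightarrow>
    recursive n (\<lambda>xs. LEAST k. f (k # xs) = 0)"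
| rec_ext: "recursive n f \<Longrightarrow> (\<forall>xs. length xs = n \<longrightarrow> f xs = g xs) \<Longrightarrow> recursive n g"

definition decidable_set :: "nat set \<Rightarrow> bool" where
  "decidable_set S \<longleftrightarrow> (\<exists>f. recursive 1 f \<and> (\<forall>n. f [n] = (if n \<in> S then 1 else 0)))"


section \<open>Decidability of properties of expressions under a substitution\<close>

text \<open>
  Goedel numbers are assigned to raw expressions, and to the duplicate-free listings of
  raw substitutions.
\<close>

primrec code_arity :: "arity \<Rightarrow> nat" where
  "code_arity Base = 0"
| "code_arity (Arr \<alpha> \<beta>) = Suc (prod_encode (code_arity \<alpha>, code_arity \<beta>))"

primrec code_tm :: "var rtm \<Rightarrow> nat" and code_atm :: "var ratm \<Rightarrow> nat" where
  "code_tm (RAtom R) = prod_encode (0, code_atm R)"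
| "code_tm (RLam x M) = prod_encode (1, prod_encode (x, code_tm M))"
| "code_atm (RConst c) = prod_encode (0, c)"
| "code_atm (RVar x) = prod_encode (1, x)"
| "code_atm (RApp R M) = prod_encode (2, prod_encode (code_atm R, code_tm M))"

primrec code_aty :: "var raty \<Rightarrow> nat" where
  "code_aty (RTConst a) = prod_encode (0, a)"
| "code_aty (RTApp P M) = prod_encode (1, prod_encode (code_aty P, code_tm M))"

primrec code_ty :: "var rty \<Rightarrow> nat" where
  "code_ty (RTAtom P) = prod_encode (0, code_aty P)"
| "code_ty (RPi x A B) = prod_encode (1, prod_encode (x, prod_encode (code_ty A, code_ty B)))"

primrec code_kind :: "var rkind \<Rightarrow> nat" where
  "code_kind RType = 0"
| "code_kind (RKPi x A K) = Suc (prod_encode (x, prod_encode (code_ty A, code_kind K)))"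

type_synonym rctx = "(var \<times> var rty) list"

definition code_ctx :: "rctx \<Rightarrow> nat" where
  "code_ctx \<Gamma> = list_encode (map (\<lambda>(x, A). prod_encode (x, code_ty A)) \<Gamma>)"

definition abs_ctx :: "rctx \<Rightarrow> ctx" where
  "abs_ctx \<Gamma> = map (\<lambda>(x, A). (x, abs_ty A)) \<Gamma>"

type_synonym rsubst = "(var \<times> var rtm \<times> arity) list"

definition code_subst :: "rsubst \<Rightarrow> nat" where
  "code_subst s = list_encode
     (map (\<lambda>(x, M, \<alpha>). prod_encode (x, prod_encode (code_tm M, code_arity \<alpha>))) s)"

definition abs_subst :: "rsubst \<Rightarrow> subst" where
  "abs_subst s = (\<lambda>(x, M, \<alpha>). (x, abs_tm M, \<alpha>)) ` set s"

lemma code_arity_inject: "code_arity \<alpha> = code_arity \<beta> \<longleftrightarrow> \<alpha> = \<beta>"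
proof (induction \<alpha> arbitrary: \<beta>)
  case Base
  then show ?case by (cases \<beta>) auto
next
  case (Arr \<alpha>1 \<alpha>2)
  then show ?case by (cases \<beta>) (auto simp: prod_encode_eq)
qed

lemma code_tm_inject: "code_tm M = code_tm N \<longleftrightarrow> M = N"
  and code_atm_inject: "code_atm R = code_atm S \<longleftrightarrow> R = S"
proof (induction M and R arbitrary: N and S rule: rtm.induct ratm.induct)
  case (RAtom R)
  then show ?case by (cases N) (auto simp: prod_encode_eq)
next
  case (RLam x M)
  then show ?case by (cases N) (auto simp: prod_encode_eq)
next
  case (RConst c)
  then show ?case by (cases S) (auto simp: prod_encode_eq)
next
  case (RVar x)
  then show ?case by (cases S) (auto simp: prod_encode_eq)
next
  case (RApp R M)
  then show ?case by (cases S) (auto simp: prod_encode_eq)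
qed

lemma code_aty_inject: "code_aty P = code_aty Q \<longleftrightarrow> P = Q"
proof (induction P arbitrary: Q)
  case (RTConst a)
  then show ?case by (cases Q) (auto simp: prod_encode_eq)
next
  case (RTApp P M)
  then show ?case by (cases Q) (auto simp: prod_encode_eq code_tm_inject)
qed

lemma code_ty_inject: "code_ty A = code_ty B \<longleftrightarrow> A = B"
proof (induction A arbitrary: B)
  case (RTAtom P)
  then show ?case by (cases B) (auto simp: prod_encode_eq code_aty_inject)
next
  case (RPi x A1 A2)
  then show ?case by (cases B) (auto simp: prod_encode_eq)
qed

lemma code_kind_inject: "code_kind K = code_kind L \<longleftrightarrow> K = L"
proof (induction K arbitrary: L)
  case RType
  then show ?case by (cases L) auto
next
  case (RKPi x A K)
  then show ?case by (cases L) (auto simp: prod_encode_eq code_ty_inject)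
qed

lemma inj_code_ctx: "inj code_ctx"
proof -
  have "inj (\<lambda>(x, A). prod_encode (x, code_ty A))"
    by (auto simp: inj_on_def prod_encode_eq code_ty_inject)
  then show ?thesis
    by (auto simp: inj_on_def code_ctx_def list_encode_eq dest: map_injective)
qed

lemma inj_code_subst: "inj code_subst"
proof -
  have "inj (\<lambda>(x, M, \<alpha>). prod_encode (x, prod_encode (code_tm M, code_arity \<alpha>)))"
    by (auto simp: inj_on_def prod_encode_eq code_tm_inject code_arity_inject)
  then show ?thesis
    by (auto simp: inj_on_def code_subst_def list_encode_eq dest: map_injective)
qed

lemma is_subst_iff: "is_subst \<theta> \<longleftrightarrow> (\<exists>s. distinct (map fst s) \<and> abs_subst s = \<theta>)"
proof
  assume "is_subst \<theta>"
  then obtain ts where ts: "set ts = \<theta>" "distinct ts" "inj_on fst (set ts)"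
    unfolding is_subst_def by (metis finite_distinct_list)
  define s where "s = map (\<lambda>(x, M, \<alpha>). (x, rep_tm M, \<alpha>)) ts"
  have "map fst s = map fst ts" by (auto simp: s_def)
  then have "distinct (map fst s)" using ts by (simp add: distinct_map)
  moreover have "abs_subst s = \<theta>"
    using ts(1) by (auto simp: abs_subst_def s_def image_image case_prod_unfold
        Quotient_abs_rep[OF Quotient_tm])
  ultimately show "\<exists>s. distinct (map fst s) \<and> abs_subst s = \<theta>" by blast
next
  assume "\<exists>s. distinct (map fst s) \<and> abs_subst s = \<theta>"
  then show "is_subst \<theta>"
    by (force simp: is_subst_def abs_subst_def inj_on_def distinct_map)
qed

text \<open>
  \<open>decidable code cls J\<close>: the set of Goedel numbers of those pairs of a substitution and an
  expression for which \<open>J\<close> holds is recursive; \<open>code\<close> numbers the raw expressions and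
  \<open>cls\<close> maps a raw expression to the expression it represents.
\<close>

definition decidable ::
    "('r \<Rightarrow> nat) \<Rightarrow> ('r \<Rightarrow> 'e) \<Rightarrow> (subst \<Rightarrow> 'e \<Rightarrow> bool) \<Rightarrow> bool" where
  "decidable code cls J \<longleftrightarrow>
     decidable_set {prod_encode (code_subst s, code e) | s e.
       distinct (map fst s) \<and> J (abs_subst s) (cls e)}"

end

theory Submission
  imports Defs "HOL-Library.Infinite_Set"
begin

text \<open>
  Uniqueness is proved by induction on derivations. When two derivations open a binder with
  different names, both are moved to a common fresh name by equivariance; in a redex, the result
  of the inner substitution is invariant under renaming the single variable of its domain.

  For decidability, hereditary substitution is evaluated directly on Goedel numbers, choosing at
  each binder a name that exceeds all numbers in sight. The evaluation terminates because the
  substitution performed in a redex has a strictly smaller arity, and every other call has a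
  smaller code. The recursion equations define a partial recursive function as the least fixed
  point of a computable functional, so termination on the relevant inputs is all that is needed.
\<close>

section \<open>Closure properties of the recursive functions\<close>

text \<open>\<open>Lam\<close>, \<open>Pi\<close> and \<open>KPi\<close> are not injective, so
  inverting a derivation returns a binder name of its own. Agreement at all but finitely many names
  is the form of equality of abstractions that survives symmetry and transitivity and combines with
  further freshness conditions. Nothing is typed, so termination rests on the arities in the
  substitution: the arity of a canonical result is a part of a stored arity. If all stored arities
  have size at most \<open>k\<close>, so have those of all results, and a redex substitutes at the
  domain of an \<open>Arr\<close>, whose size is below \<open>k\<close>. Minimization is available
  only for searches that always succeed. Evaluation is therefore guarded by a recursive test that
  the first component codes a substitution; whether the second codes an expression is settled by the
  evaluation, which answers 0 on other numbers. Under a binder a fresh name can be chosen, but the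
  names of a context are fixed, so their freshness has to be tested.\<close>

abbreviation recursive1 :: "(nat \<Rightarrow> nat) \<Rightarrow> bool" where
  "recursive1 f \<equiv> recursive 1 (\<lambda>xs. f (xs ! 0))"

abbreviation recursive2 :: "(nat \<Rightarrow> nat \<Rightarrow> nat) \<Rightarrow> bool" where
  "recursive2 f \<equiv> recursive 2 (\<lambda>xs. f (xs ! 0) (xs ! 1))"

lemma recursive_cong:
  "recursive n f \<Longrightarrow> (\<And>xs. length xs = n \<Longrightarrow> f xs = g xs) \<Longrightarrow> recursive n g"
  by (blast intro: rec_ext)

lemma recursive1_comp:
  assumes "recursive1 f" "recursive n g"
  shows "recursive n (\<lambda>xs. f (g xs))"
  using rec_comp[of "[g]" "\<lambda>xs. f (xs ! 0)" n] assms by simp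

lemma recursive2_comp:
  assumes "recursive2 f" "recursive n g" "recursive n h"
  shows "recursive n (\<lambda>xs. f (g xs) (h xs))"
  using rec_comp[of "[g, h]" "\<lambda>xs. f (xs ! 0) (xs ! 1)" n] assms by (simp add: numeral_2_eq_2)

lemma recursive_Suc: "recursive n f \<Longrightarrow> recursive n (\<lambda>xs. Suc (f xs))"
  by (rule recursive1_comp[OF rec_succ])

lemma recursive_const: "recursive n (\<lambda>xs. c)"
  by (induction c) (auto intro: rec_zero recursive_Suc)

text \<open>Primitive recursion with a single parameter: several parameters are packed by pairing,
  and outer arguments enter by composition.\<close>

lemma recursive_rec_nat:
  assumes f: "recursive1 f"
    and g: "recursive 3 (\<lambda>xs. g (xs ! 0) (xs ! 1) (xs ! 2))"
    and a: "recursive n a" and b: "recursive n b"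
  shows "recursive n (\<lambda>xs. rec_nat (f (b xs)) (\<lambda>k r. g k r (b xs)) (a xs))"
proof (rule recursive2_comp[OF _ a b, where f = "\<lambda>a b. rec_nat (f b) (\<lambda>k r. g k r b) a"])
  have "recursive (Suc 1) (\<lambda>xs. rec_nat (f (tl xs ! 0)) (\<lambda>k r. g ((k # r # tl xs) ! 0)
      ((k # r # tl xs) ! 1) ((k # r # tl xs) ! 2)) (hd xs))"
    using rec_prim[of 1 "\<lambda>xs. f (xs ! 0)" "\<lambda>xs. g (xs ! 0) (xs ! 1) (xs ! 2)"] f g
    by (simp add: numeral_3_eq_3)
  then have "recursive 2 (\<lambda>xs. rec_nat (f (tl xs ! 0)) (\<lambda>k r. g ((k # r # tl xs) ! 0)
      ((k # r # tl xs) ! 1) ((k # r # tl xs) ! 2)) (hd xs))"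
    by (simp add: numeral_2_eq_2)
  then show "recursive2 (\<lambda>a b. rec_nat (f b) (\<lambda>k r. g k r b) a)"
    by (rule recursive_cong) (auto simp: numeral_2_eq_2 length_Suc_conv)
qed

lemma recursive_add:
  assumes "recursive n f" "recursive n g"
  shows "recursive n (\<lambda>xs. f xs + g xs)"
proof -
  have "rec_nat p (\<lambda>k. Suc) m = m + p" for m p :: nat by (induction m) auto
  then show ?thesis
    using recursive_rec_nat[of "\<lambda>x. x" "\<lambda>k r p. Suc r", OF _ _ assms]
    by (simp add: rec_proj recursive_Suc)
qed

lemma recursive_pred: "recursive n f \<Longrightarrow> recursive n (\<lambda>xs. f xs - 1)"
proof -
  assume f: "recursive n f"
  have "rec_nat 0 (\<lambda>k r. k) m = m - 1" for m :: nat by (cases m) auto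
  then show ?thesis
    using recursive_rec_nat[of "\<lambda>x. 0" "\<lambda>k r p. k", OF _ _ f f] by (simp add: rec_proj rec_zero)
qed

lemma recursive_diff:
  assumes "recursive n f" "recursive n g"
  shows "recursive n (\<lambda>xs. f xs - g xs)"
proof -
  have "rec_nat p (\<lambda>k r. r - 1) m = p - m" for m p :: nat by (induction m) auto
  then show ?thesis
    using recursive_rec_nat[of "\<lambda>x. x" "\<lambda>k r p. r - 1", OF _ _ assms(2,1)]
    by (simp add: rec_proj recursive_pred[simplified])
qed

lemma recursive_mult:
  assumes "recursive n f" "recursive n g"
  shows "recursive n (\<lambda>xs. f xs * g xs)"
proof -
  have "rec_nat 0 (\<lambda>k r. r + p) m = m * p" for m p :: nat by (induction m) auto
  then show ?thesis
    using recursive_rec_nat[of "\<lambda>x. 0" "\<lambda>k r p. r + p", OF _ _ assms]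
    by (simp add: rec_proj rec_zero recursive_add)
qed

lemma recursive_triangle: "recursive n f \<Longrightarrow> recursive n (\<lambda>xs. triangle (f xs))"
proof -
  assume f: "recursive n f"
  have "rec_nat 0 (\<lambda>k r. r + Suc k) m = triangle m" for m by (induction m) auto
  then show ?thesis
    using recursive_rec_nat[of "\<lambda>x. 0" "\<lambda>k r p. r + Suc k", OF _ _ f f]
    by (simp add: rec_proj rec_zero recursive_add recursive_Suc del: add_Suc_right)
qed

lemma recursive_pair:
  assumes "recursive n f" "recursive n g"
  shows "recursive n (\<lambda>xs. prod_encode (f xs, g xs))"
  unfolding prod_encode_def by (auto intro!: recursive_add recursive_triangle assms)

lemma recursive1_Least:
  assumes "recursive2 f" "\<And>n. \<exists>k. f k n = 0"
  shows "recursive1 (\<lambda>n. LEAST k. f k n = 0)"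
proof -
  have "recursive 1 (\<lambda>xs. LEAST k. f ((k # xs) ! 0) ((k # xs) ! 1) = 0)"
    using rec_mu[of 1 "\<lambda>xs. f (xs ! 0) (xs ! 1)"] assms by (simp add: numeral_2_eq_2)
  then show ?thesis by simp
qed

section \<open>Projections of the pairing function\<close>

definition pfst :: "nat \<Rightarrow> nat" where "pfst n = fst (prod_decode n)"
definition psnd :: "nat \<Rightarrow> nat" where "psnd n = snd (prod_decode n)"

lemma pfst_pair [simp]: "pfst (prod_encode (a, b)) = a"
  and psnd_pair [simp]: "psnd (prod_encode (a, b)) = b"
  and pair_pfst_psnd [simp]: "prod_encode (pfst n, psnd n) = n"
  by (simp_all add: pfst_def psnd_def)

lemma pair_cases: obtains a b where "n = prod_encode (a, b)"
  by (metis pair_pfst_psnd)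

lemma triangle_mono: "a \<le> b \<Longrightarrow> triangle a \<le> triangle b"
  by (induction b) (auto simp: le_Suc_eq)

text \<open>\<open>prod_encode (a, b)\<close> is \<open>triangle (a + b) + a\<close>, so
  \<open>a + b\<close> is the least \<open>k\<close> with \<open>n < triangle (Suc k)\<close>.
  Truncated subtraction turns this inequality into an equation with 0, the form that
  \<open>rec_mu\<close> searches.\<close>

lemma pfst_eq: "pfst n = n - triangle (LEAST k. Suc n - triangle (Suc k) = 0)"
  and psnd_eq: "psnd n = (LEAST k. Suc n - triangle (Suc k) = 0) - pfst n"
proof -
  obtain a b where n: "n = prod_encode (a, b)" by (rule pair_cases)
  have "(LEAST k. Suc n - triangle (Suc k) = 0) = a + b"
  proof (rule Least_equality)
    show "Suc n - triangle (Suc (a + b)) = 0" by (simp add: n prod_encode_def)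
  next
    fix k assume "Suc n - triangle (Suc k) = 0"
    then have "n < triangle (Suc k)" by simp
    moreover have "triangle (a + b) \<le> n" by (simp add: n prod_encode_def)
    ultimately have "\<not> Suc k \<le> a + b" using triangle_mono[of "Suc k" "a + b"] by linarith
    then show "a + b \<le> k" by simp
  qed
  then show "pfst n = n - triangle (LEAST k. Suc n - triangle (Suc k) = 0)"
    and "psnd n = (LEAST k. Suc n - triangle (Suc k) = 0) - pfst n"
    by (simp_all only: n pfst_pair psnd_pair) (simp_all add: prod_encode_def)
qed

lemma recursive1_pfst: "recursive1 pfst" and recursive1_psnd: "recursive1 psnd"
proof -
  have "\<exists>k. Suc n - triangle (Suc k) = 0" for n by (rule exI[of _ n]) simp
  moreover have "recursive2 (\<lambda>k n. Suc n - triangle (Suc k))"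
    by (intro recursive_diff recursive_Suc recursive_triangle rec_proj) auto
  ultimately have L: "recursive1 (\<lambda>n. LEAST k. Suc n - triangle (Suc k) = 0)"
    by (intro recursive1_Least) auto
  show fst: "recursive1 pfst"
    by (subst pfst_eq) (intro recursive_diff recursive_triangle rec_proj L, simp)
  show "recursive1 psnd"
    by (subst psnd_eq) (intro recursive_diff L fst)
qed

lemmas recursive_pfst = recursive1_comp[OF recursive1_pfst]
lemmas recursive_psnd = recursive1_comp[OF recursive1_psnd]

section \<open>Decidable predicates and case distinction\<close>

definition decides :: "nat \<Rightarrow> (nat list \<Rightarrow> bool) \<Rightarrow> bool" where
  "decides n P \<longleftrightarrow> recursive n (\<lambda>xs. if P xs then 1 else 0)"

lemma recursive_if:
  assumes "decides n P" "recursive n f" "recursive n g"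
  shows "recursive n (\<lambda>xs. if P xs then f xs else g xs)"
proof -
  have "recursive n (\<lambda>xs. (if P xs then 1 else 0) * f xs + (1 - (if P xs then 1 else 0)) * g xs)"
    using assms unfolding decides_def
    by (intro recursive_add recursive_mult recursive_diff recursive_const)
  then show ?thesis by (rule recursive_cong) auto
qed

lemma decides_eq:
  assumes "recursive n f" "recursive n g"
  shows "decides n (\<lambda>xs. f xs = g xs)"
proof -
  have "recursive n (\<lambda>xs. 1 - ((f xs - g xs) + (g xs - f xs)))"
    using assms by (intro recursive_add recursive_diff recursive_const)
  then show ?thesis unfolding decides_def by (rule recursive_cong) auto
qed

lemma decides_not: "decides n P \<Longrightarrow> decides n (\<lambda>xs. \<not> P xs)"
  unfolding decides_def
  by (rule recursive_cong[OF recursive_diff[OF recursive_const[of n 1]]]) auto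

lemma decides_conj:
  assumes "decides n P" "decides n Q"
  shows "decides n (\<lambda>xs. P xs \<and> Q xs)"
  using recursive_if[OF assms(1) assms(2)[unfolded decides_def] recursive_const[of n 0]]
  unfolding decides_def by (rule recursive_cong) auto

lemma decides_disj:
  assumes "decides n P" "decides n Q"
  shows "decides n (\<lambda>xs. P xs \<or> Q xs)"
  using recursive_if[OF assms(1) recursive_const[of n 1] assms(2)[unfolded decides_def]]
  unfolding decides_def by (rule recursive_cong) auto

lemma recursive_funpow:
  assumes "recursive1 f" "recursive n a" "recursive n b"
  shows "recursive n (\<lambda>xs. (f ^^ a xs) (b xs))"
proof -
  have "rec_nat p (\<lambda>k. f) m = (f ^^ m) p" for m p by (induction m) auto
  then show ?thesis
    using recursive_rec_nat[of "\<lambda>x. x" "\<lambda>k r p. f r", OF _ _ assms(2,3)]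
    by (simp add: rec_proj recursive1_comp[OF assms(1)])
qed

lemmas recursive_intros = recursive_Suc recursive_pred recursive_pair recursive_pfst
  recursive_psnd recursive_if decides_eq decides_not decides_conj decides_disj
  recursive_const rec_proj

section \<open>Folds over coded lists\<close>

text \<open>The state is the triple of remaining list, accumulator and outer argument. A nonempty
  list has a code \<open>Suc (prod_encode (a, rest))\<close>, so a first component 0 means that the
  list is exhausted; such a state is a fixed point, and surplus iterations are harmless.\<close>

definition fold_step :: "(nat \<Rightarrow> nat \<Rightarrow> nat \<Rightarrow> nat) \<Rightarrow> nat \<Rightarrow> nat" where
  "fold_step h st = (if pfst st = 0 then st else prod_encode (psnd (pfst st - 1),
     prod_encode (h (pfst (psnd st)) (pfst (pfst st - 1)) (psnd (psnd st)), psnd (psnd st))))"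

lemma fold_step_Nil: "(fold_step h ^^ k) (prod_encode (0, y)) = prod_encode (0, y)"
  by (induction k) (auto simp: fold_step_def)

lemma fold_step_funpow:
  "length as \<le> k \<Longrightarrow>
    (fold_step h ^^ k) (prod_encode (list_encode as, prod_encode (acc, e))) =
      prod_encode (0, prod_encode (foldl (\<lambda>acc a. h acc a e) acc as, e))"
proof (induction as arbitrary: acc k)
  case (Cons a as)
  then obtain k' where "k = Suc k'" "length as \<le> k'" by (cases k) auto
  then show ?case
    using Cons.IH[of k'] by (simp add: funpow_Suc_right fold_step_def del: funpow.simps)
qed (simp add: fold_step_Nil)

lemma length_le_list_encode: "length as \<le> list_encode as"
  by (induction as) (auto intro: order_trans[OF _ le_prod_encode_2])

text \<open>The code of a list bounds its length, so \<open>f n\<close> iterations of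
  \<open>fold_step\<close> exhaust the list coded by \<open>f n\<close>.\<close>

lemma recursive1_foldl:
  assumes h: "recursive1 (\<lambda>m. h (pfst (pfst m)) (psnd (pfst m)) (psnd m))"
    and f: "recursive1 f" and g: "recursive1 g"
  shows "recursive1 (\<lambda>n. foldl (\<lambda>acc a. h acc a n) (g n) (list_decode (f n)))"
proof -
  have h': "recursive n (\<lambda>xs. h (a xs) (b xs) (c xs))"
    if "recursive n a" "recursive n b" "recursive n c" for n a b c
    using recursive1_comp[OF h recursive_pair[OF recursive_pair[OF that(1,2)] that(3)]] by simp
  have "recursive1 (fold_step h)"
    unfolding fold_step_def by (intro recursive_intros h') auto
  then have "recursive1 (\<lambda>n. pfst (psnd ((fold_step h ^^ f n)
      (prod_encode (f n, prod_encode (g n, n))))))"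
    by (intro recursive_intros recursive_funpow f g) auto
  moreover have "(fold_step h ^^ f n) (prod_encode (f n, prod_encode (g n, n))) =
      prod_encode (0, prod_encode (foldl (\<lambda>acc a. h acc a n) (g n) (list_decode (f n)), n))" for n
    using fold_step_funpow[of "list_decode (f n)" "f n" h "g n" n]
      length_le_list_encode[of "list_decode (f n)"] by simp
  ultimately show ?thesis by simp
qed


section \<open>Partial recursive functions as least fixed points\<close>

text \<open>
  The least fixed point is recursive wherever it is defined: its value at an argument is read
  off the first list of pairs every entry of which follows from the later ones.
\<close>

type_synonym pfun = "nat \<Rightarrow> nat option"

text \<open>The rules form a small language of recursion equations. Only a call consults
  \<open>F\<close>, which makes every such functional monotone and each of its values dependent on
  finitely many values of \<open>F\<close>. \<open>functional_bind'\<close> hands the continuation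
  the pair of input and intermediate value, so that it is again a functional of one number.\<close>

inductive functional :: "(pfun \<Rightarrow> pfun) \<Rightarrow> bool" where
  functional_Some: "recursive1 g \<Longrightarrow> functional (\<lambda>F n. Some (g n))"
| functional_call: "recursive1 g \<Longrightarrow> functional (\<lambda>F n. F (g n))"
| functional_bind': "functional \<Phi> \<Longrightarrow> functional \<Psi> \<Longrightarrow>
    functional (\<lambda>F n. Option.bind (\<Phi> F n) (\<lambda>v. \<Psi> F (prod_encode (n, v))))"
| functional_if: "decides 1 (\<lambda>xs. P (xs ! 0)) \<Longrightarrow> functional \<Phi> \<Longrightarrow> functional \<Psi> \<Longrightarrow>
    functional (\<lambda>F n. if P n then \<Phi> F n else \<Psi> F n)"

lemma functional_bind:
  assumes "functional \<Phi>" "functional (\<lambda>F m. \<Psi> F (pfst m) (psnd m))"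
  shows "functional (\<lambda>F n. Option.bind (\<Phi> F n) (\<lambda>v. \<Psi> F n v))"
  using functional_bind'[OF assms] by simp

lemma map_le_Some: "T \<subseteq>\<^sub>m T' \<Longrightarrow> T n = Some v \<Longrightarrow> T' n = Some v"
  by (metis domI map_le_def)

lemma map_leI: "(\<And>n v. T n = Some v \<Longrightarrow> T' n = Some v) \<Longrightarrow> T \<subseteq>\<^sub>m T'"
  by (auto simp: map_le_def)

lemma functional_mono: "functional \<Phi> \<Longrightarrow> T \<subseteq>\<^sub>m T' \<Longrightarrow> \<Phi> T \<subseteq>\<^sub>m \<Phi> T'"
proof (induction arbitrary: rule: functional.induct)
  case (functional_bind' \<Phi> \<Psi>)
  then show ?case by (fastforce simp: map_le_def dom_def split: Option.bind_split)
qed (auto simp: map_le_def dom_def)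

text \<open>A call consults one point, and a sequence of two computations consults the union of
  their points; by monotonicity both still succeed on the union.\<close>

lemma functional_finite:
  "functional \<Phi> \<Longrightarrow> \<Phi> T n = Some v \<Longrightarrow> \<exists>A. finite A \<and> A \<subseteq> dom T \<and> \<Phi> (T |` A) n = Some v"
proof (induction arbitrary: n v rule: functional.induct)
  case (functional_Some g)
  then show ?case by auto
next
  case (functional_call g)
  then show ?case by (intro exI[of _ "{g n}"]) auto
next
  case (functional_bind' \<Phi> \<Psi>)
  from functional_bind'.prems obtain u where
    "\<Phi> T n = Some u" and u: "\<Psi> T (prod_encode (n, u)) = Some v" by (auto simp: bind_eq_Some_conv)
  with functional_bind'.IH(1) obtain A where
    A: "finite A" "A \<subseteq> dom T" "\<Phi> (T |` A) n = Some u" by blast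
  from functional_bind'.IH(2)[OF u] obtain B where
    B: "finite B" "B \<subseteq> dom T" "\<Psi> (T |` B) (prod_encode (n, u)) = Some v" by blast
  have "\<Phi> (T |` (A \<union> B)) n = Some u"
    using A(3) by (rule map_le_Some[OF functional_mono[OF functional_bind'.hyps(1)], rotated])
      (auto simp: map_le_def)
  moreover have "\<Psi> (T |` (A \<union> B)) (prod_encode (n, u)) = Some v"
    using B(3) by (rule map_le_Some[OF functional_mono[OF functional_bind'.hyps(2)], rotated])
      (auto simp: map_le_def)
  ultimately show ?case using A B by (intro exI[of _ "A \<union> B"]) auto
next
  case (functional_if P \<Phi> \<Psi>)
  then show ?case by (cases "P n") auto
qed

inductive table :: "(pfun \<Rightarrow> pfun) \<Rightarrow> (nat \<times> nat) list \<Rightarrow> bool" for \<Phi> where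
  table_Nil: "table \<Phi> []"
| table_Cons: "table \<Phi> xs \<Longrightarrow> \<Phi> (map_of xs) n = Some v \<Longrightarrow> table \<Phi> ((n, v) # xs)"

definition stage :: "(pfun \<Rightarrow> pfun) \<Rightarrow> nat \<Rightarrow> pfun" where
  "stage \<Phi> k = (\<Phi> ^^ k) Map.empty"

text \<open>The union of the finite stages. For a functional of the language the stages increase, so
  all stages defined at \<open>n\<close> give the same value.\<close>

definition lfpf :: "(pfun \<Rightarrow> pfun) \<Rightarrow> pfun" where
  "lfpf \<Phi> n = (if \<exists>k. stage \<Phi> k n \<noteq> None then stage \<Phi> (SOME k. stage \<Phi> k n \<noteq> None) n else None)"

context
  fixes \<Phi> :: "pfun \<Rightarrow> pfun"
  assumes func: "functional \<Phi>"
begin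

lemma stage_mono: "i \<le> j \<Longrightarrow> stage \<Phi> i \<subseteq>\<^sub>m stage \<Phi> j"
proof -
  have "stage \<Phi> k \<subseteq>\<^sub>m stage \<Phi> (Suc k)" for k
    by (induction k) (auto simp: stage_def functional_mono[OF func])
  then show "i \<le> j \<Longrightarrow> stage \<Phi> i \<subseteq>\<^sub>m stage \<Phi> j"
    by (induction j) (auto simp: le_Suc_eq intro: map_le_trans)
qed

lemma lfpf_eq_Some: "lfpf \<Phi> n = Some v \<longleftrightarrow> (\<exists>k. stage \<Phi> k n = Some v)"
proof -
  have unique: "u = v" if "stage \<Phi> i n = Some u" "stage \<Phi> j n = Some v" for i j u v
    using stage_mono[of i j] stage_mono[of j i] that
    by (cases i j rule: le_cases) (force simp: map_le_def dom_def)+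
  show ?thesis
  proof (cases "\<exists>k. stage \<Phi> k n \<noteq> None")
    case True
    then have "stage \<Phi> (SOME k. stage \<Phi> k n \<noteq> None) n \<noteq> None" by (rule someI_ex)
    with True show ?thesis unfolding lfpf_def by (auto intro: unique)
  qed (auto simp: lfpf_def)
qed

lemma stage_le_lfpf: "stage \<Phi> k \<subseteq>\<^sub>m lfpf \<Phi>"
  by (rule map_leI) (auto simp: lfpf_eq_Some)

lemma lfpf_unfold: "lfpf \<Phi> n = \<Phi> (lfpf \<Phi>) n"
proof -
  have "lfpf \<Phi> n = Some v \<longleftrightarrow> \<Phi> (lfpf \<Phi>) n = Some v" for v
  proof
    assume "lfpf \<Phi> n = Some v"
    then obtain k where "stage \<Phi> k n = Some v" by (auto simp: lfpf_eq_Some)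
    then have "stage \<Phi> (Suc k) n = Some v"
      using stage_mono[of k "Suc k"] by (force simp: map_le_def dom_def)
    then have "\<Phi> (stage \<Phi> k) n = Some v" by (simp add: stage_def)
    then show "\<Phi> (lfpf \<Phi>) n = Some v"
      using functional_mono[OF func stage_le_lfpf[of k]] by (force simp: map_le_def dom_def)
  next
    assume "\<Phi> (lfpf \<Phi>) n = Some v"
    from functional_finite[OF func this] obtain A where
      A: "finite A" "A \<subseteq> dom (lfpf \<Phi>)" "\<Phi> (lfpf \<Phi> |` A) n = Some v" by blast
    \<comment> \<open>Continuity: a finite part of the limit already lies in one stage, because the
      stages increase, and then the next stage contains the value.\<close>
    from A(1,2) have "\<exists>k. lfpf \<Phi> |` A \<subseteq>\<^sub>m stage \<Phi> k"
    proof (induction A rule: finite_induct)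
      case (insert a A)
      then obtain k where k: "lfpf \<Phi> |` A \<subseteq>\<^sub>m stage \<Phi> k" by auto
      from insert.prems obtain u where "lfpf \<Phi> a = Some u" by auto
      then obtain j where u: "lfpf \<Phi> a = Some u" "stage \<Phi> j a = Some u"
        by (auto simp: lfpf_eq_Some)
      have "lfpf \<Phi> |` insert a A \<subseteq>\<^sub>m stage \<Phi> (max j k)"
        using k u stage_mono[of j "max j k"] stage_mono[of k "max j k"]
        by (auto simp: map_le_def dom_def restrict_map_def)
      then show ?case ..
    qed (auto simp: map_le_def)
    then obtain k where "lfpf \<Phi> |` A \<subseteq>\<^sub>m stage \<Phi> k" ..
    from functional_mono[OF func this] A(3) have "stage \<Phi> (Suc k) n = Some v"
      by (force simp: map_le_def dom_def stage_def)
    then show "lfpf \<Phi> n = Some v" by (auto simp: lfpf_eq_Some)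
  qed
  then show ?thesis by (metis option.exhaust)
qed

lemma table_le_lfpf: "table \<Phi> xs \<Longrightarrow> map_of xs \<subseteq>\<^sub>m lfpf \<Phi>"
proof (induction rule: table.induct)
  case (table_Cons xs n v)
  then have "\<Phi> (lfpf \<Phi>) n = Some v"
    using functional_mono[OF func table_Cons.IH] by (force simp: map_le_def dom_def)
  with table_Cons.IH show ?case by (auto simp: map_le_def lfpf_unfold[of n])
qed simp

text \<open>Entries put behind a table only add information, since \<open>map_of\<close> prefers the
  front list; by monotonicity each entry keeps its justification.\<close>

lemma table_append: "table \<Phi> xs \<Longrightarrow> table \<Phi> ys \<Longrightarrow> table \<Phi> (xs @ ys)"
proof (induction rule: table.induct)
  case (table_Cons xs n v)
  have "map_of xs \<subseteq>\<^sub>m map_of (xs @ ys)" by (simp add: map_le_iff_map_add_commute table_Cons)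
  from functional_mono[OF func this] table_Cons show ?case
    by (force intro: table.table_Cons simp: map_le_def dom_def)
qed simp

text \<open>A value at stage \<open>Suc k\<close> consults finitely many values of stage
  \<open>k\<close>. Concatenating tables for these justifies one more entry in front.\<close>

lemma lfpf_table: "lfpf \<Phi> n = Some v \<Longrightarrow> \<exists>xs. table \<Phi> xs \<and> map_of xs n = Some v"
proof -
  have "stage \<Phi> k n = Some v \<Longrightarrow> \<exists>xs. table \<Phi> xs \<and> map_of xs n = Some v" for k
  proof (induction k arbitrary: n v)
    case (Suc k)
    from Suc.prems have "\<Phi> (stage \<Phi> k) n = Some v" by (simp add: stage_def)
    from functional_finite[OF func this] obtain A where
      A: "finite A" "A \<subseteq> dom (stage \<Phi> k)" "\<Phi> (stage \<Phi> k |` A) n = Some v" by blast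
    from A(1,2) have "\<exists>xs. table \<Phi> xs \<and> A \<subseteq> dom (map_of xs)"
    proof (induction A rule: finite_induct)
      case (insert a A)
      then obtain xs where xs: "table \<Phi> xs" "A \<subseteq> dom (map_of xs)" by auto
      from insert.prems obtain u where "stage \<Phi> k a = Some u" by auto
      from Suc.IH[OF this] obtain ys where ys: "table \<Phi> ys" "map_of ys a = Some u" by blast
      then show ?case using xs table_append[OF xs(1) ys(1)] by (intro exI[of _ "xs @ ys"]) auto
    qed (auto intro: table_Nil)
    then obtain xs where xs: "table \<Phi> xs" "A \<subseteq> dom (map_of xs)" by blast
    \<comment> \<open>The stage and the table are both contained in \<open>lfpf \<Phi>\<close>, so
      they agree wherever both are defined.\<close>
    have "stage \<Phi> k |` A \<subseteq>\<^sub>m map_of xs"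
      using xs(2) table_le_lfpf[OF xs(1)] stage_le_lfpf[of k]
      by (fastforce simp: map_le_def dom_def restrict_map_def)
    from functional_mono[OF func this] A(3) have "\<Phi> (map_of xs) n = Some v"
      by (force simp: map_le_def dom_def)
    then show ?case using xs(1) by (intro exI[of _ "(n, v) # xs"]) (auto intro: table_Cons)
  qed (simp add: stage_def)
  then show "lfpf \<Phi> n = Some v \<Longrightarrow> \<exists>xs. table \<Phi> xs \<and> map_of xs n = Some v"
    by (auto simp: lfpf_eq_Some)
qed

end

section \<open>Searching for tables by their codes\<close>

definition code_opt :: "nat option \<Rightarrow> nat" where
  "code_opt p = (case p of None \<Rightarrow> 0 | Some v \<Rightarrow> Suc v)"

lemma code_opt_simps [simp]: "code_opt None = 0" "code_opt (Some v) = Suc v"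
  "code_opt p = 0 \<longleftrightarrow> p = None" "code_opt p = Suc v \<longleftrightarrow> p = Some v"
  by (auto simp: code_opt_def split: option.splits)

definition lookup :: "nat \<Rightarrow> nat \<Rightarrow> nat" where
  "lookup t k = foldl (\<lambda>acc a. if acc = 0 \<and> pfst a = k then Suc (psnd a) else acc) 0 (list_decode t)"

lemma lookup_list_encode: "lookup (list_encode (map prod_encode xs)) k = code_opt (map_of xs k)"
proof -
  have "foldl (\<lambda>acc a. if acc = 0 \<and> pfst a = k then Suc (psnd a) else acc) acc (map prod_encode xs) =
      (if acc = 0 then code_opt (map_of xs k) else acc)" for acc
    by (induction xs arbitrary: acc) auto
  then show ?thesis by (simp add: lookup_def)
qed

lemma list_decode_cases: obtains xs where "t = list_encode (map prod_encode xs)"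
proof
  show "t = list_encode (map prod_encode (map prod_decode (list_decode t)))"
    by (simp add: comp_def)
qed

lemma recursive1_lookup: "recursive1 f \<Longrightarrow> recursive1 g \<Longrightarrow> recursive1 (\<lambda>n. lookup (f n) (g n))"
  unfolding lookup_def
  by (rule recursive1_foldl[where h = "\<lambda>acc a n. if acc = 0 \<and> pfst a = g n then Suc (psnd a) else acc"])
    (intro recursive_intros | erule recursive1_comp | simp)+

lemma recursive_lookup:
  assumes "recursive n f" "recursive n g"
  shows "recursive n (\<lambda>xs. lookup (f xs) (g xs))"
  using recursive1_comp[OF recursive1_lookup[OF recursive1_pfst recursive1_psnd]
      recursive_pair[OF assms]] by simp

abbreviation map_of_code :: "nat \<Rightarrow> pfun" where
  "map_of_code t \<equiv> map_of (map prod_decode (list_decode t))"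

text \<open>A coded table stands in for \<open>F\<close>, so a call becomes a \<open>lookup\<close>,
  and one step of the functional is an ordinary total recursive function with 0 for an undefined
  value.\<close>

lemma recursive1_functional:
  "functional \<Phi> \<Longrightarrow> recursive1 (\<lambda>m. code_opt (\<Phi> (map_of_code (pfst m)) (psnd m)))"
proof (induction rule: functional.induct)
  case (functional_Some g)
  then have "recursive1 (\<lambda>m. g (psnd m))"
    by (rule recursive1_comp) (rule recursive1_psnd)
  then show ?case by (simp add: recursive_Suc)
next
  case (functional_call g)
  have "code_opt (map_of_code t n) = lookup t n" for t n
    by (rule list_decode_cases[of t]) (simp add: lookup_list_encode comp_def)
  then show ?case
    by (simp only:) (intro recursive_lookup recursive1_comp[OF functional_call] recursive_intros, simp_all)
next
  case (functional_bind' \<Phi> \<Psi>)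
  let ?\<phi> = "\<lambda>m. code_opt (\<Phi> (map_of_code (pfst m)) (psnd m))"
  let ?\<psi> = "\<lambda>m. code_opt (\<Psi> (map_of_code (pfst m)) (psnd m))"
  have "recursive1 (\<lambda>m. if ?\<phi> m = 0 then 0
      else ?\<psi> (prod_encode (pfst m, prod_encode (psnd m, ?\<phi> m - 1))))"
    by (intro recursive_if decides_eq recursive_const functional_bind'.IH
      recursive1_comp[OF functional_bind'.IH(2)] recursive_intros) simp_all
  then show ?case
    by (rule recursive_cong) (auto split: Option.bind_split)
next
  case (functional_if P \<Phi> \<Psi>)
  have "decides 1 (\<lambda>xs. P (psnd (xs ! 0)))"
    using recursive1_comp[OF functional_if.hyps(1)[unfolded decides_def] recursive1_psnd]
    unfolding decides_def by simp
  from recursive_if[OF this functional_if.IH] show ?case by (rule recursive_cong) auto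
qed

text \<open>The accumulator is the successor of the code of the table accepted so far, or 0 after a
  failed entry. Each entry is put in front of the earlier ones, so \<open>w\<close> lists the
  entries in order of justification, the reverse of the order in \<open>table\<close>.\<close>

definition check_table :: "(nat \<Rightarrow> nat) \<Rightarrow> nat \<Rightarrow> nat" where
  "check_table \<phi> w = foldl (\<lambda>acc a.
      if acc \<noteq> 0 \<and> \<phi> (prod_encode (acc - 1, pfst a)) = Suc (psnd a)
      then Suc (Suc (prod_encode (a, acc - 1))) else 0) 1 (list_decode w)"

lemma check_table_eq_Suc:
  assumes \<phi>: "\<And>m. \<phi> m = code_opt (\<Phi> (map_of_code (pfst m)) (psnd m))"
  shows "check_table \<phi> w = Suc t \<longleftrightarrow>
    (\<exists>xs. table \<Phi> xs \<and> w = list_encode (map prod_encode (rev xs)) \<and>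
      t = list_encode (map prod_encode xs))"
proof -
  have [simp]: "prod_decode \<circ> prod_encode = id" by auto
  have "check_table \<phi> (list_encode (map prod_encode (rev xs))) =
      (if table \<Phi> xs then Suc (list_encode (map prod_encode xs)) else 0)" for xs
  proof (induction xs)
    case Nil
    then show ?case by (simp add: check_table_def table_Nil)
  next
    case (Cons x xs)
    obtain n v where x: "x = (n, v)" by fastforce
    have "table \<Phi> (x # xs) \<longleftrightarrow> table \<Phi> xs \<and> \<Phi> (map_of xs) n = Some v"
      by (auto simp: x table.simps[of _ "_ # _"])
    then show ?case using Cons
      by (simp add: check_table_def x \<phi> del: list_encode.simps(2)) simp
  qed
  note check = this[of "rev xs" for xs, simplified]
  obtain xs where "w = list_encode (map prod_encode xs)" by (rule list_decode_cases)
  then show ?thesis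
    using check[of xs] by (auto simp: list_encode_eq inj_map_eq_map[OF inj_prod_encode])
qed

lemma recursive1_check_table: "recursive1 \<phi> \<Longrightarrow> recursive1 f \<Longrightarrow> recursive1 (\<lambda>n. check_table \<phi> (f n))"
  unfolding check_table_def
  by (rule recursive1_foldl) (intro recursive_intros | erule recursive1_comp | simp)+

text \<open>The value is found by searching for the first coded table that contains
  \<open>g n\<close>. The fixed point is known to be defined only where \<open>P\<close> holds,
  while minimization demands success for every \<open>n\<close>; a decidable \<open>P\<close> allows
  the search to be cut short elsewhere.\<close>

theorem recursive1_lfpf:
  assumes \<Phi>: "functional \<Phi>" and P: "decides 1 (\<lambda>xs. P (xs ! 0))" and g: "recursive1 g"
    and total: "\<And>n. P n \<Longrightarrow> \<exists>v. lfpf \<Phi> (g n) = Some v"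
  shows "recursive1 (\<lambda>n. if P n then the (lfpf \<Phi> (g n)) else 0)"
proof -
  define \<phi> where "\<phi> m = code_opt (\<Phi> (map_of_code (pfst m)) (psnd m))" for m
  have \<phi>: "recursive1 \<phi>" unfolding \<phi>_def by (rule recursive1_functional[OF \<Phi>])
  have check: "check_table \<phi> w = Suc t \<longleftrightarrow> (\<exists>xs. table \<Phi> xs \<and>
      w = list_encode (map prod_encode (rev xs)) \<and> t = list_encode (map prod_encode xs))" for w t
    by (rule check_table_eq_Suc) (rule \<phi>_def)
  define val where "val w n = (if check_table \<phi> w = 0 then 0 else lookup (check_table \<phi> w - 1) (g n))"
    for w n
  have val_sound: "lfpf \<Phi> (g n) = Some v" if "val w n = Suc v" for w n v
  proof -
    from that obtain t where t: "check_table \<phi> w = Suc t" "lookup t (g n) = Suc v"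
      by (cases "check_table \<phi> w") (auto simp: val_def)
    then obtain xs where "table \<Phi> xs" "map_of xs (g n) = Some v"
      by (auto simp: check lookup_list_encode)
    then show ?thesis using table_le_lfpf[OF \<Phi>] by (force simp: map_le_def dom_def)
  qed
  have val_complete: "\<exists>w. val w n = Suc v" if "lfpf \<Phi> (g n) = Some v" for n v
  proof -
    from lfpf_table[OF \<Phi> that] obtain xs where xs: "table \<Phi> xs" "map_of xs (g n) = Some v" by blast
    then have "check_table \<phi> (list_encode (map prod_encode (rev xs))) =
        Suc (list_encode (map prod_encode xs))" by (auto simp: check)
    then have "val (list_encode (map prod_encode (rev xs))) n = Suc v"
      using xs(2) by (simp add: val_def lookup_list_encode)
    then show ?thesis ..
  qed
  have val: "recursive n (\<lambda>xs. val (a xs) (b xs))" if "recursive n a" "recursive n b" for n a b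
    unfolding val_def
    by (intro recursive_intros recursive_lookup recursive1_comp[OF g] that
        recursive1_comp[OF recursive1_check_table[OF \<phi>, of "\<lambda>n. n"]]) auto
  \<comment> \<open>Outside \<open>P\<close> every \<open>w\<close> counts as a success, which makes
    the search total.\<close>
  define bad where "bad w n = (if P n \<and> val w n = 0 then 1 else 0 :: nat)" for w n
  have P': "decides n (\<lambda>xs. P (a xs))" if "recursive n a" for n a
    using recursive1_comp[OF P[unfolded decides_def] that] unfolding decides_def .
  have "recursive2 bad"
    unfolding bad_def by (intro recursive_intros val P') auto
  moreover have ex: "\<exists>w. bad w n = 0" for n
  proof (cases "P n")
    case True
    then obtain v w where "val w n = Suc v" using total val_complete by blast
    then have "bad w n = 0" by (simp add: bad_def)
    then show ?thesis ..
  qed (simp add: bad_def)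
  ultimately have "recursive1 (\<lambda>n. LEAST w. bad w n = 0)"
    by (rule recursive1_Least)
  then have "recursive1 (\<lambda>n. if P n then val (LEAST w. bad w n = 0) n - 1 else 0)"
    by (intro recursive_intros val P') auto
  moreover have "val (LEAST w. bad w n = 0) n - 1 = the (lfpf \<Phi> (g n))" if "P n" for n
  proof -
    define w where "w = (LEAST w. bad w n = 0)"
    have "bad w n = 0" unfolding w_def using ex by (rule LeastI_ex)
    then have "val w n \<noteq> 0" using that by (auto simp: bad_def split: if_splits)
    then obtain v where "val w n = Suc v" using not0_implies_Suc by blast
    then show ?thesis using val_sound unfolding w_def[symmetric] by simp
  qed
  ultimately show ?thesis by (auto elim!: recursive_cong)
qed

section \<open>Permuting the names of expressions\<close>

lemma infinitely_many_fresh: "finite (S :: nat set) \<Longrightarrow> \<forall>\<^sub>\<infinity>z. z \<notin> S"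
  by (simp add: MOST_iff_finiteNeg)

lemma MOST_nat_ex:
  fixes P :: "nat \<Rightarrow> bool"
  shows "\<forall>\<^sub>\<infinity>z. P z \<Longrightarrow> \<exists>z. P z"
  by (metis MOST_nat not_less_eq)

text \<open>Freshness conditions hold cofinitely, so one name can be chosen that meets several of
  them at once.\<close>

lemma MOST_nat_ex2:
  fixes P Q :: "nat \<Rightarrow> bool"
  shows "\<forall>\<^sub>\<infinity>z. P z \<Longrightarrow> \<forall>\<^sub>\<infinity>z. Q z \<Longrightarrow> \<exists>z. P z \<and> Q z"
  by (intro MOST_nat_ex eventually_conj)

lemma MOST_nat_ex3:
  fixes P Q R :: "nat \<Rightarrow> bool"
  shows "\<forall>\<^sub>\<infinity>z. P z \<Longrightarrow> \<forall>\<^sub>\<infinity>z. Q z \<Longrightarrow> \<forall>\<^sub>\<infinity>z. R z \<Longrightarrow> \<exists>z. P z \<and> Q z \<and> R z"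
  by (intro MOST_nat_ex eventually_conj)

lemma MOST_nat_ex4:
  fixes P Q R S :: "nat \<Rightarrow> bool"
  shows "\<forall>\<^sub>\<infinity>z. P z \<Longrightarrow> \<forall>\<^sub>\<infinity>z. Q z \<Longrightarrow> \<forall>\<^sub>\<infinity>z. R z \<Longrightarrow> \<forall>\<^sub>\<infinity>z. S z \<Longrightarrow>
    \<exists>z. P z \<and> Q z \<and> R z \<and> S z"
  by (intro MOST_nat_ex eventually_conj)

lemma finite_set_rtm: "finite (set_rtm M)" and finite_set_ratm: "finite (set_ratm R)"
  for M :: "'v rtm" and R :: "'v ratm"
  by (induction M and R rule: rtm.induct ratm.induct) auto

lemma finite_set_raty: "finite (set_raty P)"
  by (induction P) (auto simp: finite_set_rtm)

lemma finite_set_rty: "finite (set_rty A)"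
  by (induction A) (auto simp: finite_set_raty)

lemma finite_set_rkind: "finite (set_rkind K)"
  by (induction K) (auto simp: finite_set_rty)

text \<open>Conjugating a transposition by a bijection transposes the images; this carries the
  renaming rules of the alpha relations through \<open>p\<close>.\<close>

lemma comp_transpose: "bij p \<Longrightarrow> p \<circ> transpose x y = transpose (p x) (p y) \<circ> p"
  by (auto simp: fun_eq_iff transpose_def bij_def inj_eq)

lemma alpha_map_tm:
  assumes "bij p"
  shows "alpha_tm M N \<Longrightarrow> alpha_tm (map_rtm p M) (map_rtm p N)"
    and "alpha_atm R S \<Longrightarrow> alpha_atm (map_ratm p R) (map_ratm p S)"
proof (induction rule: alpha_tm_alpha_atm.inducts)
  case (alpha_tm_rename y M x)
  have "p y \<notin> set_rtm (map_rtm p M)"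
    using alpha_tm_rename assms by (auto simp: rtm.set_map bij_def inj_eq)
  from alpha_tm_alpha_atm.alpha_tm_rename[OF this, of "p x"] show ?case
    by (simp add: rtm.map_comp comp_transpose[OF assms])
qed (auto intro: alpha_tm_alpha_atm.intros)

lemma alpha_map_aty: "bij p \<Longrightarrow> alpha_aty P Q \<Longrightarrow> alpha_aty (map_raty p P) (map_raty p Q)"
  by (rotate_tac, induction rule: alpha_aty.induct) (auto intro: alpha_aty.intros alpha_map_tm)

lemma alpha_map_ty: 
  assumes "bij p"
  shows "alpha_ty A B \<Longrightarrow> alpha_ty (map_rty p A) (map_rty p B)"
proof (induction rule: alpha_ty.induct)
  case (alpha_ty_rename y B x A)
  have "p y \<notin> set_rty (map_rty p B)"
    using alpha_ty_rename assms by (auto simp: rty.set_map bij_def inj_eq)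
  from alpha_ty.alpha_ty_rename[OF this, of "p x"] show ?case
    by (simp add: rty.map_comp comp_transpose[OF assms])
qed (auto intro: alpha_ty.intros alpha_map_aty[OF assms])

lemma alpha_map_kind:
  assumes "bij p"
  shows "alpha_kind K L \<Longrightarrow> alpha_kind (map_rkind p K) (map_rkind p L)"
proof (induction rule: alpha_kind.induct)
  case (alpha_kind_rename y K x A)
  have "p y \<notin> set_rkind (map_rkind p K)"
    using alpha_kind_rename assms by (auto simp: rkind.set_map bij_def inj_eq)
  from alpha_kind.alpha_kind_rename[OF this, of "p x"] show ?case
    by (simp add: rkind.map_comp comp_transpose[OF assms])
qed (auto intro: alpha_kind.intros alpha_map_ty[OF assms])

text \<open>
  Renaming a bound variable is undone by opening both sides with the same name, for all but
  the finitely many names that occur.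
\<close>

lemma map_transpose_comp_fresh:
  assumes "y \<notin> set_rtm M" "z \<notin> set_rtm M"
  shows "map_rtm (transpose y z) (map_rtm (transpose x y) M) = map_rtm (transpose x z) M"
  using assms by (auto simp: rtm.map_comp transpose_def intro!: rtm.map_cong0)

text \<open>The alpha relations are generated with symmetry and transitivity, so plain rule
  inversion yields nothing useful. Agreement of the opened bodies at cofinitely many names is stable
  under both, as the intersection of two cofinite sets is cofinite.\<close>

lemma alpha_tm_inv:
  "alpha_tm M N \<Longrightarrow>
    (\<forall>R. M = RAtom R \<longrightarrow> (\<exists>S. N = RAtom S \<and> alpha_atm R S)) \<and>
    (\<forall>x M'. M = RLam x M' \<longrightarrow> (\<exists>y N'. N = RLam y N' \<and>
      (\<forall>\<^sub>\<infinity>z. alpha_tm (map_rtm (transpose x z) M') (map_rtm (transpose y z) N'))))"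
  "alpha_atm R S \<Longrightarrow>
    (\<forall>c. R = RConst c \<longrightarrow> S = RConst c) \<and> (\<forall>x. R = RVar x \<longrightarrow> S = RVar x) \<and>
    (\<forall>R' M. R = RApp R' M \<longrightarrow> (\<exists>S' N. S = RApp S' N \<and> alpha_atm R' S' \<and> alpha_tm M N))"
proof (induction rule: alpha_tm_alpha_atm.inducts)
  case (alpha_tm_sym M N)
  then show ?case
    by (cases M rule: rtm.exhaust; cases N rule: rtm.exhaust) (auto intro: alpha_tm_alpha_atm.intros elim!: MOST_mono)
next
  case (alpha_tm_trans M N P)
  then show ?case
    by (cases M rule: rtm.exhaust; cases N rule: rtm.exhaust; cases P rule: rtm.exhaust)
      (auto intro: alpha_tm_alpha_atm.intros elim!: MOST_rev_mp intro: eventuallyI)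
next
  case (alpha_tm_rename y M x)
  have "\<forall>\<^sub>\<infinity>z. z \<notin> set_rtm M" by (simp add: infinitely_many_fresh finite_set_rtm)
  then have "\<forall>\<^sub>\<infinity>z. alpha_tm (map_rtm (transpose x z) M)
      (map_rtm (transpose y z) (map_rtm (transpose x y) M))"
    by (rule MOST_mono) (simp add: map_transpose_comp_fresh alpha_tm_rename alpha_tm_refl)
  then show ?case by simp
next
  case (alpha_tm_Lam M M' x)
  then show ?case by (auto simp: alpha_map_tm)
next
  case (alpha_atm_sym R S)
  then show ?case by (cases R rule: ratm.exhaust; cases S rule: ratm.exhaust) (auto intro: alpha_tm_alpha_atm.intros)
next
  case (alpha_atm_trans R S T)
  then show ?case by (cases R rule: ratm.exhaust; cases S rule: ratm.exhaust) (auto intro: alpha_tm_alpha_atm.intros)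
qed (auto intro: alpha_tm_alpha_atm.intros simp: alpha_tm_refl)

lemma alpha_aty_inv:
  "alpha_aty P Q \<Longrightarrow> (\<forall>c. P = RTConst c \<longrightarrow> Q = RTConst c) \<and>
    (\<forall>P' M. P = RTApp P' M \<longrightarrow> (\<exists>Q' N. Q = RTApp Q' N \<and> alpha_aty P' Q' \<and> alpha_tm M N))"
proof (induction rule: alpha_aty.induct)
  case (alpha_aty_sym P Q)
  then show ?case by (cases P rule: raty.exhaust; cases Q rule: raty.exhaust) (auto intro: alpha_aty.intros alpha_tm_sym)
next
  case (alpha_aty_trans P Q S)
  then show ?case by (cases P rule: raty.exhaust; cases Q rule: raty.exhaust) (auto intro: alpha_aty.intros alpha_tm_trans)
qed (auto intro: alpha_aty.intros alpha_tm_refl)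

lemma alpha_ty_inv:
  "alpha_ty A B \<Longrightarrow>
    (\<forall>P. A = RTAtom P \<longrightarrow> (\<exists>Q. B = RTAtom Q \<and> alpha_aty P Q)) \<and>
    (\<forall>x A1 A2. A = RPi x A1 A2 \<longrightarrow> (\<exists>y B1 B2. B = RPi y B1 B2 \<and> alpha_ty A1 B1 \<and>
      (\<forall>\<^sub>\<infinity>z. alpha_ty (map_rty (transpose x z) A2) (map_rty (transpose y z) B2))))"
proof (induction rule: alpha_ty.induct)
  case (alpha_ty_sym A B)
  then show ?case
    by (cases A rule: rty.exhaust; cases B rule: rty.exhaust) (auto intro: alpha_ty.intros alpha_aty.intros elim!: MOST_mono)
next
  case (alpha_ty_trans A B C)
  then show ?case
    by (cases A rule: rty.exhaust; cases B rule: rty.exhaust; cases C rule: rty.exhaust)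
      (auto intro: alpha_ty.intros alpha_aty.intros elim!: MOST_rev_mp intro: eventuallyI)
next
  case (alpha_ty_rename y B x A)
  have "\<forall>\<^sub>\<infinity>z. z \<notin> set_rty B" by (simp add: infinitely_many_fresh finite_set_rty)
  then have "\<forall>\<^sub>\<infinity>z. map_rty (transpose y z) (map_rty (transpose x y) B) = map_rty (transpose x z) B"
    by (rule MOST_mono)
      (use alpha_ty_rename in \<open>auto simp: rty.map_comp transpose_def intro!: rty.map_cong0\<close>)
  then have "\<forall>\<^sub>\<infinity>z. alpha_ty (map_rty (transpose x z) B)
      (map_rty (transpose y z) (map_rty (transpose x y) B))"
    by (rule MOST_mono) (simp add: alpha_ty_refl)
  then show ?case by (simp add: alpha_ty_refl)
next
  case (alpha_ty_Pi A A' B B' x)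
  then show ?case by (auto simp: alpha_map_ty)
qed (auto intro: alpha_ty.intros alpha_aty.intros simp: alpha_ty_refl)

lemma alpha_kind_inv:
  "alpha_kind K L \<Longrightarrow> (K = RType \<longrightarrow> L = RType) \<and>
    (\<forall>x A K'. K = RKPi x A K' \<longrightarrow> (\<exists>y B L'. L = RKPi y B L' \<and> alpha_ty A B \<and>
      (\<forall>\<^sub>\<infinity>z. alpha_kind (map_rkind (transpose x z) K') (map_rkind (transpose y z) L'))))"
proof (induction rule: alpha_kind.induct)
  case (alpha_kind_sym K L)
  then show ?case
    by (cases K rule: rkind.exhaust; cases L rule: rkind.exhaust) (auto intro: alpha_kind.intros alpha_ty.intros elim!: MOST_mono)
next
  case (alpha_kind_trans K L J)
  then show ?case
    by (cases K rule: rkind.exhaust; cases L rule: rkind.exhaust; cases J rule: rkind.exhaust)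
      (auto intro: alpha_kind.intros alpha_ty.intros elim!: MOST_rev_mp intro: eventuallyI)
next
  case (alpha_kind_rename y K x A)
  have "\<forall>\<^sub>\<infinity>z. z \<notin> set_rkind K" by (simp add: infinitely_many_fresh finite_set_rkind)
  then have "\<forall>\<^sub>\<infinity>z. map_rkind (transpose y z) (map_rkind (transpose x y) K) = map_rkind (transpose x z) K"
    by (rule MOST_mono)
      (use alpha_kind_rename in \<open>auto simp: rkind.map_comp transpose_def intro!: rkind.map_cong0\<close>)
  then have "\<forall>\<^sub>\<infinity>z. alpha_kind (map_rkind (transpose x z) K)
      (map_rkind (transpose y z) (map_rkind (transpose x y) K))"
    by (rule MOST_mono) (simp add: alpha_kind_refl)
  then show ?case by (simp add: alpha_ty_refl)
next
  case (alpha_kind_Pi A A' K K' x)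
  show ?case using alpha_kind_Pi.hyps by (auto simp: alpha_map_kind)
qed (auto intro: alpha_kind.intros alpha_ty.intros simp: alpha_kind_refl)

text \<open>The maps respect renaming of bound variables only for injective \<open>p\<close>.\<close>

lift_definition perm_tm :: "(var \<Rightarrow> var) \<Rightarrow> tm \<Rightarrow> tm" is "\<lambda>p. if bij p then map_rtm p else id"
  by (simp add: alpha_map_tm)
lift_definition perm_atm :: "(var \<Rightarrow> var) \<Rightarrow> atm \<Rightarrow> atm" is "\<lambda>p. if bij p then map_ratm p else id"
  by (simp add: alpha_map_tm)
lift_definition perm_aty :: "(var \<Rightarrow> var) \<Rightarrow> aty \<Rightarrow> aty" is "\<lambda>p. if bij p then map_raty p else id"
  by (simp add: alpha_map_aty)
lift_definition perm_ty :: "(var \<Rightarrow> var) \<Rightarrow> ty \<Rightarrow> ty" is "\<lambda>p. if bij p then map_rty p else id"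
  by (simp add: alpha_map_ty)
lift_definition perm_kind :: "(var \<Rightarrow> var) \<Rightarrow> kind \<Rightarrow> kind" is "\<lambda>p. if bij p then map_rkind p else id"
  by (simp add: alpha_map_kind)

lift_definition fva :: "atm \<Rightarrow> var set" is fv_ratm by (rule fv_alpha)

lemma perm_simps [simp]:
  assumes "bij p"
  shows "perm_tm p (Atom R) = Atom (perm_atm p R)"
    "perm_tm p (Lam x M) = Lam (p x) (perm_tm p M)"
    "perm_atm p (Const c) = Const c"
    "perm_atm p (Var x) = Var (p x)"
    "perm_atm p (App R M) = App (perm_atm p R) (perm_tm p M)"
    "perm_aty p (TConst c) = TConst c"
    "perm_aty p (TApp P M) = TApp (perm_aty p P) (perm_tm p M)"
    "perm_ty p (TAtom P) = TAtom (perm_aty p P)"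
    "perm_ty p (Pi x A B) = Pi (p x) (perm_ty p A) (perm_ty p B)"
    "perm_kind p Type = Type"
    "perm_kind p (KPi x A K) = KPi (p x) (perm_ty p A) (perm_kind p K)"
  using assms by (transfer; simp add: alpha_tm_alpha_atm.intros alpha_aty.intros alpha_ty.intros
    alpha_kind.intros)+

lemma perm_comp:
  assumes "bij p" "bij q"
  shows "perm_tm p (perm_tm q M) = perm_tm (p \<circ> q) M"
    "perm_atm p (perm_atm q R) = perm_atm (p \<circ> q) R"
    "perm_aty p (perm_aty q P) = perm_aty (p \<circ> q) P"
    "perm_ty p (perm_ty q A) = perm_ty (p \<circ> q) A"
    "perm_kind p (perm_kind q K) = perm_kind (p \<circ> q) K"
  using assms
  by (transfer; simp add: bij_comp rtm.map_comp ratm.map_comp raty.map_comp rty.map_comp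
    rkind.map_comp alpha_tm_alpha_atm.intros alpha_aty.intros alpha_ty.intros alpha_kind.intros)+

lemma perm_id [simp]:
  "perm_tm id M = M" "perm_atm id R = R" "perm_aty id P = P" "perm_ty id A = A" "perm_kind id K = K"
  by (transfer; simp add: rtm.map_id ratm.map_id raty.map_id rty.map_id
    rkind.map_id alpha_tm_alpha_atm.intros alpha_aty.intros alpha_ty.intros alpha_kind.intros)+

lemma perm_transpose_transpose [simp]:
  "perm_tm (transpose x y) (perm_tm (transpose x y) M) = M"
  "perm_atm (transpose x y) (perm_atm (transpose x y) R) = R"
  "perm_aty (transpose x y) (perm_aty (transpose x y) P) = P"
  "perm_ty (transpose x y) (perm_ty (transpose x y) A) = A"
  "perm_kind (transpose x y) (perm_kind (transpose x y) K) = K"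
  by (simp_all add: perm_comp)

lemma fv_simps [simp]:
  "fv (Atom R) = fva R" "fv (Lam x M) = fv M - {x}"
  "fva (Const c) = {}" "fva (Var x) = {x}" "fva (App R M) = fva R \<union> fv M"
  by (transfer; simp)+

lemma fv_map_bij:
  assumes "bij p"
  shows "fv_rtm (map_rtm p M) = p ` fv_rtm M" "fv_ratm (map_ratm p R) = p ` fv_ratm R"
  using assms
  by (induction M and R rule: rtm.induct ratm.induct) (auto simp: bij_def inj_eq)

lemma fv_perm: "bij p \<Longrightarrow> fv (perm_tm p M) = p ` fv M"
  by transfer (simp add: fv_map_bij)

lemma finite_fv [simp]: "finite (fv M)"
  by transfer (meson finite_set_rtm fv_subset_set(1) finite_subset)

lemma Lam_fresh: "\<forall>\<^sub>\<infinity>z. Lam x M = Lam z (perm_tm (transpose x z) M)"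
proof (transfer fixing: x)
  fix M :: "var rtm"
  have "\<forall>\<^sub>\<infinity>z. z \<notin> set_rtm M" by (simp add: infinitely_many_fresh finite_set_rtm)
  then show "\<forall>\<^sub>\<infinity>z. alpha_tm (RLam x M)
      (RLam z ((if bij (transpose x z) then map_rtm (transpose x z) else id) M))"
    by (rule MOST_mono) (simp add: alpha_tm_rename)
qed

lemma Pi_fresh: "\<forall>\<^sub>\<infinity>z. Pi x A B = Pi z A (perm_ty (transpose x z) B)"
proof (transfer fixing: x)
  fix A B :: "var rty"
  have "\<forall>\<^sub>\<infinity>z. z \<notin> set_rty B" by (simp add: infinitely_many_fresh finite_set_rty)
  then show "\<forall>\<^sub>\<infinity>z. alpha_ty (RPi x A B)
      (RPi z A ((if bij (transpose x z) then map_rty (transpose x z) else id) B))"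
    by (rule MOST_mono) (simp add: alpha_ty_rename)
qed

lemma KPi_fresh: "\<forall>\<^sub>\<infinity>z. KPi x A K = KPi z A (perm_kind (transpose x z) K)"
proof (transfer fixing: x)
  fix A :: "var rty" and K :: "var rkind"
  have "\<forall>\<^sub>\<infinity>z. z \<notin> set_rkind K" by (simp add: infinitely_many_fresh finite_set_rkind)
  then show "\<forall>\<^sub>\<infinity>z. alpha_kind (RKPi x A K)
      (RKPi z A ((if bij (transpose x z) then map_rkind (transpose x z) else id) K))"
    by (rule MOST_mono) (simp add: alpha_kind_rename)
qed

text \<open>Takes the place of injectivity of \<open>Lam\<close>, which fails because the binder
  name is not determined.\<close>

lemma Lam_eqD: "Lam x M = Lam y N \<Longrightarrow>
    \<forall>\<^sub>\<infinity>z. perm_tm (transpose x z) M = perm_tm (transpose y z) N"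
  by transfer (auto dest: alpha_tm_inv)

lemma Pi_eqD: "Pi x A B = Pi y A' B' \<Longrightarrow>
    A = A' \<and> (\<forall>\<^sub>\<infinity>z. perm_ty (transpose x z) B = perm_ty (transpose y z) B')"
  by transfer (auto dest: alpha_ty_inv)

lemma KPi_eqD: "KPi x A K = KPi y A' K' \<Longrightarrow>
    A = A' \<and> (\<forall>\<^sub>\<infinity>z. perm_kind (transpose x z) K = perm_kind (transpose y z) K')"
  by transfer (auto dest: alpha_kind_inv)

lemma expr_inject [simp]:
  "Atom R = Atom S \<longleftrightarrow> R = S" "Var x = Var y \<longleftrightarrow> x = y" "Const c = Const d \<longleftrightarrow> c = d"
  "App R M = App S N \<longleftrightarrow> R = S \<and> M = N"
  "TConst c = TConst d \<longleftrightarrow> c = d" "TApp P M = TApp Q N \<longleftrightarrow> P = Q \<and> M = N"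
  "TAtom P = TAtom Q \<longleftrightarrow> P = Q"
  by (transfer; auto dest: alpha_tm_inv alpha_aty_inv alpha_ty_inv
    intro: alpha_tm_alpha_atm.intros alpha_aty.intros alpha_ty.intros)+

lemma expr_distinct [simp]:
  "Atom R \<noteq> Lam x M" "Lam x M \<noteq> Atom R"
  "Const c \<noteq> Var x" "Var x \<noteq> Const c" "Const c \<noteq> App R M" "App R M \<noteq> Const c"
  "Var x \<noteq> App R M" "App R M \<noteq> Var x"
  "TConst c \<noteq> TApp P M" "TApp P M \<noteq> TConst c"
  "TAtom P \<noteq> Pi x A B" "Pi x A B \<noteq> TAtom P"
  "Type \<noteq> KPi x A K" "KPi x A K \<noteq> Type"
  by (transfer; auto dest: alpha_tm_inv alpha_aty_inv alpha_ty_inv alpha_kind_inv)+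

text \<open>Induction on raw representatives, pushed through the abstraction functions. The
  \<open>Lam\<close> case provides no freshness for \<open>x\<close>, so later inductions rename
  explicitly.\<close>

lemma tm_atm_induct [case_names Atom Lam Const Var App]:
  assumes "\<And>R. Q R \<Longrightarrow> P (Atom R)" "\<And>x M. P M \<Longrightarrow> P (Lam x M)"
    "\<And>c. Q (Const c)" "\<And>x. Q (Var x)" "\<And>R M. Q R \<Longrightarrow> P M \<Longrightarrow> Q (App R M)"
  shows "P M" "Q R"
proof -
  have "P (abs_tm M)" "Q (abs_atm R)" for M R
    by (induction M and R rule: rtm.induct ratm.induct)
      (auto intro: assms simp: Atom.abs_eq[symmetric] Lam.abs_eq[symmetric] Const.abs_eq[symmetric]
        Var.abs_eq[symmetric] App.abs_eq[symmetric])
  then show "P M" "Q R"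
    by (metis Quotient_abs_rep[OF Quotient_tm], metis Quotient_abs_rep[OF Quotient_atm])
qed

text \<open>Under a binder \<open>p x\<close> and \<open>q x\<close> may differ. Renaming both to
  one fresh \<open>z\<close> gives permutations that agree on \<open>x\<close> as well, which is
  what the induction hypothesis asks for the body.\<close>

lemma perm_cong:
  "bij p \<Longrightarrow> bij q \<Longrightarrow> (\<And>v. v \<in> fv M \<Longrightarrow> p v = q v) \<Longrightarrow> perm_tm p M = perm_tm q M"
  "bij p \<Longrightarrow> bij q \<Longrightarrow> (\<And>v. v \<in> fva R \<Longrightarrow> p v = q v) \<Longrightarrow> perm_atm p R = perm_atm q R"
proof (induction M and R arbitrary: p q and p q rule: tm_atm_induct)
  case (Lam x M)
  have fresh: "\<forall>\<^sub>\<infinity>z. z \<notin> p ` fv M \<union> q ` fv M"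
    by (rule infinitely_many_fresh) simp
  obtain z where z: "Lam (p x) (perm_tm p M) = Lam z (perm_tm (transpose (p x) z) (perm_tm p M))"
      "Lam (q x) (perm_tm q M) = Lam z (perm_tm (transpose (q x) z) (perm_tm q M))"
      "z \<notin> p ` fv M \<union> q ` fv M"
    using MOST_nat_ex3[OF Lam_fresh[of "p x" "perm_tm p M"] Lam_fresh[of "q x" "perm_tm q M"] fresh]
    by blast
  have "bij (transpose (p x) z \<circ> p)" "bij (transpose (q x) z \<circ> q)"
    using Lam.prems(1,2) by (simp_all add: bij_comp del: o_apply)
  then have "perm_tm (transpose (p x) z \<circ> p) M = perm_tm (transpose (q x) z \<circ> q) M"
  proof (rule Lam.IH)
    fix v assume v: "v \<in> fv M"
    have "p v \<noteq> z" "q v \<noteq> z" using z(3) v by auto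
    moreover have "p v = p x \<longleftrightarrow> v = x" "q v = q x \<longleftrightarrow> v = x"
      using Lam.prems(1,2) by (auto simp: bij_def inj_eq)
    ultimately show "(transpose (p x) z \<circ> p) v = (transpose (q x) z \<circ> q) v"
      using Lam.prems(3)[of v] v by (cases "v = x" rule: case_split) (auto simp: transpose_def)
  qed
  then show ?case using Lam.prems(1,2) by (simp add: z(1,2) perm_comp del: o_apply)
next
  case (Atom R)
  have "perm_atm p R = perm_atm q R" by (rule Atom.IH) (use Atom.prems in auto)
  then show ?case using Atom.prems by simp
next
  case (App R M)
  have "perm_atm p R = perm_atm q R" by (rule App.IH(1)) (use App.prems in auto)
  moreover have "perm_tm p M = perm_tm q M" by (rule App.IH(2)) (use App.prems in auto)
  ultimately show ?case using App.prems by simp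
qed simp_all

lemma perm_fresh:
  assumes "x \<notin> fv M" "y \<notin> fv M"
  shows "perm_tm (transpose x y) M = M"
proof -
  have "perm_tm (transpose x y) M = perm_tm id M"
    by (rule perm_cong(1)) (use assms in \<open>auto simp: transpose_def\<close>)
  then show ?thesis by simp
qed

section \<open>Determinacy of hereditary substitution\<close>

text \<open>\<open>S\<close> is the set of free variables of the subject. Entries of
  \<open>\<theta>\<close> reappear in \<open>\<eta>\<close> with the name moved by \<open>p\<close>
  and the term by \<open>q\<close>. A variable outside the domain is copied from subject to result,
  so there \<open>p\<close> and \<open>q\<close> must agree.\<close>

definition compat :: "(var \<Rightarrow> var) \<Rightarrow> (var \<Rightarrow> var) \<Rightarrow> subst \<Rightarrow> subst \<Rightarrow> var set \<Rightarrow> bool" where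
  "compat p q \<theta> \<eta> S \<longleftrightarrow> (\<forall>x\<in>S.
    (\<forall>M \<alpha>. (x, M, \<alpha>) \<in> \<theta> \<longrightarrow> (p x, perm_tm q M, \<alpha>) \<in> \<eta>) \<and>
    (x \<notin> sdom \<theta> \<longrightarrow> p x \<notin> sdom \<eta> \<and> p x = q x))"

lemma MOST_sfresh:
  assumes "finite \<theta>"
  shows "\<forall>\<^sub>\<infinity>z. sfresh z \<theta>"
proof -
  have "\<forall>\<^sub>\<infinity>z. z \<notin> fst ` \<theta> \<union> (\<Union>(x, M, \<alpha>)\<in>\<theta>. fv M)"
    by (rule infinitely_many_fresh) (use assms in auto)
  then show ?thesis by (rule MOST_mono) (force simp: sfresh_def sdom_def srng_def)
qed

text \<open>
  The subject is permuted by \<open>p\<close> and everything produced from the substitution by \<open>q\<close>.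
  For \<open>p = q\<close> this is equivariance; for \<open>q = id\<close> it renames a variable of the domain.
\<close>

lemma hsub_perm:
  "hsub_tm \<theta> M N \<Longrightarrow> finite \<eta> \<Longrightarrow> bij p \<Longrightarrow> bij q \<Longrightarrow> compat p q \<theta> \<eta> (fv M) \<Longrightarrow>
    hsub_tm \<eta> (perm_tm p M) (perm_tm q N)"
  "hsub_can \<theta> R N \<alpha> \<Longrightarrow> finite \<eta> \<Longrightarrow> bij p \<Longrightarrow> bij q \<Longrightarrow> compat p q \<theta> \<eta> (fva R) \<Longrightarrow>
    hsub_can \<eta> (perm_atm p R) (perm_tm q N) \<alpha>"
  "hsub_atm \<theta> R R' \<Longrightarrow> finite \<eta> \<Longrightarrow> bij p \<Longrightarrow> bij q \<Longrightarrow> compat p q \<theta> \<eta> (fva R) \<Longrightarrow>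
    hsub_atm \<eta> (perm_atm p R) (perm_atm q R')"
proof (induction arbitrary: \<eta> p q and \<eta> p q and \<eta> p q rule: hsub_tm_hsub_can_hsub_atm.inducts)
  case (hsub_tm_Lam x \<theta> M M')
  have fresh: "\<forall>\<^sub>\<infinity>z. z \<notin> p ` fv M \<union> q ` fv M"
    by (rule infinitely_many_fresh) simp
  obtain z where z: "Lam (p x) (perm_tm p M) = Lam z (perm_tm (transpose (p x) z) (perm_tm p M))"
    "Lam (q x) (perm_tm q M') = Lam z (perm_tm (transpose (q x) z) (perm_tm q M'))"
    and z': "z \<notin> p ` fv M" "z \<notin> q ` fv M" "sfresh z \<eta>"
    using MOST_nat_ex4[OF Lam_fresh[of "p x" "perm_tm p M"] Lam_fresh[of "q x" "perm_tm q M'"]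
      fresh MOST_sfresh[OF hsub_tm_Lam.prems(1)]] by blast
  \<comment> \<open>Both permutations now send \<open>x\<close> to \<open>z\<close>. Freshness of
    \<open>x\<close> for \<open>\<theta>\<close> and of \<open>z\<close> for \<open>\<eta>\<close>
    keeps the relevant entries of the substitutions in place.\<close>
  let ?p = "transpose (p x) z \<circ> p" and ?q = "transpose (q x) z \<circ> q"
  have bij: "bij ?p" "bij ?q" using hsub_tm_Lam.prems by (intro bij_comp; simp)+
  have eq: "p v = p w \<longleftrightarrow> v = w" "q v = q w \<longleftrightarrow> v = w" for v w
    using hsub_tm_Lam.prems by (auto simp: bij_def inj_eq)
  have "compat ?p ?q \<theta> \<eta> (fv M)"
    unfolding compat_def
  proof (intro ballI conjI allI impI)
    fix v K \<alpha> assume v: "v \<in> fv M" and K: "(v, K, \<alpha>) \<in> \<theta>"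
    then have "v \<noteq> x" and x: "x \<notin> fv K"
      using hsub_tm_Lam.hyps(1) unfolding sfresh_def sdom_def srng_def by blast+
    then have in_\<eta>: "(p v, perm_tm q K, \<alpha>) \<in> \<eta>"
      using hsub_tm_Lam.prems(4) v K by (auto simp: compat_def)
    have "perm_tm ?q K = perm_tm (transpose (q x) z) (perm_tm q K)"
      using hsub_tm_Lam.prems by (simp add: perm_comp)
    also have "\<dots> = perm_tm q K"
    proof (rule perm_fresh)
      show "q x \<notin> fv (perm_tm q K)"
        using x hsub_tm_Lam.prems by (auto simp: fv_perm eq)
      show "z \<notin> fv (perm_tm q K)"
        using z'(3) in_\<eta> unfolding sfresh_def srng_def by blast
    qed
    finally show "(?p v, perm_tm ?q K, \<alpha>) \<in> \<eta>"
      using in_\<eta> v z'(1) \<open>v \<noteq> x\<close> by (auto simp: transpose_def eq)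
  next
    fix v assume v: "v \<in> fv M" and dom: "v \<notin> sdom \<theta>"
    have "v \<noteq> x \<Longrightarrow> p v \<notin> sdom \<eta> \<and> p v = q v"
      using hsub_tm_Lam.prems(4) v dom by (auto simp: compat_def)
    then show "?p v \<notin> sdom \<eta>" "?p v = ?q v"
      using z' v by (cases "v = x" rule: case_split; auto simp: transpose_def eq sfresh_def)+
  qed
  from hsub_tm_Lam.IH[OF hsub_tm_Lam.prems(1) bij this]
  have "hsub_tm \<eta> (Lam z (perm_tm ?p M)) (Lam z (perm_tm ?q M'))"
    by (rule hsub_tm_hsub_can_hsub_atm.hsub_tm_Lam[OF z'(3)])
  then show ?case using hsub_tm_Lam.prems z by (simp add: perm_comp)
next
  case (hsub_can_App \<theta> R x M' \<alpha>' \<alpha>'' M M'' M''')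
  \<comment> \<open>The body of the redex was produced from the substitution, so within the redex
    subject and result alike are moved by \<open>q\<close>.\<close>
  have "compat q q {(x, M'', \<alpha>')} {(q x, perm_tm q M'', \<alpha>')} (fv M')"
    using hsub_can_App.prems(3) by (auto simp: compat_def sdom_def bij_def inj_eq)
  from hsub_can_App.IH(3)[OF _ hsub_can_App.prems(3,3) this]
  have "hsub_tm {(q x, perm_tm q M'', \<alpha>')} (perm_tm q M') (perm_tm q M''')" by simp
  moreover have "compat p q \<theta> \<eta> (fva R)" "compat p q \<theta> \<eta> (fv M)"
    using hsub_can_App.prems(4) by (auto simp: compat_def)
  ultimately show ?case
    using hsub_can_App.IH(1,2)[OF hsub_can_App.prems(1-3)] hsub_can_App.prems(2,3)
    by (auto intro: hsub_tm_hsub_can_hsub_atm.hsub_can_App)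
next
  case (hsub_atm_App \<theta> R R' M M')
  have "compat p q \<theta> \<eta> (fva R)" "compat p q \<theta> \<eta> (fv M)"
    using hsub_atm_App.prems(4) by (auto simp: compat_def)
  then show ?case
    using hsub_atm_App.IH[OF hsub_atm_App.prems(1-3)] hsub_atm_App.prems(2,3)
    by (auto intro: hsub_tm_hsub_can_hsub_atm.hsub_atm_App)
qed (auto simp: compat_def sdom_def intro: hsub_tm_hsub_can_hsub_atm.intros)

text \<open>\<open>\<theta>\<close> mentions neither name, so the transposition fixes its entries
  and \<open>hsub_perm\<close> applies with the same substitution on both sides.\<close>

lemma hsub_tm_transpose:
  assumes "hsub_tm \<theta> M N" "finite \<theta>" "sfresh x \<theta>" "sfresh z \<theta>"
  shows "hsub_tm \<theta> (perm_tm (transpose x z) M) (perm_tm (transpose x z) N)"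
proof (rule hsub_perm(1)[OF assms(1,2)])
  have "perm_tm (transpose x z) K = K" if "(v, K, \<alpha>) \<in> \<theta>" for v K \<alpha>
    using assms(3,4) that by (intro perm_fresh) (auto simp: sfresh_def srng_def)
  moreover have "(x, K, \<alpha>) \<notin> \<theta>" "(z, K, \<alpha>) \<notin> \<theta>" for K \<alpha>
    using assms(3,4) by (auto simp: sfresh_def sdom_def)
  ultimately show "compat (transpose x z) (transpose x z) \<theta> \<theta> (fv M)"
    by (auto simp: compat_def sdom_def transpose_def)
qed auto

text \<open>A redex provides its abstraction only up to renaming; this makes the last premise of
  \<open>hsub_can_App\<close> independent of the representative. The body is permuted while the
  result stays fixed, the case \<open>q = id\<close> of \<open>hsub_perm\<close>.\<close>

lemma hsub_tm_rename_dom: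
  assumes "hsub_tm {(x, K, \<alpha>)} M P" and eq: "Lam x M = Lam y N"
  shows "hsub_tm {(y, K, \<alpha>)} N P"
proof -
  have fresh: "\<forall>\<^sub>\<infinity>z. z \<notin> fv M" by (rule infinitely_many_fresh) simp
  obtain z where
    z: "perm_tm (transpose x z) M = perm_tm (transpose y z) N" "z \<notin> fv M"
    using MOST_nat_ex2[OF Lam_eqD[OF eq] fresh] by blast
  \<comment> \<open>\<open>?p\<close> sends \<open>x\<close> to \<open>y\<close> by way of
    \<open>z\<close> and fixes the other free variables of \<open>M\<close>, among which neither
    \<open>y\<close> nor \<open>z\<close> occurs.\<close>
  let ?p = "transpose y z \<circ> transpose x z"
  have "y \<notin> fv M - {x}" using arg_cong[OF eq, of fv] by auto
  then have "compat ?p id {(x, K, \<alpha>)} {(y, K, \<alpha>)} (fv M)"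
    using z(2) by (auto simp: compat_def sdom_def transpose_def)
  moreover have "bij ?p" by (intro bij_comp) simp_all
  ultimately have "hsub_tm {(y, K, \<alpha>)} (perm_tm ?p M) (perm_tm id P)"
    by (intro hsub_perm(1)[OF assms(1)]) simp_all
  moreover have "perm_tm ?p M = N" using z(1) by (simp add: perm_comp[symmetric])
  ultimately show ?thesis by simp
qed

section \<open>Inversion of the judgements on terms, and uniqueness\<close>

lemma hsub_tm_AtomE:
  "hsub_tm \<theta> (Atom R) N \<Longrightarrow> (\<exists>R'. N = Atom R' \<and> hsub_atm \<theta> R R') \<or> (\<exists>\<alpha>. hsub_can \<theta> R N \<alpha>)"
  by (erule hsub_tm.cases) auto

text \<open>The rule may have been applied to another representative of the abstraction, hence the
  binder name \<open>y\<close> in place of \<open>x\<close>.\<close>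

lemma hsub_tm_LamE:
  "hsub_tm \<theta> (Lam x M) N \<Longrightarrow>
    \<exists>y M' N'. Lam x M = Lam y M' \<and> N = Lam y N' \<and> sfresh y \<theta> \<and> hsub_tm \<theta> M' N'"
  by (erule hsub_tm.cases) auto

lemma hsub_can_VarE: "hsub_can \<theta> (Var x) N \<alpha> \<Longrightarrow> (x, N, \<alpha>) \<in> \<theta>"
  by (erule hsub_can.cases) auto

lemma hsub_can_ConstE: "\<not> hsub_can \<theta> (Const c) N \<alpha>"
  by (auto elim: hsub_can.cases)

lemma hsub_can_AppE:
  "hsub_can \<theta> (App R M) N \<beta> \<Longrightarrow> \<exists>x M' \<alpha> M''. hsub_can \<theta> R (Lam x M') (Arr \<alpha> \<beta>) \<and>
    hsub_tm \<theta> M M'' \<and> hsub_tm {(x, M'', \<alpha>)} M' N"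
  by (erule hsub_can.cases) auto

lemma hsub_atm_VarE: "hsub_atm \<theta> (Var x) R \<Longrightarrow> x \<notin> sdom \<theta> \<and> R = Var x"
  by (erule hsub_atm.cases) auto

lemma hsub_atm_ConstE: "hsub_atm \<theta> (Const c) R \<Longrightarrow> R = Const c"
  by (erule hsub_atm.cases) auto

lemma hsub_atm_AppE:
  "hsub_atm \<theta> (App R M) N \<Longrightarrow> \<exists>R' M'. N = App R' M' \<and> hsub_atm \<theta> R R' \<and> hsub_tm \<theta> M M'"
  by (erule hsub_atm.cases) auto

lemma is_subst_singleton: "is_subst {(x, M, \<alpha>)}"
  by (simp add: is_subst_def)

text \<open>Two rules of \<open>hsub_tm\<close> apply to \<open>Atom\<close>, so uniqueness of its
  result requires that the two judgements on atomic terms exclude each other; the exclusion is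
  therefore part of the same induction.\<close>

lemma hsub_deterministic:
  "hsub_tm \<theta> M N \<Longrightarrow> is_subst \<theta> \<Longrightarrow> hsub_tm \<theta> M N2 \<Longrightarrow> N2 = N"
  "hsub_can \<theta> R N \<alpha> \<Longrightarrow> is_subst \<theta> \<Longrightarrow>
    (\<forall>N2 \<beta>. hsub_can \<theta> R N2 \<beta> \<longrightarrow> N2 = N \<and> \<beta> = \<alpha>) \<and> (\<forall>R'. \<not> hsub_atm \<theta> R R')"
  "hsub_atm \<theta> R R' \<Longrightarrow> is_subst \<theta> \<Longrightarrow>
    (\<forall>N2 \<beta>. \<not> hsub_can \<theta> R N2 \<beta>) \<and> (\<forall>R2. hsub_atm \<theta> R R2 \<longrightarrow> R2 = R')"
proof (induction arbitrary: N2 rule: hsub_tm_hsub_can_hsub_atm.inducts)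
  case (hsub_tm_Lam x \<theta> M M')
  then obtain y L L' where L: "Lam x M = Lam y L" "N2 = Lam y L'" "sfresh y \<theta>" "hsub_tm \<theta> L L'"
    using hsub_tm_LamE by blast
  have fin: "finite \<theta>" using hsub_tm_Lam.prems by (simp add: is_subst_def)
  obtain z where z: "perm_tm (transpose x z) M = perm_tm (transpose y z) L"
    "Lam x M' = Lam z (perm_tm (transpose x z) M')" "Lam y L' = Lam z (perm_tm (transpose y z) L')"
    "sfresh z \<theta>"
    using MOST_nat_ex4[OF Lam_eqD[OF L(1)] Lam_fresh[of x M'] Lam_fresh[of y L'] MOST_sfresh[OF fin]]
    by blast
  \<comment> \<open>The second derivation is moved from \<open>y\<close> by way of \<open>z\<close>
    to \<open>x\<close>; its subject becomes \<open>M\<close>, and the induction hypothesis compares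
    the results.\<close>
  have "hsub_tm \<theta> (perm_tm (transpose x z) (perm_tm (transpose y z) L))
      (perm_tm (transpose x z) (perm_tm (transpose y z) L'))"
    by (intro hsub_tm_transpose fin L hsub_tm_Lam z)
  then have "perm_tm (transpose x z) (perm_tm (transpose y z) L') = M'"
    by (intro hsub_tm_Lam.IH) (auto simp: z(1)[symmetric] hsub_tm_Lam.prems)
  then have "perm_tm (transpose y z) L' = perm_tm (transpose x z) M'" by auto
  then show ?case using z L(2) by simp
next
  case (hsub_can_App \<theta> R x M' \<alpha>' \<alpha>'' M M'' M''')
  have "N2 = M''' \<and> \<beta> = \<alpha>''" if "hsub_can \<theta> (App R M) N2 \<beta>" for N2 \<beta>
  proof -
    from hsub_can_AppE[OF that] obtain y L' \<alpha> L'' where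
      L: "hsub_can \<theta> R (Lam y L') (Arr \<alpha> \<beta>)" "hsub_tm \<theta> M L''" "hsub_tm {(y, L'', \<alpha>)} L' N2"
      by blast
    \<comment> \<open>Uniqueness for \<open>R\<close> identifies the two abstractions but not their
      binder names, hence the renaming of the domain that follows.\<close>
    with hsub_can_App have eq: "Lam y L' = Lam x M'" "\<alpha> = \<alpha>'" "\<beta> = \<alpha>''" "L'' = M''" by auto
    then have "hsub_tm {(x, M'', \<alpha>')} M' N2"
      using L(3) hsub_tm_rename_dom by blast
    then show ?thesis using hsub_can_App.IH(3) is_subst_singleton eq by blast
  qed
  moreover have "\<not> hsub_atm \<theta> (App R M) R'" for R'
    using hsub_can_App hsub_atm_AppE by blast
  ultimately show ?case by blast
next
  case (hsub_can_Var x M \<alpha> \<theta>)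
  have "N2 = M \<and> \<beta> = \<alpha>" if "(x, N2, \<beta>) \<in> \<theta>" for N2 \<beta>
  proof -
    have "inj_on fst \<theta>" using hsub_can_Var.prems(1) by (simp add: is_subst_def)
    from inj_onD[OF this _ that hsub_can_Var.hyps] show ?thesis by simp
  qed
  moreover have "x \<in> sdom \<theta>" using hsub_can_Var.hyps by (auto simp: sdom_def)
  ultimately show ?case using hsub_can_VarE hsub_atm_VarE by blast
next
  case (hsub_tm_atm \<theta> R R')
  then show ?case using hsub_tm_AtomE by blast
next
  case (hsub_tm_can \<theta> R M' \<alpha>')
  then show ?case using hsub_tm_AtomE by blast
next
  case (hsub_atm_Const \<theta> c)
  then show ?case using hsub_can_ConstE hsub_atm_ConstE by blast
next
  case (hsub_atm_Var x \<theta>)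
  then show ?case by (auto simp: sdom_def dest: hsub_can_VarE hsub_atm_VarE)
next
  case (hsub_atm_App \<theta> R R' M M')
  then show ?case using hsub_can_AppE hsub_atm_AppE by (metis (no_types, lifting))
qed

text \<open>Whether a binder admits a result does not depend on the name chosen for its variable.\<close>

lemma hsub_tm_LamD:
  assumes "hsub_tm \<theta> (Lam z M) N" "finite \<theta>" "sfresh z \<theta>"
  shows "\<exists>N'. hsub_tm \<theta> M N'"
proof -
  from hsub_tm_LamE[OF assms(1)] obtain y L L' where
    L: "Lam z M = Lam y L" "N = Lam y L'" "sfresh y \<theta>" "hsub_tm \<theta> L L'" by blast
  obtain w where
    w: "perm_tm (transpose z w) M = perm_tm (transpose y w) L" "sfresh w \<theta>"
    using MOST_nat_ex2[OF Lam_eqD[OF L(1)] MOST_sfresh[OF assms(2)]]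
    by blast
  have "hsub_tm \<theta> (perm_tm (transpose z w) (perm_tm (transpose y w) L))
      (perm_tm (transpose z w) (perm_tm (transpose y w) L'))"
    by (intro hsub_tm_transpose assms L w)
  then show ?thesis by (auto simp: w(1)[symmetric])
qed

section \<open>Types, kinds and contexts\<close>

lemma hsub_aty_TConstE: "hsub_aty \<theta> (TConst c) P \<Longrightarrow> P = TConst c"
  by (erule hsub_aty.cases) auto

lemma hsub_aty_TAppE:
  "hsub_aty \<theta> (TApp P M) Q \<Longrightarrow> \<exists>P' M'. Q = TApp P' M' \<and> hsub_aty \<theta> P P' \<and> hsub_tm \<theta> M M'"
  by (erule hsub_aty.cases) auto

lemma hsub_ty_TAtomE: "hsub_ty \<theta> (TAtom P) A \<Longrightarrow> \<exists>P'. A = TAtom P' \<and> hsub_aty \<theta> P P'"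
  by (erule hsub_ty.cases) auto

lemma hsub_ty_PiE:
  "hsub_ty \<theta> (Pi x A B) C \<Longrightarrow> \<exists>y B1 A' B'. Pi x A B = Pi y A B1 \<and> C = Pi y A' B' \<and>
    sfresh y \<theta> \<and> hsub_ty \<theta> A A' \<and> hsub_ty \<theta> B1 B'"
  by (erule hsub_ty.cases; simp) (metis Pi_eqD)

lemma hsub_kind_TypeE: "hsub_kind \<theta> Type K \<Longrightarrow> K = Type"
  by (erule hsub_kind.cases) auto

lemma hsub_kind_KPiE:
  "hsub_kind \<theta> (KPi x A K) C \<Longrightarrow> \<exists>y K1 A' K'. KPi x A K = KPi y A K1 \<and> C = KPi y A' K' \<and>
    sfresh y \<theta> \<and> hsub_ty \<theta> A A' \<and> hsub_kind \<theta> K1 K'"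
  by (erule hsub_kind.cases; simp) (metis KPi_eqD)

lemma sfresh_transpose: "sfresh x \<theta> \<Longrightarrow> sfresh z \<theta> \<Longrightarrow> sfresh y \<theta> \<Longrightarrow> sfresh (transpose x z y) \<theta>"
  by (auto simp: transpose_def)

lemma hsub_aty_transpose:
  assumes "hsub_aty \<theta> P Q" "finite \<theta>" "sfresh x \<theta>" "sfresh z \<theta>"
  shows "hsub_aty \<theta> (perm_aty (transpose x z) P) (perm_aty (transpose x z) Q)"
  using assms by induction (auto intro: hsub_aty.intros hsub_tm_transpose)

text \<open>Substitution creates no redexes at the level of types, so each rule is reapplied with
  its binder transposed; the binder stays fresh because both swapped names are fresh.\<close>

lemma hsub_ty_transpose:
  assumes "hsub_ty \<theta> A B" "finite \<theta>" "sfresh x \<theta>" "sfresh z \<theta>"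
  shows "hsub_ty \<theta> (perm_ty (transpose x z) A) (perm_ty (transpose x z) B)"
  using assms by induction (auto intro: hsub_ty.intros hsub_aty_transpose sfresh_transpose)

lemma hsub_kind_transpose:
  assumes "hsub_kind \<theta> K L" "finite \<theta>" "sfresh x \<theta>" "sfresh z \<theta>"
  shows "hsub_kind \<theta> (perm_kind (transpose x z) K) (perm_kind (transpose x z) L)"
  using assms by induction (auto intro: hsub_kind.intros hsub_ty_transpose sfresh_transpose)

lemma hsub_aty_deterministic:
  "hsub_aty \<theta> P Q \<Longrightarrow> is_subst \<theta> \<Longrightarrow> hsub_aty \<theta> P Q2 \<Longrightarrow> Q2 = Q"
proof (induction arbitrary: Q2 rule: hsub_aty.induct)
  case (hsub_aty_App \<theta> P P' M M')
  from hsub_aty_TAppE[OF hsub_aty_App.prems(2)] hsub_aty_App hsub_deterministic(1)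
  show ?case by blast
qed (auto dest: hsub_aty_TConstE)

lemma hsub_ty_deterministic:
  "hsub_ty \<theta> A B \<Longrightarrow> is_subst \<theta> \<Longrightarrow> hsub_ty \<theta> A B2 \<Longrightarrow> B2 = B"
proof (induction arbitrary: B2 rule: hsub_ty.induct)
  case (hsub_ty_Atom \<theta> P P')
  then show ?case by (auto dest!: hsub_ty_TAtomE intro: hsub_aty_deterministic)
next
  case (hsub_ty_Pi x \<theta> A A' B B')
  from hsub_ty_PiE[OF hsub_ty_Pi.prems(2)] obtain y L A2 L' where
    L: "Pi x A B = Pi y A L" "B2 = Pi y A2 L'" "sfresh y \<theta>" "hsub_ty \<theta> A A2" "hsub_ty \<theta> L L'"
    by blast
  have fin: "finite \<theta>" using hsub_ty_Pi.prems by (simp add: is_subst_def)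
  have "A2 = A'" using hsub_ty_Pi L by blast
  obtain z where z: "perm_ty (transpose x z) B = perm_ty (transpose y z) L"
    "Pi x A' B' = Pi z A' (perm_ty (transpose x z) B')"
    "Pi y A' L' = Pi z A' (perm_ty (transpose y z) L')" "sfresh z \<theta>"
    using MOST_nat_ex4[OF Pi_eqD[OF L(1), THEN conjunct2] Pi_fresh[of x A' B'] Pi_fresh[of y A' L']
      MOST_sfresh[OF fin]]
    by blast
  have "hsub_ty \<theta> (perm_ty (transpose x z) (perm_ty (transpose y z) L))
      (perm_ty (transpose x z) (perm_ty (transpose y z) L'))"
    by (intro hsub_ty_transpose fin L hsub_ty_Pi z)
  then have "perm_ty (transpose x z) (perm_ty (transpose y z) L') = B'"
    by (intro hsub_ty_Pi.IH) (auto simp: z(1)[symmetric] hsub_ty_Pi.prems)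
  then have "perm_ty (transpose y z) L' = perm_ty (transpose x z) B'" by auto
  then show ?case using z L(2) \<open>A2 = A'\<close> by simp
qed

lemma hsub_kind_deterministic:
  "hsub_kind \<theta> K L \<Longrightarrow> is_subst \<theta> \<Longrightarrow> hsub_kind \<theta> K L2 \<Longrightarrow> L2 = L"
proof (induction arbitrary: L2 rule: hsub_kind.induct)
  case (hsub_kind_Type \<theta>)
  then show ?case by (auto dest: hsub_kind_TypeE)
next
  case (hsub_kind_Pi x \<theta> A A' K K')
  from hsub_kind_KPiE[OF hsub_kind_Pi.prems(2)] obtain y L A2 L' where
    L: "KPi x A K = KPi y A L" "L2 = KPi y A2 L'" "sfresh y \<theta>" "hsub_ty \<theta> A A2" "hsub_kind \<theta> L L'"
    by blast
  have fin: "finite \<theta>" using hsub_kind_Pi.prems by (simp add: is_subst_def)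
  have "A2 = A'" using hsub_kind_Pi L hsub_ty_deterministic by blast
  obtain z where z: "perm_kind (transpose x z) K = perm_kind (transpose y z) L"
    "KPi x A' K' = KPi z A' (perm_kind (transpose x z) K')"
    "KPi y A' L' = KPi z A' (perm_kind (transpose y z) L')" "sfresh z \<theta>"
    using MOST_nat_ex4[OF KPi_eqD[OF L(1), THEN conjunct2] KPi_fresh[of x A' K'] KPi_fresh[of y A' L']
      MOST_sfresh[OF fin]]
    by blast
  have "hsub_kind \<theta> (perm_kind (transpose x z) (perm_kind (transpose y z) L))
      (perm_kind (transpose x z) (perm_kind (transpose y z) L'))"
    by (intro hsub_kind_transpose fin L hsub_kind_Pi z)
  then have "perm_kind (transpose x z) (perm_kind (transpose y z) L') = K'"
    by (intro hsub_kind_Pi.IH) (auto simp: z(1)[symmetric] hsub_kind_Pi.prems)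
  then have "perm_kind (transpose y z) L' = perm_kind (transpose x z) K'" by auto
  then show ?case using z L(2) \<open>A2 = A'\<close> by simp
qed

lemma hsub_ctx_deterministic:
  "hsub_ctx \<theta> \<Gamma> \<Delta> \<Longrightarrow> is_subst \<theta> \<Longrightarrow> hsub_ctx \<theta> \<Gamma> \<Delta>2 \<Longrightarrow> \<Delta>2 = \<Delta>"
proof (induction arbitrary: \<Delta>2 rule: hsub_ctx.induct)
  case (hsub_ctx_Nil \<theta>)
  from hsub_ctx_Nil(2) show ?case by cases
next
  case (hsub_ctx_Cons x \<theta> \<Gamma> \<Gamma>' A A')
  from hsub_ctx_Cons.prems(2) show ?case
    by cases (use hsub_ctx_Cons hsub_ty_deterministic in blast)
qed

lemma hsub_ty_PiD:
  assumes "hsub_ty \<theta> (Pi z A B) C" "finite \<theta>" "sfresh z \<theta>"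
  shows "(\<exists>A'. hsub_ty \<theta> A A') \<and> (\<exists>B'. hsub_ty \<theta> B B')"
proof -
  from hsub_ty_PiE[OF assms(1)] obtain y L A' L' where
    L: "Pi z A B = Pi y A L" "C = Pi y A' L'" "sfresh y \<theta>" "hsub_ty \<theta> A A'" "hsub_ty \<theta> L L'"
    by blast
  obtain w where
    w: "perm_ty (transpose z w) B = perm_ty (transpose y w) L" "sfresh w \<theta>"
    using MOST_nat_ex2[OF Pi_eqD[OF L(1), THEN conjunct2] MOST_sfresh[OF assms(2)]]
    by blast
  have "hsub_ty \<theta> (perm_ty (transpose z w) (perm_ty (transpose y w) L))
      (perm_ty (transpose z w) (perm_ty (transpose y w) L'))"
    by (intro hsub_ty_transpose assms L w)
  with L(4) show ?thesis by (auto simp: w(1)[symmetric])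
qed

lemma hsub_kind_KPiD:
  assumes "hsub_kind \<theta> (KPi z A K) C" "finite \<theta>" "sfresh z \<theta>"
  shows "(\<exists>A'. hsub_ty \<theta> A A') \<and> (\<exists>K'. hsub_kind \<theta> K K')"
proof -
  from hsub_kind_KPiE[OF assms(1)] obtain y L A' L' where
    L: "KPi z A K = KPi y A L" "C = KPi y A' L'" "sfresh y \<theta>" "hsub_ty \<theta> A A'" "hsub_kind \<theta> L L'"
    by blast
  obtain w where
    w: "perm_kind (transpose z w) K = perm_kind (transpose y w) L" "sfresh w \<theta>"
    using MOST_nat_ex2[OF KPi_eqD[OF L(1), THEN conjunct2] MOST_sfresh[OF assms(2)]]
    by blast
  have "hsub_kind \<theta> (perm_kind (transpose z w) (perm_kind (transpose y w) L))
      (perm_kind (transpose z w) (perm_kind (transpose y w) L'))"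
    by (intro hsub_kind_transpose assms L w)
  with L(4) show ?thesis by (auto simp: w(1)[symmetric])
qed

section \<open>Evaluating hereditary substitution on Goedel numbers\<close>

text \<open>
  A renaming is a list of pairs of names, standing for the composition of the transpositions
  they define. It is carried along until a variable is reached, so that the code of the subject
  decreases in recursive calls even though bound variables are renamed.
\<close>

definition ren :: "nat \<Rightarrow> nat \<Rightarrow> nat" where
  "ren r x = foldl (\<lambda>y a. if y = pfst a then psnd a else if y = psnd a then pfst a else y) x
    (list_decode r)"

lemma ren_0 [simp]: "ren 0 = id"
  by (simp add: ren_def fun_eq_iff)

lemma ren_Suc [simp]: "ren (Suc (prod_encode (prod_encode (x, z), r))) = ren r \<circ> transpose x z"
  by (simp add: ren_def fun_eq_iff transpose_def)

lemma ren_induct [case_names Nil Cons]: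
  assumes "P 0" "\<And>x z r. P r \<Longrightarrow> P (Suc (prod_encode (prod_encode (x, z), r)))"
  shows "P r"
proof (induction r rule: less_induct)
  case (less r)
  show ?case
  proof (cases r)
    case (Suc n)
    obtain a r' where n: "n = prod_encode (a, r')" by (rule pair_cases)
    obtain x z where a: "a = prod_encode (x, z)" by (rule pair_cases)
    have "r' < r" using le_prod_encode_2[of r' a] by (simp add: Suc n)
    then show ?thesis using assms(2) less.IH by (simp add: Suc n a)
  qed (use assms(1) in simp)
qed

lemma bij_ren: "bij (ren r)"
proof (induction r rule: ren_induct)
  case (Cons x z r)
  then show ?case unfolding ren_Suc by (intro bij_comp) simp_all
qed (simp add: ren_0 del: id_apply)

lemma ren_fresh: "r < z \<Longrightarrow> ren r z = z"
proof (induction r rule: ren_induct)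
  case (Cons x y r)
  have "x \<le> prod_encode (prod_encode (x, y), r)" "y \<le> prod_encode (prod_encode (x, y), r)"
    "r \<le> prod_encode (prod_encode (x, y), r)"
    by (meson le_prod_encode_1 le_prod_encode_2 order_trans)+
  with Cons.prems have "x < z" "y < z" "r < z" by linarith+
  then show ?case using Cons.IH by (simp add: transpose_def)
qed simp

lemma recursive_ren:
  assumes "recursive n f" "recursive n g"
  shows "recursive n (\<lambda>xs. ren (f xs) (g xs))"
proof -
  have "recursive1 (\<lambda>m. ren (pfst m) (psnd m))"
    unfolding ren_def by (rule recursive1_foldl) (intro recursive_intros; simp)+
  from recursive1_comp[OF this recursive_pair[OF assms]] show ?thesis by simp
qed

text \<open>The mode \<open>m\<close> selects the syntactic class: 0 canonical terms, 1 atomic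
  terms, 2 atomic types, 3 types, 4 kinds. A single function with a mode replaces a mutual
  recursion; \<open>t\<close>, \<open>r\<close> and \<open>c\<close> are the codes of substitution,
  renaming and subject.\<close>

definition arg :: "nat \<Rightarrow> nat \<Rightarrow> nat \<Rightarrow> nat \<Rightarrow> nat" where
  "arg m t r c = prod_encode (m, prod_encode (t, prod_encode (r, c)))"

abbreviation "arg_sub n \<equiv> pfst (psnd n)"
abbreviation "arg_ren n \<equiv> pfst (psnd (psnd n))"
abbreviation "arg_code n \<equiv> psnd (psnd (psnd n))"

definition extend_ren :: "nat \<Rightarrow> nat \<Rightarrow> nat" where
  "extend_ren x n = Suc (prod_encode (prod_encode (x, Suc n), arg_ren n))"

definition single :: "nat \<Rightarrow> nat \<Rightarrow> nat \<Rightarrow> nat" where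
  "single x c a = Suc (prod_encode (prod_encode (x, prod_encode (c, a)), 0))"

lemma arg_simps [simp]: "pfst (arg m t r c) = m" "arg_sub (arg m t r c) = t"
  "arg_ren (arg m t r c) = r" "arg_code (arg m t r c) = c"
  by (simp_all add: arg_def)

text \<open>
  A result 0 means that no judgement is derivable, or that the input is not the code of an
  expression. The successful results on atomic terms are tagged 0 if atomic and 1 if canonical;
  on types and kinds only success is recorded. The name \<open>Suc n\<close> exceeds all names in the
  input \<open>n\<close> and is therefore fresh.
\<close>

definition eval_tm :: "pfun \<Rightarrow> pfun" where
  "eval_tm F n = (if pfst (arg_code n) = 0
    then Option.bind (F (arg 1 (arg_sub n) (arg_ren n) (psnd (arg_code n)))) (\<lambda>v.
      Some (if v = 0 then 0 else if pfst (v - 1) = 0 then v else Suc (pfst (psnd (v - 1)))))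
    else if pfst (arg_code n) = 1
    then Option.bind (F (arg 0 (arg_sub n) (extend_ren (pfst (psnd (arg_code n))) n)
        (psnd (psnd (arg_code n))))) (\<lambda>v.
      Some (if v = 0 then 0 else Suc (prod_encode (1, prod_encode (Suc n, v - 1)))))
    else Some 0)"

text \<open>In the redex branch \<open>v - 1\<close> holds a tagged pair of a term and an arity. Tag
  1 of the term recognizes \<open>RLam\<close>, and a nonzero arity code recognizes
  \<open>Arr\<close>, since \<open>Base\<close> has code 0. The renaming restarts at 0 because the
  body is already the result of an evaluation that has applied \<open>r\<close>.\<close>

definition eval_atm :: "pfun \<Rightarrow> pfun" where
  "eval_atm F n = (if pfst (arg_code n) = 0
    then Some (Suc (prod_encode (0, arg_code n)))
    else if pfst (arg_code n) = 1
    then Some (if lookup (arg_sub n) (ren (arg_ren n) (psnd (arg_code n))) = 0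
      then Suc (prod_encode (0, prod_encode (1, ren (arg_ren n) (psnd (arg_code n)))))
      else Suc (prod_encode (1, lookup (arg_sub n) (ren (arg_ren n) (psnd (arg_code n))) - 1)))
    else if pfst (arg_code n) = 2
    then Option.bind (F (arg 1 (arg_sub n) (arg_ren n) (pfst (psnd (arg_code n))))) (\<lambda>v.
      Option.bind (F (arg 0 (arg_sub n) (arg_ren n) (psnd (psnd (arg_code n))))) (\<lambda>w.
        if v = 0 \<or> w = 0 then Some 0
        else if pfst (v - 1) = 0
        then Some (Suc (prod_encode (0, prod_encode (2, prod_encode (psnd (v - 1), w - 1)))))
        else if pfst (pfst (psnd (v - 1))) = 1 \<and> psnd (psnd (v - 1)) \<noteq> 0
        then Option.bind
          (F (arg 0 (single (pfst (psnd (pfst (psnd (v - 1))))) (w - 1) (pfst (psnd (psnd (v - 1)) - 1)))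
            0 (psnd (psnd (pfst (psnd (v - 1))))))) (\<lambda>k.
          Some (if k = 0 then 0
            else Suc (prod_encode (1, prod_encode (k - 1, psnd (psnd (psnd (v - 1)) - 1))))))
        else Some 0))
    else Some 0)"

definition eval_aty :: "pfun \<Rightarrow> pfun" where
  "eval_aty F n = (if pfst (arg_code n) = 0 then Some 1
    else if pfst (arg_code n) = 1
    then Option.bind (F (arg 2 (arg_sub n) (arg_ren n) (pfst (psnd (arg_code n))))) (\<lambda>v.
      Option.bind (F (arg 0 (arg_sub n) (arg_ren n) (psnd (psnd (arg_code n))))) (\<lambda>w.
        Some (if v = 0 \<or> w = 0 then 0 else 1)))
    else Some 0)"

definition eval_ty :: "pfun \<Rightarrow> pfun" where
  "eval_ty F n = (if pfst (arg_code n) = 0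
    then F (arg 2 (arg_sub n) (arg_ren n) (psnd (arg_code n)))
    else if pfst (arg_code n) = 1
    then Option.bind (F (arg 3 (arg_sub n) (arg_ren n) (pfst (psnd (psnd (arg_code n)))))) (\<lambda>v.
      Option.bind (F (arg 3 (arg_sub n) (extend_ren (pfst (psnd (arg_code n))) n)
          (psnd (psnd (psnd (arg_code n)))))) (\<lambda>w.
        Some (if v = 0 \<or> w = 0 then 0 else 1)))
    else Some 0)"

definition eval_kind :: "pfun \<Rightarrow> pfun" where
  "eval_kind F n = (if arg_code n = 0 then Some 1
    else Option.bind (F (arg 3 (arg_sub n) (arg_ren n) (pfst (psnd (arg_code n - 1))))) (\<lambda>v.
      Option.bind (F (arg 4 (arg_sub n) (extend_ren (pfst (arg_code n - 1)) n)
          (psnd (psnd (arg_code n - 1))))) (\<lambda>w.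
        Some (if v = 0 \<or> w = 0 then 0 else 1))))"

definition eval_step :: "pfun \<Rightarrow> pfun" where
  "eval_step F n = (if pfst n = 0 then eval_tm F n else if pfst n = 1 then eval_atm F n
    else if pfst n = 2 then eval_aty F n else if pfst n = 3 then eval_ty F n else eval_kind F n)"

lemma functional_eval_step: "functional eval_step"
proof -
  have arg: "recursive n (\<lambda>xs. arg (m xs) (t xs) (r xs) (c xs))"
    if "recursive n m" "recursive n t" "recursive n r" "recursive n c" for n m t r c
    unfolding arg_def by (intro recursive_intros that)
  have extend: "recursive n (\<lambda>xs. extend_ren (x xs) (k xs))"
    if "recursive n x" "recursive n k" for n x k
    unfolding extend_ren_def by (intro recursive_intros that)
  have single: "recursive n (\<lambda>xs. single (x xs) (c xs) (a xs))"
    if "recursive n x" "recursive n c" "recursive n a" for n x c a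
    unfolding single_def by (intro recursive_intros that)
  note intros = functional_if functional_bind functional_Some functional_call recursive_intros
    arg extend single recursive_lookup recursive_ren
  have "functional eval_tm" unfolding eval_tm_def[abs_def] by (intro intros; simp)
  moreover have "functional eval_atm" unfolding eval_atm_def[abs_def] by (intro intros; simp)
  moreover have "functional eval_aty" unfolding eval_aty_def[abs_def] by (intro intros; simp)
  moreover have "functional eval_ty" unfolding eval_ty_def[abs_def] by (intro intros; simp)
  moreover have "functional eval_kind" unfolding eval_kind_def[abs_def] by (intro intros; simp)
  moreover have "decides 1 (\<lambda>xs. pfst (xs ! 0) = k)" for k by (intro recursive_intros) simp
  ultimately show ?thesis
    unfolding eval_step_def[abs_def] by (intro functional_if)
qed

definition eval :: pfun where "eval = lfpf eval_step"

lemma eval_arg: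
  "eval (arg 0 t r c) = eval_tm eval (arg 0 t r c)"
  "eval (arg 1 t r c) = eval_atm eval (arg 1 t r c)"
  "eval (arg 2 t r c) = eval_aty eval (arg 2 t r c)"
  "eval (arg 3 t r c) = eval_ty eval (arg 3 t r c)"
  "eval (arg 4 t r c) = eval_kind eval (arg 4 t r c)"
  using lfpf_unfold[OF functional_eval_step, folded eval_def]
  by (simp_all add: eval_step_def)

section \<open>Shapes, sizes and names of codes\<close>

lemma code_tm_eq_pair:
  "code_tm M = prod_encode (a, b) \<longleftrightarrow> (\<exists>R. a = 0 \<and> M = RAtom R \<and> b = code_atm R) \<or>
    (\<exists>x N. a = 1 \<and> M = RLam x N \<and> b = prod_encode (x, code_tm N))"
  by (cases M) auto

lemma code_atm_eq_pair:
  "code_atm R = prod_encode (a, b) \<longleftrightarrow> (a = 0 \<and> R = RConst b) \<or> (a = 1 \<and> R = RVar b) \<or>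
    (\<exists>S M. a = 2 \<and> R = RApp S M \<and> b = prod_encode (code_atm S, code_tm M))"
  by (cases R) auto

lemma code_aty_eq_pair:
  "code_aty P = prod_encode (a, b) \<longleftrightarrow> (a = 0 \<and> P = RTConst b) \<or>
    (\<exists>Q M. a = 1 \<and> P = RTApp Q M \<and> b = prod_encode (code_aty Q, code_tm M))"
  by (cases P) auto

lemma code_ty_eq_pair:
  "code_ty A = prod_encode (a, b) \<longleftrightarrow> (\<exists>P. a = 0 \<and> A = RTAtom P \<and> b = code_aty P) \<or>
    (\<exists>x B C. a = 1 \<and> A = RPi x B C \<and> b = prod_encode (x, prod_encode (code_ty B, code_ty C)))"
  by (cases A) auto

text \<open>Only a positive tag gives strictness. With tag 0 there is just \<open>\<le>\<close>:
  \<open>RConst 0\<close> and \<open>RAtom (RConst 0)\<close> both have code 0, so passing from a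
  term to its atomic term need not decrease the code.\<close>

lemma less_prod_encode: "0 < a \<Longrightarrow> b < prod_encode (a, b)"
proof -
  have "k \<le> triangle k" for k by (induction k) auto
  from this[of "a + b"] show "0 < a \<Longrightarrow> b < prod_encode (a, b)"
    by (simp add: prod_encode_def)
qed

lemma less_prod_encode2: "0 < a \<Longrightarrow> b < prod_encode (a, prod_encode (b, c))"
  and less_prod_encode3: "0 < a \<Longrightarrow> c < prod_encode (a, prod_encode (b, c))"
  using less_prod_encode[of a "prod_encode (b, c)"] le_prod_encode_1[of b c] le_prod_encode_2[of c b]
  by linarith+

lemma name_le_code_tm: "x \<in> set_rtm M \<Longrightarrow> x \<le> code_tm M"
  and name_le_code_atm: "x \<in> set_ratm R \<Longrightarrow> x \<le> code_atm R"
  by (induction M and R rule: rtm.induct ratm.induct)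
    (auto intro: order_trans[OF _ le_prod_encode_2] order_trans[OF _ le_prod_encode_1]
      order_trans[OF le_prod_encode_1 le_prod_encode_2] le_prod_encode_2)

lemma name_le_code_aty: "x \<in> set_raty P \<Longrightarrow> x \<le> code_aty P"
  by (induction P)
    (auto intro: order_trans[OF _ le_prod_encode_2] order_trans[OF _ le_prod_encode_1] name_le_code_tm)

lemma name_le_code_ty: "x \<in> set_rty A \<Longrightarrow> x \<le> code_ty A"
  by (induction A)
    (auto intro: order_trans[OF _ le_prod_encode_2] order_trans[OF _ le_prod_encode_1] name_le_code_aty)

lemma name_le_code_kind: "x \<in> set_rkind K \<Longrightarrow> x \<le> code_kind K"
  by (induction K)
    (auto intro!: le_SucI intro: order_trans[OF _ le_prod_encode_2] order_trans[OF _ le_prod_encode_1]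
      name_le_code_ty)

lemma mem_le_list_encode: "a \<in> set as \<Longrightarrow> a \<le> list_encode as"
  by (induction as)
    (auto intro!: le_SucI intro: order_trans[OF _ le_prod_encode_2] le_prod_encode_1)

lemma mem_le_code_subst:
  "(x, M, \<alpha>) \<in> set s \<Longrightarrow> prod_encode (x, prod_encode (code_tm M, code_arity \<alpha>)) \<le> code_subst s"
  unfolding code_subst_def by (rule mem_le_list_encode) force

lemma mem_abs_subst: "(x, M, \<alpha>) \<in> abs_subst s \<longleftrightarrow> (\<exists>N. (x, N, \<alpha>) \<in> set s \<and> M = abs_tm N)"
  by (force simp: abs_subst_def)

lemma finite_abs_subst: "finite (abs_subst s)"
  by (simp add: abs_subst_def)

lemma sfresh_code_subst:
  assumes "code_subst s < z"
  shows "sfresh z (abs_subst s)"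
proof -
  have "x < z \<and> z \<notin> fv (abs_tm N)" if "(x, N, \<alpha>) \<in> set s" for x N \<alpha>
  proof -
    have "code_tm N \<le> code_subst s" "x \<le> code_subst s"
      using mem_le_code_subst[OF that] le_prod_encode_1 le_prod_encode_2 order_trans by metis+
    then have "x < z" "z \<notin> set_rtm N" using assms name_le_code_tm[of z N] by auto
    then show ?thesis using fv_subset_set(1)[of N] by (auto simp: fv.abs_eq)
  qed
  then show ?thesis by (force simp: sfresh_def sdom_def srng_def mem_abs_subst)
qed

lemma le_arg: "t \<le> arg m t r c" "r \<le> arg m t r c" "c \<le> arg m t r c"
  unfolding arg_def by (meson le_prod_encode_1 le_prod_encode_2 order_trans)+

lemma perm_abs:
  assumes "bij p"
  shows "perm_tm p (abs_tm (RAtom R)) = Atom (perm_atm p (abs_atm R))"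
    "perm_tm p (abs_tm (RLam x M)) = Lam (p x) (perm_tm p (abs_tm M))"
    "perm_atm p (abs_atm (RConst c)) = Const c"
    "perm_atm p (abs_atm (RVar x)) = Var (p x)"
    "perm_atm p (abs_atm (RApp R M)) = App (perm_atm p (abs_atm R)) (perm_tm p (abs_tm M))"
    "perm_aty p (abs_aty (RTConst c)) = TConst c"
    "perm_aty p (abs_aty (RTApp P M)) = TApp (perm_aty p (abs_aty P)) (perm_tm p (abs_tm M))"
    "perm_ty p (abs_ty (RTAtom P)) = TAtom (perm_aty p (abs_aty P))"
    "perm_ty p (abs_ty (RPi x A B)) = Pi (p x) (perm_ty p (abs_ty A)) (perm_ty p (abs_ty B))"
    "perm_kind p (abs_kind RType) = Type"
    "perm_kind p (abs_kind (RKPi x A K)) = KPi (p x) (perm_ty p (abs_ty A)) (perm_kind p (abs_kind K))"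
  unfolding Atom.abs_eq[symmetric] Lam.abs_eq[symmetric] Const.abs_eq[symmetric]
    Var.abs_eq[symmetric] App.abs_eq[symmetric] TConst.abs_eq[symmetric] TApp.abs_eq[symmetric]
    TAtom.abs_eq[symmetric] Pi.abs_eq[symmetric] Type_def[symmetric] KPi.abs_eq[symmetric]
  using assms by simp_all

text \<open>In contrast to \<open>Lam_fresh\<close> the admissible names are explicit, because the
  evaluation opens a binder at a computed name.\<close>

lemma abs_RLam_rename:
  assumes "z \<notin> set_rtm M"
  shows "abs_tm (RLam x M) = Lam z (perm_tm (transpose x z) (abs_tm M))"
  using alpha_tm_rename[OF assms, of x]
  by (simp add: perm_tm.abs_eq Lam.abs_eq tm.abs_eq_iff)

lemma abs_RPi_rename:
  assumes "z \<notin> set_rty B"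
  shows "abs_ty (RPi x A B) = Pi z (abs_ty A) (perm_ty (transpose x z) (abs_ty B))"
  using alpha_ty_rename[OF assms, of x A]
  by (simp add: perm_ty.abs_eq Pi.abs_eq ty.abs_eq_iff)

lemma abs_RKPi_rename:
  assumes "z \<notin> set_rkind K"
  shows "abs_kind (RKPi x A K) = KPi z (abs_ty A) (perm_kind (transpose x z) (abs_kind K))"
  using alpha_kind_rename[OF assms, of x A]
  by (simp add: perm_kind.abs_eq KPi.abs_eq kind.abs_eq_iff)

lemma extend_ren_arg:
  "ren (extend_ren x (arg m t r c)) = ren r \<circ> transpose x (Suc (arg m t r c))"
  by (simp add: extend_ren_def)

text \<open>\<open>ren r\<close> fixes the new name, which exceeds \<open>r\<close>, and the new
  pair acts before those of \<open>r\<close>. Opening at the new name and then renaming by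
  \<open>r\<close> is therefore the extended renaming.\<close>

lemma ren_abs_RLam:
  assumes "code_tm M \<le> c"
  shows "perm_tm (ren r) (abs_tm (RLam x M)) =
    Lam (Suc (arg m t r c)) (perm_tm (ren (extend_ren x (arg m t r c))) (abs_tm M))"
proof -
  have "Suc (arg m t r c) \<notin> set_rtm M"
    using name_le_code_tm[of "Suc (arg m t r c)" M] assms le_arg(3)[of c m t r] by auto
  then show ?thesis
    using ren_fresh[of r "Suc (arg m t r c)"] le_arg(2)[of r m t c]
    by (simp add: abs_RLam_rename bij_ren perm_comp extend_ren_arg)
qed

lemma ren_abs_RPi:
  assumes "code_ty B \<le> c"
  shows "perm_ty (ren r) (abs_ty (RPi x A B)) = Pi (Suc (arg m t r c)) (perm_ty (ren r) (abs_ty A))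
    (perm_ty (ren (extend_ren x (arg m t r c))) (abs_ty B))"
proof -
  have "Suc (arg m t r c) \<notin> set_rty B"
    using name_le_code_ty[of "Suc (arg m t r c)" B] assms le_arg(3)[of c m t r] by auto
  then show ?thesis
    using ren_fresh[of r "Suc (arg m t r c)"] le_arg(2)[of r m t c]
    by (simp add: abs_RPi_rename bij_ren perm_comp extend_ren_arg)
qed

lemma ren_abs_RKPi:
  assumes "code_kind K \<le> c"
  shows "perm_kind (ren r) (abs_kind (RKPi x A K)) = KPi (Suc (arg m t r c))
    (perm_ty (ren r) (abs_ty A)) (perm_kind (ren (extend_ren x (arg m t r c))) (abs_kind K))"
proof -
  have "Suc (arg m t r c) \<notin> set_rkind K"
    using name_le_code_kind[of "Suc (arg m t r c)" K] assms le_arg(3)[of c m t r] by auto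
  then show ?thesis
    using ren_fresh[of r "Suc (arg m t r c)"] le_arg(2)[of r m t c]
    by (simp add: abs_RKPi_rename bij_ren perm_comp extend_ren_arg)
qed

lemma lookup_code_subst:
  "lookup (code_subst s) x = 0 \<Longrightarrow> x \<notin> sdom (abs_subst s)"
  "lookup (code_subst s) x = Suc v \<Longrightarrow>
    \<exists>M \<alpha>. (x, M, \<alpha>) \<in> set s \<and> v = prod_encode (code_tm M, code_arity \<alpha>)"
proof -
  let ?xs = "map (\<lambda>(x, M, \<alpha>). (x, prod_encode (code_tm M, code_arity \<alpha>))) s"
  have "code_subst s = list_encode (map prod_encode ?xs)"
    by (simp add: code_subst_def case_prod_unfold comp_def)
  then have eq: "lookup (code_subst s) x = code_opt (map_of ?xs x)"
    by (simp only: lookup_list_encode)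
  show "x \<notin> sdom (abs_subst s)" if "lookup (code_subst s) x = 0"
  proof -
    have "x \<notin> fst ` set s" using that by (force simp: eq map_of_eq_None_iff)
    then show ?thesis by (force simp: sdom_def mem_abs_subst)
  qed
  show "\<exists>M \<alpha>. (x, M, \<alpha>) \<in> set s \<and> v = prod_encode (code_tm M, code_arity \<alpha>)"
    if "lookup (code_subst s) x = Suc v"
  proof -
    have "(x, v) \<in> set ?xs" using that by (simp only: eq code_opt_simps map_of_SomeD)
    then show ?thesis by auto
  qed
qed

section \<open>Correctness and termination of the evaluation\<close>

text \<open>Success returns the code of one raw representative \<open>N\<close>, while failure
  excludes every result in the quotient. The failure clause also covers a \<open>c\<close> that
  codes no term.\<close>

definition tm_result :: "rsubst \<Rightarrow> nat \<Rightarrow> nat \<Rightarrow> nat \<Rightarrow> bool" where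
  "tm_result s r c v \<longleftrightarrow>
    (v = 0 \<and> (\<forall>M N. c = code_tm M \<longrightarrow> \<not> hsub_tm (abs_subst s) (perm_tm (ren r) (abs_tm M)) N)) \<or>
    (\<exists>M N. c = code_tm M \<and> v = Suc (code_tm N) \<and>
      hsub_tm (abs_subst s) (perm_tm (ren r) (abs_tm M)) (abs_tm N))"

text \<open>The bound \<open>k\<close> on the arity makes the substitution performed in a redex terminate.\<close>

definition atm_result :: "nat \<Rightarrow> rsubst \<Rightarrow> nat \<Rightarrow> nat \<Rightarrow> nat \<Rightarrow> bool" where
  "atm_result k s r c v \<longleftrightarrow>
    (v = 0 \<and> (\<forall>R. c = code_atm R \<longrightarrow>
      (\<forall>R'. \<not> hsub_atm (abs_subst s) (perm_atm (ren r) (abs_atm R)) R') \<and>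
      (\<forall>N \<alpha>. \<not> hsub_can (abs_subst s) (perm_atm (ren r) (abs_atm R)) N \<alpha>))) \<or>
    (\<exists>R R'. c = code_atm R \<and> v = Suc (prod_encode (0, code_atm R')) \<and>
      hsub_atm (abs_subst s) (perm_atm (ren r) (abs_atm R)) (abs_atm R')) \<or>
    (\<exists>R N \<alpha>. c = code_atm R \<and> v = Suc (prod_encode (1, prod_encode (code_tm N, code_arity \<alpha>))) \<and>
      size \<alpha> \<le> k \<and> hsub_can (abs_subst s) (perm_atm (ren r) (abs_atm R)) (abs_tm N) \<alpha>)"

lemma atm_result_none:
  assumes "\<And>R R'. c = code_atm R \<Longrightarrow> \<not> hsub_atm (abs_subst s) (perm_atm (ren r) (abs_atm R)) R'"
    and "\<And>R N \<alpha>. c = code_atm R \<Longrightarrow> \<not> hsub_can (abs_subst s) (perm_atm (ren r) (abs_atm R)) N \<alpha>"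
  shows "atm_result k s r c 0"
  using assms unfolding atm_result_def by blast

lemma atm_result_atm:
  assumes "hsub_atm (abs_subst s) (perm_atm (ren r) (abs_atm R)) (abs_atm R')" "c = code_atm R"
  shows "atm_result k s r c (Suc (prod_encode (0, code_atm R')))"
  using assms unfolding atm_result_def by blast

lemma atm_result_can:
  assumes "hsub_can (abs_subst s) (perm_atm (ren r) (abs_atm R)) (abs_tm N) \<alpha>" "c = code_atm R"
    "size \<alpha> \<le> k"
  shows "atm_result k s r c (Suc (prod_encode (1, prod_encode (code_tm N, code_arity \<alpha>))))"
  using assms unfolding atm_result_def by blast

definition ok_subst :: "nat \<Rightarrow> rsubst \<Rightarrow> bool" where
  "ok_subst k s \<longleftrightarrow> distinct (map fst s) \<and> (\<forall>(x, M, \<alpha>) \<in> set s. size \<alpha> \<le> k)"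

lemma is_subst_ok: "ok_subst k s \<Longrightarrow> is_subst (abs_subst s)"
  by (auto simp: ok_subst_def is_subst_iff)

lemma tm_result_0:
  "tm_result s r c 0 \<longleftrightarrow>
    (\<forall>M N. c = code_tm M \<longrightarrow> \<not> hsub_tm (abs_subst s) (perm_tm (ren r) (abs_tm M)) N)"
  by (simp add: tm_result_def)

lemma tm_result_Suc:
  "tm_result s r c (Suc v) \<longleftrightarrow> (\<exists>M N. c = code_tm M \<and> v = code_tm N \<and>
      hsub_tm (abs_subst s) (perm_tm (ren r) (abs_tm M)) (abs_tm N))"
  by (simp add: tm_result_def)

lemma abs_tm_RAtom: "abs_tm (RAtom R) = Atom (abs_atm R)"
  and abs_tm_RLam: "abs_tm (RLam x M) = Lam x (abs_tm M)"
  and abs_atm_RApp: "abs_atm (RApp R M) = App (abs_atm R) (abs_tm M)"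
  and abs_atm_RConst: "abs_atm (RConst c) = Const c"
  and abs_atm_RVar: "abs_atm (RVar x) = Var x"
  by (simp_all add: Atom.abs_eq Lam.abs_eq App.abs_eq Const.abs_eq Var.abs_eq)

text \<open>The hypotheses mirror the recursive calls. The one for atomic terms allows
  \<open>c' = c\<close>, as tag 0 gives no strict decrease; the one for terms allows any
  \<open>r'\<close>, as the renaming grows under a binder.\<close>

lemma eval_tm_result:
  assumes s: "ok_subst k s" and t: "t = code_subst s"
    and atm: "\<And>c'. c' \<le> c \<Longrightarrow> \<exists>v. eval (arg 1 t r c') = Some v \<and> atm_result k s r c' v"
    and tm: "\<And>c' r'. c' < c \<Longrightarrow> \<exists>v. eval (arg 0 t r' c') = Some v \<and> tm_result s r' c' v"
  shows "\<exists>v. eval (arg 0 t r c) = Some v \<and> tm_result s r c v"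
proof -
  let ?\<theta> = "abs_subst s"
  obtain a b where c: "c = prod_encode (a, b)" by (rule pair_cases)
  consider "a = 0" | "a = 1" | "a \<ge> 2" by linarith
  then show ?thesis
  proof cases
    case 1
    then have "b \<le> c" by (simp add: c le_prod_encode_2)
    from atm[OF this] obtain v where v: "eval (arg 1 t r b) = Some v" "atm_result k s r b v" by blast
    have E: "eval (arg 0 t r c) =
        Some (if v = 0 then 0 else if pfst (v - 1) = 0 then v else Suc (pfst (psnd (v - 1))))"
      using v(1) by (simp add: eval_arg(1) eval_tm_def c 1)
    from v(2) consider
      (none) "v = 0" "\<And>R. b = code_atm R \<Longrightarrow>
        (\<forall>R'. \<not> hsub_atm ?\<theta> (perm_atm (ren r) (abs_atm R)) R') \<and>
        (\<forall>N \<alpha>. \<not> hsub_can ?\<theta> (perm_atm (ren r) (abs_atm R)) N \<alpha>)"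
      | (atm) R R' where "b = code_atm R" "v = Suc (prod_encode (0, code_atm R'))"
        "hsub_atm ?\<theta> (perm_atm (ren r) (abs_atm R)) (abs_atm R')"
      | (can) R N \<alpha> where "b = code_atm R"
        "v = Suc (prod_encode (1, prod_encode (code_tm N, code_arity \<alpha>)))"
        "hsub_can ?\<theta> (perm_atm (ren r) (abs_atm R)) (abs_tm N) \<alpha>"
      unfolding atm_result_def by blast
    then have "tm_result s r c (if v = 0 then 0 else if pfst (v - 1) = 0 then v
        else Suc (pfst (psnd (v - 1))))"
    proof cases
      case none
      have "\<not> hsub_tm ?\<theta> (perm_tm (ren r) (abs_tm M)) N" if "c = code_tm M" for M N
      proof -
        obtain R where "M = RAtom R" "b = code_atm R"
          using \<open>c = code_tm M\<close>[symmetric] by (auto simp: c 1 code_tm_eq_pair)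
        then show ?thesis using none(2)[of R] hsub_tm_AtomE by (fastforce simp: perm_abs bij_ren)
      qed
      then show ?thesis using none by (simp add: tm_result_0)
    next
      case (atm R R')
      \<comment> \<open>The tag 0 of an atomic result coincides with the tag of
        \<open>RAtom\<close>, so \<open>v\<close> can be returned unchanged as the coded
        term.\<close>
      have "c = code_tm (RAtom R)" "v = Suc (code_tm (RAtom R'))" using atm by (simp_all add: c 1)
      moreover have "hsub_tm ?\<theta> (perm_tm (ren r) (abs_tm (RAtom R))) (abs_tm (RAtom R'))"
        using atm hsub_tm_atm by (simp add: perm_abs bij_ren abs_tm_RAtom[of R'])
      ultimately have "tm_result s r c v" unfolding tm_result_def by blast
      then show ?thesis using atm(2) by simp
    next
      case (can R N \<alpha>)
      have "c = code_tm (RAtom R)" using can by (simp add: c 1)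
      moreover have "hsub_tm ?\<theta> (perm_tm (ren r) (abs_tm (RAtom R))) (abs_tm N)"
        using can hsub_tm_can by (auto simp: perm_abs bij_ren)
      ultimately have "tm_result s r c (Suc (code_tm N))" unfolding tm_result_def by blast
      then show ?thesis using can(2) by simp
    qed
    with E show ?thesis by blast
  next
    case 2
    obtain x d where b: "b = prod_encode (x, d)" by (rule pair_cases)
    let ?n = "arg 0 t r c" let ?r = "extend_ren x ?n"
    have "d < c" by (simp add: c b 2 less_prod_encode3)
    from tm[OF this] obtain v where v: "eval (arg 0 t ?r d) = Some v" "tm_result s ?r d v" by blast
    have E: "eval ?n = Some (if v = 0 then 0 else Suc (prod_encode (1, prod_encode (Suc ?n, v - 1))))"
      using v(1) by (simp add: eval_arg(1) eval_tm_def c 2 b)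
    have fresh: "sfresh (Suc ?n) ?\<theta>"
      using sfresh_code_subst[of s "Suc ?n"] le_arg(1)[of t 0 r c] by (simp add: t)
    show ?thesis
    proof (cases v)
      case 0
      \<comment> \<open>A derivation may open the binder at any fresh name;
        \<open>hsub_tm_LamD\<close> moves it to \<open>Suc ?n\<close>, where the recursive call has
        reported failure.\<close>
      have "\<not> hsub_tm ?\<theta> (perm_tm (ren r) (abs_tm M)) N" if M: "c = code_tm M" for M N
      proof
        assume H: "hsub_tm ?\<theta> (perm_tm (ren r) (abs_tm M)) N"
        obtain M' where M': "M = RLam x M'" "d = code_tm M'"
          using M[symmetric] by (auto simp: c 2 b code_tm_eq_pair)
        have "perm_tm (ren r) (abs_tm M) = Lam (Suc ?n) (perm_tm (ren ?r) (abs_tm M'))"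
          unfolding M'(1) by (rule ren_abs_RLam) (use \<open>d < c\<close> M'(2) in simp)
        with H have "\<exists>N'. hsub_tm ?\<theta> (perm_tm (ren ?r) (abs_tm M')) N'"
          using hsub_tm_LamD[OF _ finite_abs_subst fresh] by simp
        then show False using v(2) 0 M'(2) by (simp add: tm_result_0)
      qed
      then show ?thesis using E 0 by (simp add: tm_result_0)
    next
      case (Suc v')
      with v(2) obtain M N where M: "d = code_tm M" "v' = code_tm N"
        "hsub_tm ?\<theta> (perm_tm (ren ?r) (abs_tm M)) (abs_tm N)" by (auto simp: tm_result_Suc)
      have "c = code_tm (RLam x M)" by (simp add: c 2 b M)
      moreover have "hsub_tm ?\<theta> (perm_tm (ren r) (abs_tm (RLam x M))) (abs_tm (RLam (Suc ?n) N))"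
        using ren_abs_RLam[of M c r x 0 t] \<open>d < c\<close> M hsub_tm_Lam[OF fresh M(3)]
        by (simp add: abs_tm_RLam[of "Suc ?n"])
      moreover have "Suc (prod_encode (1, prod_encode (Suc ?n, v'))) = Suc (code_tm (RLam (Suc ?n) N))"
        by (simp add: M)
      ultimately have "tm_result s r c (Suc (prod_encode (1, prod_encode (Suc ?n, v'))))"
        unfolding tm_result_def by blast
      with E Suc show ?thesis by simp
    qed
  next
    case 3
    have "c \<noteq> code_tm M" for M
      using 3 code_tm_eq_pair[of M a b] by (auto simp: c)
    moreover have "eval (arg 0 t r c) = Some 0" using 3 by (simp add: eval_arg(1) eval_tm_def c)
    ultimately show ?thesis by (simp add: tm_result_0)
  qed
qed

lemma code_subst_single: "code_subst [(x, M, \<alpha>)] = single x (code_tm M) (code_arity \<alpha>)"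
  by (simp add: code_subst_def single_def)

lemma abs_subst_single: "abs_subst [(x, M, \<alpha>)] = {(x, abs_tm M, \<alpha>)}"
  by (simp add: abs_subst_def)

text \<open>The body of a redex comes out of the substitution, so its code is unrelated to
  \<open>c\<close>. The hypothesis \<open>redex\<close> therefore admits all codes and renamings, at
  the price of a smaller bound \<open>k'\<close>.\<close>

lemma eval_atm_result:
  assumes s: "ok_subst k s" and t: "t = code_subst s"
    and atm: "\<And>c'. c' < c \<Longrightarrow> \<exists>v. eval (arg 1 t r c') = Some v \<and> atm_result k s r c' v"
    and tm: "\<And>c'. c' < c \<Longrightarrow> \<exists>v. eval (arg 0 t r c') = Some v \<and> tm_result s r c' v"
    and redex: "\<And>k' s' r' c'. k' < k \<Longrightarrow> ok_subst k' s' \<Longrightarrow>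
      \<exists>v. eval (arg 0 (code_subst s') r' c') = Some v \<and> tm_result s' r' c' v"
  shows "\<exists>v. eval (arg 1 t r c) = Some v \<and> atm_result k s r c v"
proof -
  let ?\<theta> = "abs_subst s"
  note subst = is_subst_ok[OF s]
  obtain a b where c: "c = prod_encode (a, b)" by (rule pair_cases)
  consider "a = 0" | "a = 1" | "a = 2" | "a \<ge> 3" by linarith
  then show ?thesis
  proof cases
    case 1
    have cc: "c = code_atm (RConst b)" by (simp add: c 1)
    have "hsub_atm ?\<theta> (perm_atm (ren r) (abs_atm (RConst b))) (abs_atm (RConst b))"
      by (simp add: perm_abs bij_ren abs_atm_RConst hsub_atm_Const)
    from atm_result_atm[OF this cc] have "atm_result k s r c (Suc (prod_encode (0, c)))"
      by (simp only: cc)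
    moreover have "eval (arg 1 t r c) = Some (Suc (prod_encode (0, c)))"
      by (simp add: eval_arg(2)[unfolded One_nat_def] eval_atm_def c 1)
    ultimately show ?thesis by blast
  next
    case 2
    let ?x = "ren r b"
    have cv: "c = code_atm (RVar b)" by (simp add: c 2)
    have p: "perm_atm (ren r) (abs_atm (RVar b)) = Var ?x" by (simp add: perm_abs bij_ren)
    show ?thesis
    proof (cases "lookup t ?x")
      case 0
      then have "?x \<notin> sdom ?\<theta>" using lookup_code_subst(1) by (simp add: t)
      then have "hsub_atm ?\<theta> (perm_atm (ren r) (abs_atm (RVar b))) (abs_atm (RVar ?x))"
        unfolding p unfolding abs_atm_RVar by (rule hsub_atm_Var)
      moreover have "eval (arg 1 t r c) = Some (Suc (prod_encode (0, code_atm (RVar ?x))))"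
        using 0 by (simp add: eval_arg(2)[unfolded One_nat_def] eval_atm_def c 2)
      ultimately show ?thesis using atm_result_atm[OF _ cv] by blast
    next
      case (Suc v)
      with lookup_code_subst(2) obtain M \<alpha> where
        M: "(?x, M, \<alpha>) \<in> set s" "v = prod_encode (code_tm M, code_arity \<alpha>)" by (metis t)
      then have "hsub_can ?\<theta> (perm_atm (ren r) (abs_atm (RVar b))) (abs_tm M) \<alpha>"
        by (auto simp: p mem_abs_subst intro!: hsub_can_Var)
      moreover have "size \<alpha> \<le> k" using s M(1) by (auto simp: ok_subst_def)
      moreover have "eval (arg 1 t r c) =
          Some (Suc (prod_encode (1, prod_encode (code_tm M, code_arity \<alpha>))))"
        using Suc M by (simp add: eval_arg(2)[unfolded One_nat_def] eval_atm_def c 2)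
      ultimately show ?thesis using atm_result_can[OF _ cv] by blast
    qed
  next
    case 3
    obtain d e where b: "b = prod_encode (d, e)" by (rule pair_cases)
    have less: "d < c" "e < c" by (simp_all add: c b 3 less_prod_encode2 less_prod_encode3)
    from atm[OF less(1)] obtain v where v: "eval (arg 1 t r d) = Some v" "atm_result k s r d v" by blast
    from tm[OF less(2)] obtain w where w: "eval (arg 0 t r e) = Some w" "tm_result s r e w" by blast
    have E: "eval (arg 1 t r c) = (if v = 0 \<or> w = 0 then Some 0
        else if pfst (v - 1) = 0
        then Some (Suc (prod_encode (0, prod_encode (2, prod_encode (psnd (v - 1), w - 1)))))
        else if pfst (pfst (psnd (v - 1))) = 1 \<and> psnd (psnd (v - 1)) \<noteq> 0
        then Option.bind
          (eval (arg 0 (single (pfst (psnd (pfst (psnd (v - 1))))) (w - 1) (pfst (psnd (psnd (v - 1)) - 1)))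
            0 (psnd (psnd (pfst (psnd (v - 1))))))) (\<lambda>k.
          Some (if k = 0 then 0
            else Suc (prod_encode (1, prod_encode (k - 1, psnd (psnd (psnd (v - 1)) - 1))))))
        else Some 0)"
      using v(1) w(1) by (simp add: eval_arg(2) eval_atm_def c 3 b del: One_nat_def)
    have c_app: "c = code_atm S \<longleftrightarrow> (\<exists>R M. S = RApp R M \<and> d = code_atm R \<and> e = code_tm M)" for S
      using code_atm_eq_pair[of S a b] by (auto simp: c b 3)
    have p: "perm_atm (ren r) (abs_atm (RApp R M)) =
        App (perm_atm (ren r) (abs_atm R)) (perm_tm (ren r) (abs_tm M))" for R M
      by (simp add: perm_abs bij_ren)
    show ?thesis
    proof (cases "v = 0 \<or> w = 0")
      case True
      have "(\<forall>R'. \<not> hsub_atm ?\<theta> (perm_atm (ren r) (abs_atm S)) R') \<and>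
          (\<forall>N \<alpha>. \<not> hsub_can ?\<theta> (perm_atm (ren r) (abs_atm S)) N \<alpha>)" if S0: "c = code_atm S" for S
      proof -
        obtain R M where S: "S = RApp R M" "d = code_atm R" "e = code_tm M"
          using iffD1[OF c_app S0] by blast
        from True show ?thesis
        proof
          assume "v = 0"
          then have "\<not> hsub_atm ?\<theta> (perm_atm (ren r) (abs_atm R)) R'"
            "\<not> hsub_can ?\<theta> (perm_atm (ren r) (abs_atm R)) N \<alpha>" for R' N \<alpha>
            using v(2) S(2) unfolding atm_result_def by (simp, blast)+
          then show ?thesis unfolding S(1) p using hsub_can_AppE hsub_atm_AppE by blast
        next
          assume "w = 0"
          then have "\<not> hsub_tm ?\<theta> (perm_tm (ren r) (abs_tm M)) N" for N
            using w(2) S(3) by (simp add: tm_result_0)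
          then show ?thesis unfolding S(1) p using hsub_can_AppE hsub_atm_AppE by blast
        qed
      qed
      then have "atm_result k s r c 0" by (intro atm_result_none) blast+
      then show ?thesis using E True by auto
    next
      case False
      then obtain w' where "w = Suc w'" by (cases w) auto
      with w(2) obtain M M'' where M: "e = code_tm M" "w = Suc (code_tm M'')"
        "hsub_tm ?\<theta> (perm_tm (ren r) (abs_tm M)) (abs_tm M'')" by (auto simp: tm_result_Suc)
      from v(2) False consider
        (atm) R R' where "d = code_atm R" "v = Suc (prod_encode (0, code_atm R'))"
          "hsub_atm ?\<theta> (perm_atm (ren r) (abs_atm R)) (abs_atm R')"
        | (can) R N \<alpha> where "d = code_atm R" "size \<alpha> \<le> k"
          "v = Suc (prod_encode (1, prod_encode (code_tm N, code_arity \<alpha>)))"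
          "hsub_can ?\<theta> (perm_atm (ren r) (abs_atm R)) (abs_tm N) \<alpha>"
        unfolding atm_result_def by blast
      then show ?thesis
      proof cases
        case atm
        have "c = code_atm (RApp R M)" by (simp add: c 3 b M atm)
        moreover have "hsub_atm ?\<theta> (perm_atm (ren r) (abs_atm (RApp R M))) (abs_atm (RApp R' M''))"
          unfolding p by (simp add: abs_atm_RApp hsub_atm_App atm M)
        moreover have "eval (arg 1 t r c) = Some (Suc (prod_encode (0, code_atm (RApp R' M''))))"
          unfolding E by (simp add: atm M)
        ultimately show ?thesis using atm_result_atm by blast
      next
        case can
        have cR: "c = code_atm (RApp R M)" by (simp add: c 3 b M can)
        have cS: "S = RApp R M" if "c = code_atm S" for S using that cR code_atm_inject by metis
        have no_atm: "\<not> hsub_atm ?\<theta> (perm_atm (ren r) (abs_atm (RApp R M))) R'" for R'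
          unfolding p using hsub_atm_AppE hsub_deterministic(2)[OF can(4) subst] by blast
        \<comment> \<open>By uniqueness, the results computed for \<open>R\<close> and
          \<open>M\<close> are those of any derivation for the application, so only the substitution
          in the redex remains open.\<close>
        have can_iff: "hsub_can ?\<theta> (perm_atm (ren r) (abs_atm (RApp R M))) P \<gamma> \<longleftrightarrow>
          (\<exists>x L \<beta>. abs_tm N = Lam x L \<and> \<alpha> = Arr \<beta> \<gamma> \<and> hsub_tm {(x, abs_tm M'', \<beta>)} L P)" (is "?l \<longleftrightarrow> ?r")
          for P \<gamma>
        proof
          assume ?l
          then obtain x L \<beta> L'' where L: "hsub_can ?\<theta> (perm_atm (ren r) (abs_atm R)) (Lam x L) (Arr \<beta> \<gamma>)"
            "hsub_tm ?\<theta> (perm_tm (ren r) (abs_tm M)) L''" "hsub_tm {(x, L'', \<beta>)} L P"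
            unfolding p using hsub_can_AppE by blast
          moreover have "Lam x L = abs_tm N" "Arr \<beta> \<gamma> = \<alpha>" "L'' = abs_tm M''"
            using L(1,2) hsub_deterministic(2)[OF can(4) subst] hsub_deterministic(1)[OF M(3) subst]
            by auto
          ultimately show ?r by metis
        next
          assume ?r
          then show ?l unfolding p using can(4) M(3) hsub_can_App by metis
        qed
        show ?thesis
        proof (cases "\<exists>x L \<beta> \<gamma>. N = RLam x L \<and> \<alpha> = Arr \<beta> \<gamma>")
          case True
          then obtain x L \<beta> \<gamma> where N: "N = RLam x L" "\<alpha> = Arr \<beta> \<gamma>" by blast
          \<comment> \<open>\<open>\<beta>\<close> is the domain of \<open>\<alpha>\<close>, so its
            size is below that of \<open>\<alpha>\<close>, which is at most \<open>k\<close>; it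
            serves as the bound for the new substitution.\<close>
          have "size \<beta> < k" using can(2) N by simp
          moreover have "ok_subst (size \<beta>) [(x, M'', \<beta>)]" by (simp add: ok_subst_def)
          ultimately obtain u where u: "eval (arg 0 (code_subst [(x, M'', \<beta>)]) 0 (code_tm L)) = Some u"
            "tm_result [(x, M'', \<beta>)] 0 (code_tm L) u" using redex by blast
          have E': "eval (arg 1 t r c) =
              Some (if u = 0 then 0 else Suc (prod_encode (1, prod_encode (u - 1, code_arity \<gamma>))))"
            unfolding E using u(1) by (simp add: can M N code_subst_single)
          \<comment> \<open>Renaming the domain removes the choice of a representative of the
            abstraction, leaving the one that was evaluated.\<close>
          have can_iff': "hsub_can ?\<theta> (perm_atm (ren r) (abs_atm (RApp R M))) P \<delta> \<longleftrightarrow>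
              \<delta> = \<gamma> \<and> hsub_tm {(x, abs_tm M'', \<beta>)} (abs_tm L) P" for P \<delta>
            unfolding can_iff N abs_tm_RLam by (metis arity.inject hsub_tm_rename_dom)
          show ?thesis
          proof (cases u)
            case 0
            with u(2) have "\<not> hsub_tm {(x, abs_tm M'', \<beta>)} (abs_tm L) P" for P
              by (simp add: tm_result_0 abs_subst_single)
            then have "atm_result k s r c 0"
              using can_iff' no_atm by (intro atm_result_none) (auto dest!: cS)
            then show ?thesis using E' 0 by simp
          next
            case (Suc u')
            with u(2) obtain P where P: "u' = code_tm P" "hsub_tm {(x, abs_tm M'', \<beta>)} (abs_tm L) (abs_tm P)"
              by (auto simp: tm_result_Suc abs_subst_single code_tm_inject)
            have "size \<gamma> \<le> k" using can(2) N by simp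
            moreover have "hsub_can ?\<theta> (perm_atm (ren r) (abs_atm (RApp R M))) (abs_tm P) \<gamma>"
              using P(2) can_iff' by blast
            ultimately have "atm_result k s r c (Suc (prod_encode (1, prod_encode (u', code_arity \<gamma>))))"
              using cR P(1) atm_result_can by blast
            then show ?thesis using E' Suc by simp
          qed
        next
          case False
          \<comment> \<open>A canonical term that is no abstraction, or whose arity is
            \<open>Base\<close>, blocks the application, and the evaluation answers 0.\<close>
          have "\<not> hsub_can ?\<theta> (perm_atm (ren r) (abs_atm (RApp R M))) P \<gamma>" for P \<gamma>
            unfolding can_iff using False by (cases N) (auto simp: abs_tm_RAtom)
          then have "atm_result k s r c 0"
            using no_atm by (intro atm_result_none) (auto dest!: cS)
          moreover have "eval (arg 1 t r c) = Some 0"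
            unfolding E using False by (cases N; cases \<alpha>) (auto simp: can M)
          ultimately show ?thesis by blast
        qed
      qed
    qed
  next
    case 4
    have "c \<noteq> code_atm M" for M
      using 4 code_atm_eq_pair[of M a b] by (auto simp: c)
    moreover have "eval (arg 1 t r c) = Some 0" using 4 by (simp add: eval_arg(2)[unfolded One_nat_def] eval_atm_def c)
    ultimately show ?thesis by (simp add: atm_result_def)
  qed
qed

text \<open>Lexicographic induction on \<open>k\<close> and \<open>c\<close>, with \<open>r\<close>
  arbitrary. At equal \<open>c\<close> the atomic case comes first, because a term and its atomic
  term may have the same code.\<close>

lemma eval_tm_atm_result:
  assumes "ok_subst k s"
  shows "\<exists>v. eval (arg 0 (code_subst s) r c) = Some v \<and> tm_result s r c v"
    and "\<exists>v. eval (arg 1 (code_subst s) r c) = Some v \<and> atm_result k s r c v"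
proof -
  define Q where "Q k s r c \<longleftrightarrow>
      (\<exists>v. eval (arg 0 (code_subst s) r c) = Some v \<and> tm_result s r c v) \<and>
      (\<exists>v. eval (arg 1 (code_subst s) r c) = Some v \<and> atm_result k s r c v)" for k s r c
  have "ok_subst k s \<Longrightarrow> Q k s r c"
  proof (induction k arbitrary: s r c rule: less_induct)
    case outer: (less k s r c)
    show ?case
    proof (induction c arbitrary: r rule: less_induct)
      case (less c)
      have atm: "\<exists>v. eval (arg 1 (code_subst s) r c) = Some v \<and> atm_result k s r c v"
        by (rule eval_atm_result[OF outer.prems refl]) (use less outer.IH in \<open>auto simp: Q_def\<close>)
      then have "\<exists>v. eval (arg 1 (code_subst s) r c') = Some v \<and> atm_result k s r c' v" if "c' \<le> c" for c'
        using less[of c' r] that by (cases "c' = c") (auto simp: Q_def)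
      then have "\<exists>v. eval (arg 0 (code_subst s) r c) = Some v \<and> tm_result s r c v"
        by (rule eval_tm_result[OF outer.prems refl]) (use less in \<open>auto simp: Q_def\<close>)
      with atm show ?case by (simp add: Q_def)
    qed
  qed
  then show "\<exists>v. eval (arg 0 (code_subst s) r c) = Some v \<and> tm_result s r c v"
    and "\<exists>v. eval (arg 1 (code_subst s) r c) = Some v \<and> atm_result k s r c v"
    using assms unfolding Q_def by blast+
qed

lemma eval_tm_cases:
  assumes "ok_subst k s"
  obtains v where "eval (arg 0 (code_subst s) r c) = Some v"
    "v \<noteq> 0 \<longleftrightarrow> (\<exists>M N. c = code_tm M \<and> hsub_tm (abs_subst s) (perm_tm (ren r) (abs_tm M)) N)"
  using eval_tm_atm_result(1)[OF assms, of r c]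
  by (auto simp: tm_result_def)

lemma eval_aty_result:
  assumes s: "ok_subst k s" and t: "t = code_subst s"
  shows "eval (arg 2 t r c) = Some (if \<exists>P P'. c = code_aty P \<and>
    hsub_aty (abs_subst s) (perm_aty (ren r) (abs_aty P)) P' then 1 else 0)"
proof (induction c rule: less_induct)
  case (less c)
  let ?\<theta> = "abs_subst s"
  obtain a b where c: "c = prod_encode (a, b)" by (rule pair_cases)
  consider "a = 0" | "a = 1" | "a \<ge> 2" by linarith
  then show ?case
  proof cases
    case 1
    have "c = code_aty (RTConst b)" by (simp add: c 1)
    moreover have "hsub_aty ?\<theta> (perm_aty (ren r) (abs_aty (RTConst b))) (TConst b)"
      by (simp add: perm_abs bij_ren hsub_aty_Const)
    ultimately have "\<exists>P P'. c = code_aty P \<and> hsub_aty ?\<theta> (perm_aty (ren r) (abs_aty P)) P'" by blast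
    moreover have "eval (arg 2 t r c) = Some 1" by (simp add: eval_arg eval_aty_def c 1)
    ultimately show ?thesis by simp
  next
    case 2
    obtain d e where b: "b = prod_encode (d, e)" by (rule pair_cases)
    have "d < c" by (simp add: c 2 b less_prod_encode2)
    obtain w where w: "eval (arg 0 t r e) = Some w"
      "w \<noteq> 0 \<longleftrightarrow> (\<exists>M N. e = code_tm M \<and> hsub_tm ?\<theta> (perm_tm (ren r) (abs_tm M)) N)"
      unfolding t by (rule eval_tm_cases[OF s])
    have "(\<exists>P P'. c = code_aty P \<and> hsub_aty ?\<theta> (perm_aty (ren r) (abs_aty P)) P') \<longleftrightarrow>
        (\<exists>P P'. d = code_aty P \<and> hsub_aty ?\<theta> (perm_aty (ren r) (abs_aty P)) P') \<and>
        (\<exists>M N. e = code_tm M \<and> hsub_tm ?\<theta> (perm_tm (ren r) (abs_tm M)) N)" (is "?l \<longleftrightarrow> ?r")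
    proof
      assume ?l
      then obtain P P' where P: "c = code_aty P" "hsub_aty ?\<theta> (perm_aty (ren r) (abs_aty P)) P'"
        by blast
      from P(1)[symmetric] obtain Q M where "P = RTApp Q M" "d = code_aty Q" "e = code_tm M"
        by (auto simp: c 2 b code_aty_eq_pair)
      then show ?r using P(2) by (auto simp: perm_abs bij_ren dest!: hsub_aty_TAppE)
    next
      assume ?r
      then obtain P P' M N where P: "d = code_aty P" "hsub_aty ?\<theta> (perm_aty (ren r) (abs_aty P)) P'"
        "e = code_tm M" "hsub_tm ?\<theta> (perm_tm (ren r) (abs_tm M)) N" by blast
      have "c = code_aty (RTApp P M)" by (simp add: c 2 b P)
      moreover have "hsub_aty ?\<theta> (perm_aty (ren r) (abs_aty (RTApp P M))) (TApp P' N)"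
        by (simp add: perm_abs bij_ren hsub_aty_App P)
      ultimately show ?l by blast
    qed
    moreover have "eval (arg 2 t r c) = Some (if (\<exists>P P'. d = code_aty P \<and>
        hsub_aty ?\<theta> (perm_aty (ren r) (abs_aty P)) P') \<and> w \<noteq> 0 then 1 else 0)"
      using w(1) less[OF \<open>d < c\<close>] by (simp add: eval_arg eval_aty_def c 2 b)
    ultimately show ?thesis unfolding w(2) by simp
  next
    case 3
    have "c \<noteq> code_aty P" for P using 3 code_aty_eq_pair[of P a b] by (auto simp: c)
    moreover have "eval (arg 2 t r c) = Some 0" using 3 by (simp add: eval_arg eval_aty_def c)
    ultimately show ?thesis by simp
  qed
qed

lemma eval_ty_result:
  assumes s: "ok_subst k s" and t: "t = code_subst s"
  shows "eval (arg 3 t r c) = Some (if \<exists>A A'. c = code_ty A \<and>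
    hsub_ty (abs_subst s) (perm_ty (ren r) (abs_ty A)) A' then 1 else 0)"
proof (induction c arbitrary: r rule: less_induct)
  case (less c)
  let ?\<theta> = "abs_subst s"
  obtain a b where c: "c = prod_encode (a, b)" by (rule pair_cases)
  consider "a = 0" | "a = 1" | "a \<ge> 2" by linarith
  then show ?case
  proof cases
    case 1
    have "(\<exists>A A'. c = code_ty A \<and> hsub_ty ?\<theta> (perm_ty (ren r) (abs_ty A)) A') \<longleftrightarrow>
        (\<exists>P P'. b = code_aty P \<and> hsub_aty ?\<theta> (perm_aty (ren r) (abs_aty P)) P')" (is "?l \<longleftrightarrow> ?r")
    proof
      assume ?l
      then obtain A A' where A: "c = code_ty A" "hsub_ty ?\<theta> (perm_ty (ren r) (abs_ty A)) A'" by blast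
      from A(1)[symmetric] obtain P where "A = RTAtom P" "b = code_aty P"
        by (auto simp: c 1 code_ty_eq_pair)
      then show ?r using A(2) by (auto simp: perm_abs bij_ren dest!: hsub_ty_TAtomE)
    next
      assume ?r
      then obtain P P' where P: "b = code_aty P" "hsub_aty ?\<theta> (perm_aty (ren r) (abs_aty P)) P'" by blast
      have "c = code_ty (RTAtom P)" by (simp add: c 1 P)
      moreover have "hsub_ty ?\<theta> (perm_ty (ren r) (abs_ty (RTAtom P))) (TAtom P')"
        by (simp add: perm_abs bij_ren hsub_ty_Atom P)
      ultimately show ?l by blast
    qed
    then show ?thesis by (simp add: eval_arg(4) eval_ty_def c 1 eval_aty_result[OF s t])
  next
    case 2
    obtain x b' where b': "b = prod_encode (x, b')" by (rule pair_cases)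
    obtain d e where b'': "b' = prod_encode (d, e)" by (rule pair_cases)
    note b = b'[unfolded b'']
    let ?n = "arg 3 t r c"
    let ?q = "extend_ren x ?n"
    have "prod_encode (d, e) < c" by (simp add: c 2 b less_prod_encode3)
    then have less_c: "d < c" "e < c"
      using le_prod_encode_1[of d e] le_prod_encode_2[of e d] by linarith+
    have fresh: "sfresh (Suc ?n) ?\<theta>"
      using sfresh_code_subst[of s "Suc ?n"] le_arg(1)[of t 3 r c] by (simp add: t)
    have "(\<exists>A A'. c = code_ty A \<and> hsub_ty ?\<theta> (perm_ty (ren r) (abs_ty A)) A') \<longleftrightarrow>
        (\<exists>A A'. d = code_ty A \<and> hsub_ty ?\<theta> (perm_ty (ren r) (abs_ty A)) A') \<and>
        (\<exists>A A'. e = code_ty A \<and> hsub_ty ?\<theta> (perm_ty (ren ?q) (abs_ty A)) A')" (is "?l \<longleftrightarrow> ?r")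
    proof
      assume ?l
      then obtain A A' where A: "c = code_ty A" "hsub_ty ?\<theta> (perm_ty (ren r) (abs_ty A)) A'" by blast
      from A(1)[symmetric] obtain B C where B: "A = RPi x B C" "d = code_ty B" "e = code_ty C"
        by (auto simp: c 2 b code_ty_eq_pair)
      have "code_ty C \<le> c" using less_c(2) B(3) by simp
      from hsub_ty_PiD[OF A(2)[unfolded B(1) ren_abs_RPi[OF this, of r x B 3 t]] finite_abs_subst fresh]
      show ?r using B(2,3) by blast
    next
      assume ?r
      then obtain B B' C C' where B: "d = code_ty B" "hsub_ty ?\<theta> (perm_ty (ren r) (abs_ty B)) B'"
        "e = code_ty C" "hsub_ty ?\<theta> (perm_ty (ren ?q) (abs_ty C)) C'" by blast
      have "c = code_ty (RPi x B C)" by (simp add: c 2 b B)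
      moreover have "code_ty C \<le> c" using less_c(2) B(3) by simp
      then have "hsub_ty ?\<theta> (perm_ty (ren r) (abs_ty (RPi x B C))) (Pi (Suc ?n) B' C')"
        unfolding ren_abs_RPi[OF \<open>code_ty C \<le> c\<close>, of r x B 3 t] by (intro hsub_ty_Pi fresh B)
      ultimately show ?l by blast
    qed
    moreover have "eval ?n = Option.bind (eval (arg 3 t r d)) (\<lambda>v.
        Option.bind (eval (arg 3 t ?q e)) (\<lambda>w. Some (if v = 0 \<or> w = 0 then 0 else 1)))"
      by (subst eval_arg(4)) (simp add: eval_ty_def c 2 b)
    ultimately show ?thesis
      using less[OF less_c(1), of r] less[OF less_c(2), of ?q] by simp
  next
    case 3
    have "c \<noteq> code_ty A" for A using 3 code_ty_eq_pair[of A a b] by (auto simp: c)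
    moreover have "eval (arg 3 t r c) = Some 0" using 3 by (simp add: eval_arg eval_ty_def c)
    ultimately show ?thesis by simp
  qed
qed

lemma eval_kind_result:
  assumes s: "ok_subst k s" and t: "t = code_subst s"
  shows "eval (arg 4 t r c) = Some (if \<exists>K K'. c = code_kind K \<and>
    hsub_kind (abs_subst s) (perm_kind (ren r) (abs_kind K)) K' then 1 else 0)"
proof (induction c arbitrary: r rule: less_induct)
  case (less c)
  let ?\<theta> = "abs_subst s"
  show ?case
  proof (cases c)
    case 0
    have "c = code_kind RType" by (simp add: 0)
    moreover have "hsub_kind ?\<theta> (perm_kind (ren r) (abs_kind RType)) Type"
      by (simp add: perm_abs bij_ren hsub_kind_Type)
    ultimately have "\<exists>K K'. c = code_kind K \<and> hsub_kind ?\<theta> (perm_kind (ren r) (abs_kind K)) K'"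
      by blast
    moreover have "eval (arg 4 t r c) = Some 1" by (simp add: eval_arg eval_kind_def 0)
    ultimately show ?thesis by simp
  next
    case (Suc b)
    obtain x b' where b': "b = prod_encode (x, b')" by (rule pair_cases)
    obtain d e where b'': "b' = prod_encode (d, e)" by (rule pair_cases)
    note b = b'[unfolded b'']
    let ?n = "arg 4 t r c"
    let ?q = "extend_ren x ?n"
    have less_c: "e < c"
      using le_prod_encode_2[of e d] le_prod_encode_2[of "prod_encode (d, e)" x]
      by (simp add: Suc b)
    have fresh: "sfresh (Suc ?n) ?\<theta>"
      using sfresh_code_subst[of s "Suc ?n"] le_arg(1)[of t 4 r c] by (simp add: t)
    have "(\<exists>K K'. c = code_kind K \<and> hsub_kind ?\<theta> (perm_kind (ren r) (abs_kind K)) K') \<longleftrightarrow>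
        (\<exists>A A'. d = code_ty A \<and> hsub_ty ?\<theta> (perm_ty (ren r) (abs_ty A)) A') \<and>
        (\<exists>K K'. e = code_kind K \<and> hsub_kind ?\<theta> (perm_kind (ren ?q) (abs_kind K)) K')" (is "?l \<longleftrightarrow> ?r")
    proof
      assume ?l
      then obtain K K' where K: "c = code_kind K" "hsub_kind ?\<theta> (perm_kind (ren r) (abs_kind K)) K'"
        by blast
      from K(1) obtain A L where L: "K = RKPi x A L" "d = code_ty A" "e = code_kind L"
        by (cases K) (auto simp: Suc b)
      have "code_kind L \<le> c" using less_c L(3) by simp
      from hsub_kind_KPiD[OF K(2)[unfolded L(1) ren_abs_RKPi[OF this, of r x A 4 t]] finite_abs_subst fresh]
      show ?r using L(2,3) by blast
    next
      assume ?r
      then obtain A A' K K' where A: "d = code_ty A" "hsub_ty ?\<theta> (perm_ty (ren r) (abs_ty A)) A'"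
        "e = code_kind K" "hsub_kind ?\<theta> (perm_kind (ren ?q) (abs_kind K)) K'" by blast
      have "c = code_kind (RKPi x A K)" by (simp add: Suc b A)
      moreover have "code_kind K \<le> c" using less_c A(3) by simp
      then have "hsub_kind ?\<theta> (perm_kind (ren r) (abs_kind (RKPi x A K))) (KPi (Suc ?n) A' K')"
        unfolding ren_abs_RKPi[OF \<open>code_kind K \<le> c\<close>, of r x A 4 t] by (intro hsub_kind_Pi fresh A)
      ultimately show ?l by blast
    qed
    moreover have "eval ?n = Option.bind (eval (arg 3 t r d)) (\<lambda>v.
        Option.bind (eval (arg 4 t ?q e)) (\<lambda>w. Some (if v = 0 \<or> w = 0 then 0 else 1)))"
      by (subst eval_arg(5)) (simp add: eval_kind_def Suc b)
    ultimately show ?thesis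
      using less[OF less_c, of ?q] eval_ty_result[OF s t, of r d] by simp
  qed
qed

section \<open>Decidability\<close>

lemma decides_comp: "decides 1 (\<lambda>xs. P (xs ! 0)) \<Longrightarrow> recursive n f \<Longrightarrow> decides n (\<lambda>xs. P (f xs))"
  unfolding decides_def by (rule recursive1_comp[where f = "\<lambda>n. if P n then 1 else 0"])

lemma decides_Ball_list:
  assumes "decides 1 (\<lambda>xs. P (pfst (xs ! 0)) (psnd (xs ! 0)))" "recursive1 f"
  shows "decides 1 (\<lambda>xs. \<forall>a\<in>set (list_decode (f (xs ! 0))). P a (xs ! 0))"
proof -
  have fold: "foldl (\<lambda>acc a. if acc = 1 \<and> P a n then 1 else 0) acc as =
      (if acc = 1 \<and> (\<forall>a\<in>set as. P a n) then 1 else if as = [] then acc else 0 :: nat)" for n acc as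
    by (induction as arbitrary: acc) auto
  have P: "decides 1 (\<lambda>xs. P (psnd (pfst (xs ! 0))) (psnd (xs ! 0)))"
    using decides_comp[OF assms(1), of 1 "\<lambda>xs. prod_encode (psnd (pfst (xs ! 0)), psnd (xs ! 0))"]
    by (simp add: recursive_intros)
  have "recursive1 (\<lambda>n. foldl (\<lambda>acc a. if acc = 1 \<and> P a n then 1 else 0) 1 (list_decode (f n)))"
    by (rule recursive1_foldl) (intro recursive_intros P assms(2); simp)+
  then show ?thesis unfolding decides_def fold by (rule recursive_cong) auto
qed

section \<open>A recursive test for free variables\<close>

text \<open>Serves the side condition on contexts, whose names cannot be changed. Modes 0 and 1
  stand for canonical and atomic terms; an abstraction over \<open>x\<close> itself falls through to
  the answer 0.\<close>

definition occurs_step :: "pfun \<Rightarrow> pfun" where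
  "occurs_step F n = (let m = pfst n; x = pfst (psnd n); c = psnd (psnd n) in
    if m = 0 \<and> pfst c = 0 then F (prod_encode (1, prod_encode (x, psnd c)))
    else if m = 0 \<and> pfst c = 1 \<and> pfst (psnd c) \<noteq> x
    then F (prod_encode (0, prod_encode (x, psnd (psnd c))))
    else if m = 1 \<and> pfst c = 1 then Some (if psnd c = x then 1 else 0)
    else if m = 1 \<and> pfst c = 2
    then Option.bind (F (prod_encode (1, prod_encode (x, pfst (psnd c))))) (\<lambda>v.
      if v \<noteq> 0 then Some 1 else F (prod_encode (0, prod_encode (x, psnd (psnd c)))))
    else Some 0)"

lemma functional_occurs_step: "functional occurs_step"
  unfolding occurs_step_def[abs_def] Let_def
  by (intro functional_if functional_bind functional_Some functional_call recursive_intros; simp)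

definition occurs :: pfun where "occurs = lfpf occurs_step"

lemmas occurs_unfold = lfpf_unfold[OF functional_occurs_step, folded occurs_def]

text \<open>A value exists at every number, so that \<open>recursive1_lfpf\<close> applies with a
  trivial guard; the meaning of the value is fixed only on codes.\<close>

lemma occurs_result:
  "\<exists>v. occurs (prod_encode (0, prod_encode (x, c))) = Some v \<and>
    (\<forall>M. c = code_tm M \<longrightarrow> (v \<noteq> 0 \<longleftrightarrow> x \<in> fv_rtm M))"
  "\<exists>v. occurs (prod_encode (1, prod_encode (x, c))) = Some v \<and>
    (\<forall>R. c = code_atm R \<longrightarrow> (v \<noteq> 0 \<longleftrightarrow> x \<in> fv_ratm R))"
proof -
  define T where "T c \<longleftrightarrow> (\<exists>v. occurs (prod_encode (0, prod_encode (x, c))) = Some v \<and>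
    (\<forall>M. c = code_tm M \<longrightarrow> (v \<noteq> 0 \<longleftrightarrow> x \<in> fv_rtm M)))" for c
  define A where "A c \<longleftrightarrow> (\<exists>v. occurs (prod_encode (1, prod_encode (x, c))) = Some v \<and>
    (\<forall>R. c = code_atm R \<longrightarrow> (v \<noteq> 0 \<longleftrightarrow> x \<in> fv_ratm R)))" for c
  have "T c \<and> A c"
  proof (induction c rule: less_induct)
    case (less c)
    obtain a b where c: "c = prod_encode (a, b)" by (rule pair_cases)
    obtain d e where b: "b = prod_encode (d, e)" by (rule pair_cases)
    have less_c: "d < c" "e < c" if "a > 0"
      using that by (simp_all add: c b less_prod_encode2 less_prod_encode3)
    have "A c"
    proof (cases "a = 2")
      case True
      from less less_c True obtain v w where
        v: "occurs (prod_encode (1, prod_encode (x, d))) = Some v"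
          "\<And>R. d = code_atm R \<Longrightarrow> v \<noteq> 0 \<longleftrightarrow> x \<in> fv_ratm R" and
        w: "occurs (prod_encode (0, prod_encode (x, e))) = Some w"
          "\<And>M. e = code_tm M \<Longrightarrow> w \<noteq> 0 \<longleftrightarrow> x \<in> fv_rtm M"
        unfolding T_def A_def by (metis zero_less_numeral)
      have "occurs (prod_encode (1, prod_encode (x, c))) = Some (if v \<noteq> 0 then 1 else w)"
        using v(1) w(1) by (subst occurs_unfold) (simp add: occurs_step_def Let_def c True b)
      moreover have "(if v \<noteq> 0 then 1 else w) \<noteq> 0 \<longleftrightarrow> x \<in> fv_ratm R" if "c = code_atm R" for R
      proof -
        from that[symmetric] obtain S M where "R = RApp S M" "d = code_atm S" "e = code_tm M"
          by (auto simp: c True b code_atm_eq_pair)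
        then show ?thesis using v(2) w(2) by auto
      qed
      ultimately show ?thesis unfolding A_def by blast
    next
      case False
      have "occurs (prod_encode (1, prod_encode (x, c))) = Some (if a = 1 \<and> b = x then 1 else 0)"
        by (subst occurs_unfold) (use False in \<open>simp add: occurs_step_def Let_def c\<close>)
      moreover have "(if a = 1 \<and> b = x then 1 else 0 :: nat) \<noteq> 0 \<longleftrightarrow> x \<in> fv_ratm R"
        if "c = code_atm R" for R
        using that[symmetric] False by (auto simp: c code_atm_eq_pair)
      ultimately show ?thesis unfolding A_def by blast
    qed
    have "T c"
    proof -
      consider "a = 0" | "a = 1" "d \<noteq> x" | "a \<noteq> 0" "\<not> (a = 1 \<and> d \<noteq> x)"
        by (cases "a = 0"; cases "a = 1 \<and> d \<noteq> x") simp_all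
      then show ?thesis
      proof cases
        case 1
        have "b \<le> c" by (simp add: c le_prod_encode_2)
        \<comment> \<open>With tag 0 the code need not drop, which is why \<open>A c\<close> is
          proved before \<open>T c\<close>.\<close>
        then have "b = c \<or> b < c" by linarith
        then have "A b" using \<open>A c\<close> less by blast
        then obtain v where v: "occurs (prod_encode (1, prod_encode (x, b))) = Some v"
          "\<And>R. b = code_atm R \<Longrightarrow> v \<noteq> 0 \<longleftrightarrow> x \<in> fv_ratm R" unfolding A_def by blast
        have "occurs (prod_encode (0, prod_encode (x, c))) = Some v"
          using v(1) by (subst occurs_unfold) (simp add: occurs_step_def Let_def c 1)
        moreover have "v \<noteq> 0 \<longleftrightarrow> x \<in> fv_rtm M" if "c = code_tm M" for M
        proof -
          from that[symmetric] obtain R where "M = RAtom R" "b = code_atm R"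
            by (auto simp: c 1 code_tm_eq_pair)
          then show ?thesis using v(2) by simp
        qed
        ultimately show ?thesis unfolding T_def by blast
      next
        case 2
        have "T e" using less less_c(2) 2 by simp
        then obtain v where v: "occurs (prod_encode (0, prod_encode (x, e))) = Some v"
          "\<And>M. e = code_tm M \<Longrightarrow> v \<noteq> 0 \<longleftrightarrow> x \<in> fv_rtm M" unfolding T_def by blast
        have "occurs (prod_encode (0, prod_encode (x, c))) = Some v"
          using v(1) by (subst occurs_unfold) (simp add: occurs_step_def Let_def c 2 b)
        moreover have "v \<noteq> 0 \<longleftrightarrow> x \<in> fv_rtm M" if "c = code_tm M" for M
        proof -
          from that[symmetric] obtain N where "M = RLam d N" "e = code_tm N"
            by (auto simp: c 2 b code_tm_eq_pair)
          then show ?thesis using v(2) 2(2) by auto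
        qed
        ultimately show ?thesis unfolding T_def by blast
      next
        case 3
        have "occurs (prod_encode (0, prod_encode (x, c))) = Some 0"
          by (subst occurs_unfold) (use 3 in \<open>auto simp: occurs_step_def Let_def c b\<close>)
        moreover have "x \<notin> fv_rtm M" if "c = code_tm M" for M
          using that[symmetric] 3 by (auto simp: c b code_tm_eq_pair)
        ultimately show ?thesis unfolding T_def by blast
      qed
    qed
    with \<open>A c\<close> show ?case by simp
  qed
  then show "\<exists>v. occurs (prod_encode (0, prod_encode (x, c))) = Some v \<and>
      (\<forall>M. c = code_tm M \<longrightarrow> (v \<noteq> 0 \<longleftrightarrow> x \<in> fv_rtm M))"
    "\<exists>v. occurs (prod_encode (1, prod_encode (x, c))) = Some v \<and>
      (\<forall>R. c = code_atm R \<longrightarrow> (v \<noteq> 0 \<longleftrightarrow> x \<in> fv_ratm R))"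
    unfolding T_def A_def by blast+
qed

definition fresh_code :: "nat \<Rightarrow> nat \<Rightarrow> bool" where
  "fresh_code x t \<longleftrightarrow> (\<forall>a\<in>set (list_decode t). pfst a \<noteq> x \<and>
    the (occurs (prod_encode (0, prod_encode (x, pfst (psnd a))))) = 0)"

lemma fresh_code_iff: "fresh_code x (code_subst s) \<longleftrightarrow> sfresh x (abs_subst s)"
proof -
  have occurs: "the (occurs (prod_encode (0, prod_encode (x, code_tm M)))) = 0 \<longleftrightarrow> x \<notin> fv (abs_tm M)"
    for M using occurs_result(1)[of x "code_tm M"] by (auto simp: fv.abs_eq)
  have "fresh_code x (code_subst s) \<longleftrightarrow> (\<forall>(y, M, \<alpha>)\<in>set s. y \<noteq> x \<and> x \<notin> fv (abs_tm M))"
    unfolding fresh_code_def code_subst_def by (auto simp: occurs)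
  also have "\<dots> \<longleftrightarrow> sfresh x (abs_subst s)"
    by (force simp: sfresh_def sdom_def srng_def mem_abs_subst)
  finally show ?thesis .
qed

lemma decides_fresh_code:
  assumes "recursive n f" "recursive n g"
  shows "decides n (\<lambda>xs. fresh_code (f xs) (g xs))"
proof -
  have occurs: "recursive1 (\<lambda>m. the (occurs (prod_encode (0, m))))"
  proof -
    have "recursive1 (\<lambda>m. if True then the (lfpf occurs_step (prod_encode (0, m))) else 0)"
    proof (rule recursive1_lfpf[OF functional_occurs_step])
      fix m
      obtain x c where "m = prod_encode (x, c)" by (rule pair_cases)
      then show "\<exists>v. lfpf occurs_step (prod_encode (0, m)) = Some v"
        using occurs_result(1)[of x c] by (auto simp: occurs_def)
    qed (auto simp: decides_def intro!: recursive_intros)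
    then show ?thesis by (simp add: occurs_def)
  qed
  have "decides 1 (\<lambda>xs. fresh_code (pfst (xs ! 0)) (psnd (xs ! 0)))"
    unfolding fresh_code_def
    by (rule decides_Ball_list) (intro recursive_intros recursive1_comp[OF occurs]; simp)+
  from decides_comp[OF this recursive_pair[OF assms]] show ?thesis by simp
qed

section \<open>Recognizing codes of terms and substitutions\<close>

lemma hsub_empty: "hsub_tm {} M M" "hsub_atm {} R R"
proof (induction M and R rule: tm_atm_induct)
  case (Lam x M)
  then show ?case by (intro hsub_tm_Lam) (auto simp: sfresh_def sdom_def srng_def)
qed (auto simp: sdom_def intro: hsub_tm_hsub_can_hsub_atm.intros)

definition valid_tm :: "nat \<Rightarrow> bool" where
  "valid_tm c \<longleftrightarrow> the (eval (arg 0 0 0 c)) \<noteq> 0"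

text \<open>The empty substitution has a result on every canonical term, hence on every valid code.\<close>

lemma valid_tm_iff: "valid_tm c \<longleftrightarrow> (\<exists>M. c = code_tm M)"
proof -
  have "ok_subst 0 []" by (simp add: ok_subst_def)
  then obtain v where "eval (arg 0 (code_subst []) 0 c) = Some v"
    "v \<noteq> 0 \<longleftrightarrow> (\<exists>M N. c = code_tm M \<and> hsub_tm (abs_subst []) (perm_tm (ren 0) (abs_tm M)) N)"
    by (rule eval_tm_cases)
  then show ?thesis
    using hsub_empty by (auto simp: valid_tm_def code_subst_def abs_subst_def)
qed

lemma decides_valid_tm:
  assumes "recursive n f"
  shows "decides n (\<lambda>xs. valid_tm (f xs))"
proof -
  have ok: "ok_subst 0 []" by (simp add: ok_subst_def)
  have "recursive1 (\<lambda>c. if True then the (lfpf eval_step (arg 0 0 0 c)) else 0)"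
  proof (rule recursive1_lfpf[OF functional_eval_step])
    show "\<exists>v. lfpf eval_step (arg 0 0 0 c) = Some v" for c
      using eval_tm_atm_result(1)[OF ok, of 0 c] by (auto simp: eval_def code_subst_def)
  qed (auto simp: decides_def arg_def intro!: recursive_intros)
  then have "recursive1 (\<lambda>c. the (eval (arg 0 0 0 c)))" by (simp add: eval_def)
  then show ?thesis
    unfolding valid_tm_def by (intro recursive_intros recursive1_comp[OF _ assms])
qed

definition valid_subst :: "nat \<Rightarrow> bool" where
  "valid_subst t \<longleftrightarrow> (\<exists>s. distinct (map fst s) \<and> t = code_subst s)"

lemma lookup_eq_0: "lookup (list_encode as) x = 0 \<longleftrightarrow> x \<notin> pfst ` set as"
proof -
  have "list_encode as = list_encode (map prod_encode (map prod_decode as))"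
    by (simp add: comp_def)
  then have "lookup (list_encode as) x = code_opt (map_of (map prod_decode as) x)"
    by (simp only: lookup_list_encode)
  then show ?thesis by (force simp: map_of_eq_None_iff pfst_def)
qed

text \<open>0 codes \<open>Base\<close>, and every positive number is the successor of a pair of
  smaller numbers. Validity of a single entry of a substitution is thus a condition on its term
  component.\<close>

lemma surj_code_arity: "\<exists>\<alpha>. code_arity \<alpha> = a"
proof (induction a rule: less_induct)
  case (less a)
  show ?case
  proof (cases a)
    case 0
    then have "code_arity Base = a" by simp
    then show ?thesis ..
  next
    case (Suc n)
    obtain b c where n: "n = prod_encode (b, c)" by (rule pair_cases)
    then have "b < a" "c < a" by (simp_all add: Suc le_prod_encode_1 le_prod_encode_2 le_imp_less_Suc)
    then obtain \<beta> \<gamma> where "code_arity \<beta> = b" "code_arity \<gamma> = c" using less by blast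
    then have "code_arity (Arr \<beta> \<gamma>) = a" by (simp add: Suc n)
    then show ?thesis ..
  qed
qed

lemma valid_subst_iff:
  "valid_subst t \<longleftrightarrow> distinct (map pfst (list_decode t)) \<and>
    (\<forall>a\<in>set (list_decode t). valid_tm (pfst (psnd a)))"
proof
  assume "valid_subst t"
  then show "distinct (map pfst (list_decode t)) \<and>
      (\<forall>a\<in>set (list_decode t). valid_tm (pfst (psnd a)))"
    by (auto simp: valid_subst_def code_subst_def valid_tm_iff case_prod_unfold comp_def) blast
next
  let ?code = "\<lambda>(x, M, \<alpha>). prod_encode (x, prod_encode (code_tm M, code_arity \<alpha>))"
  assume valid: "distinct (map pfst (list_decode t)) \<and>
      (\<forall>a\<in>set (list_decode t). valid_tm (pfst (psnd a)))"
  have "\<exists>e. a = ?code e" if "a \<in> set (list_decode t)" for a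
  proof -
    obtain x b where a: "a = prod_encode (x, b)" by (rule pair_cases)
    obtain c d where b: "b = prod_encode (c, d)" by (rule pair_cases)
    from valid that obtain M where "c = code_tm M" by (force simp: a b valid_tm_iff)
    moreover obtain \<alpha> where "code_arity \<alpha> = d" using surj_code_arity by blast
    ultimately show ?thesis by (intro exI[of _ "(x, M, \<alpha>)"]) (simp add: a b)
  qed
  then have "\<exists>s. list_decode t = map ?code s" unfolding ex_map_conv by blast
  then obtain s where s: "list_decode t = map ?code s" ..
  have "map pfst (map ?code s) = map fst s" by (simp add: case_prod_unfold comp_def)
  with valid s have "distinct (map fst s)" by metis
  moreover have "t = code_subst s" using arg_cong[OF s, of list_encode] by (simp add: code_subst_def)
  ultimately show "valid_subst t" unfolding valid_subst_def by blast
qed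

lemma decides_valid_subst:
  assumes "recursive n f"
  shows "decides n (\<lambda>xs. valid_subst (f xs))"
proof -
  \<comment> \<open>The accumulator is the successor of the code of the entries already read, or 0
    after a failure; \<open>lookup\<close> in it detects a repeated name.\<close>
  define h where "h acc a n = (if acc \<noteq> 0 \<and> lookup (acc - 1) (pfst a) = 0 \<and> valid_tm (pfst (psnd a))
    then Suc (Suc (prod_encode (a, acc - 1))) else 0)" for acc a n :: nat
  have fold0: "foldl (\<lambda>acc a. h acc a n) 0 as = 0" for as n
    by (induction as) (auto simp: h_def)
  have "foldl (\<lambda>acc a. h acc a n) (Suc (list_encode bs)) as \<noteq> 0 \<longleftrightarrow>
      distinct (map pfst as) \<and> pfst ` set as \<inter> pfst ` set bs = {} \<and>
      (\<forall>a\<in>set as. valid_tm (pfst (psnd a)))" for as bs n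
  proof (induction as arbitrary: bs)
    case (Cons a as)
    show ?case
    proof (cases "lookup (list_encode bs) (pfst a) = 0 \<and> valid_tm (pfst (psnd a))")
      case True
      then have "h (Suc (list_encode bs)) a n = Suc (list_encode (a # bs))" by (simp add: h_def)
      then have "foldl (\<lambda>acc a. h acc a n) (Suc (list_encode bs)) (a # as) =
          foldl (\<lambda>acc a. h acc a n) (Suc (list_encode (a # bs))) as" by simp
      then show ?thesis using Cons.IH[of "a # bs"] True
        by (auto simp: lookup_eq_0 simp del: list_encode.simps)
    next
      case False
      then have "h (Suc (list_encode bs)) a n = 0" by (auto simp: h_def)
      then show ?thesis using False by (auto simp: lookup_eq_0 fold0)
    qed
  qed simp
  from this[of _ "[]"] have fold: "valid_subst t \<longleftrightarrow> foldl (\<lambda>acc a. h acc a t) 1 (list_decode t) \<noteq> 0" for t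
    by (simp add: valid_subst_iff)
  have "recursive1 (\<lambda>t. foldl (\<lambda>acc a. h acc a t) 1 (list_decode t))"
    by (rule recursive1_foldl)
      (unfold h_def, (intro recursive_intros recursive_lookup decides_valid_tm; simp)+)
  from decides_not[OF decides_eq[OF this recursive_const[of _ 0]]]
  have "decides 1 (\<lambda>xs. valid_subst (xs ! 0))" by (simp add: fold)
  from decides_comp[OF this assms] show ?thesis .
qed

section \<open>From the evaluation to decidable judgements\<close>

text \<open>Totality of the evaluation is at hand only on codes of substitutions; the guard is the
  decidable domain that \<open>recursive1_lfpf\<close> asks for.\<close>

lemma recursive1_eval:
  assumes total: "\<And>s c. distinct (map fst s) \<Longrightarrow> \<exists>v. eval (arg m (code_subst s) 0 c) = Some v"
  shows "recursive1 (\<lambda>n. if valid_subst (pfst n) then the (eval (arg m (pfst n) 0 (psnd n))) else 0)"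
  unfolding eval_def
proof (rule recursive1_lfpf[OF functional_eval_step])
  show "decides 1 (\<lambda>xs. valid_subst (pfst (xs ! 0)))"
    by (intro decides_valid_subst recursive_intros) simp
  show "recursive1 (\<lambda>n. arg m (pfst n) 0 (psnd n))"
    unfolding arg_def by (intro recursive_intros) simp_all
  show "\<exists>v. lfpf eval_step (arg m (pfst n) 0 (psnd n)) = Some v" if "valid_subst (pfst n)" for n
    using that total by (auto simp: valid_subst_def eval_def)
qed

lemma ok_subst_exists: "distinct (map fst s) \<Longrightarrow> \<exists>k. ok_subst k s"
proof -
  have "\<exists>k. \<forall>(x, M, \<alpha>)\<in>set s. size \<alpha> \<le> k" for s :: rsubst
    by (intro exI[of _ "Max ((\<lambda>(x, M, \<alpha>). size \<alpha>) ` set s)"]) (force intro: Max_ge)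
  then show "distinct (map fst s) \<Longrightarrow> \<exists>k. ok_subst k s" unfolding ok_subst_def by blast
qed

text \<open>The test for a substitution code is contributed here, so \<open>Q\<close> has to be
  right only where that test succeeds, but there for every \<open>c\<close>, whether it codes an
  expression or not.\<close>

lemma decidableI:
  assumes Q: "decides 1 (\<lambda>xs. Q (xs ! 0))"
    and J: "\<And>s c. distinct (map fst s) \<Longrightarrow>
      Q (prod_encode (code_subst s, c)) \<longleftrightarrow> (\<exists>e. c = code e \<and> J (abs_subst s) (cls e))"
  shows "decidable code cls J"
proof -
  let ?S = "{prod_encode (code_subst s, code e) | s e. distinct (map fst s) \<and> J (abs_subst s) (cls e)}"
  let ?f = "\<lambda>xs. if valid_subst (pfst (xs ! 0)) \<and> Q (xs ! 0) then 1 else 0 :: nat"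
  have S: "n \<in> ?S \<longleftrightarrow> valid_subst (pfst n) \<and> Q n" for n
  proof -
    obtain t c where n: "n = prod_encode (t, c)" by (rule pair_cases)
    show ?thesis using J by (fastforce simp: n valid_subst_def)
  qed
  have "decides 1 (\<lambda>xs. valid_subst (pfst (xs ! 0)) \<and> Q (xs ! 0))"
    by (intro recursive_intros decides_valid_subst Q) simp
  then have "recursive 1 ?f" unfolding decides_def .
  moreover have "?f [n] = (if n \<in> ?S then 1 else 0)" for n unfolding S by simp
  ultimately show ?thesis unfolding decidable_def decidable_set_def by blast
qed

lemma decides_eval:
  assumes total: "\<And>s c. distinct (map fst s) \<Longrightarrow> \<exists>v. eval (arg m (code_subst s) 0 c) = Some v"
    and P: "decides 1 (\<lambda>xs. P (xs ! 0))"
    and result: "\<And>s c v. distinct (map fst s) \<Longrightarrow> eval (arg m (code_subst s) 0 c) = Some v \<Longrightarrow>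
      P v \<longleftrightarrow> (\<exists>e. c = code e \<and> J (abs_subst s) (cls e))"
  shows "decidable code cls J"
proof (rule decidableI)
  let ?f = "\<lambda>n. if valid_subst (pfst n) then the (eval (arg m (pfst n) 0 (psnd n))) else 0"
  show "decides 1 (\<lambda>xs. P (?f (xs ! 0)))"
    by (rule decides_comp[OF P recursive1_eval[OF total]])
  fix s :: rsubst and c assume s: "distinct (map fst s)"
  then have "valid_subst (code_subst s)" unfolding valid_subst_def by blast
  then show "P (?f (prod_encode (code_subst s, c))) \<longleftrightarrow> (\<exists>e. c = code e \<and> J (abs_subst s) (cls e))"
    using total[OF s, of c] result[OF s] by auto
qed

lemma decides_pos: "decides 1 (\<lambda>xs. xs ! 0 \<noteq> 0)"
  by (intro recursive_intros) simp

lemma decidable_tm: "decidable code_tm abs_tm (\<lambda>\<theta> M. \<exists>M'. hsub_tm \<theta> M M')"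
proof (rule decides_eval[where m = 0 and P = "\<lambda>v. v \<noteq> 0"])
  fix s :: rsubst and c assume "distinct (map fst s)"
  then obtain k where ok: "ok_subst k s" using ok_subst_exists by blast
  obtain v where v: "eval (arg 0 (code_subst s) 0 c) = Some v"
    "v \<noteq> 0 \<longleftrightarrow> (\<exists>M N. c = code_tm M \<and> hsub_tm (abs_subst s) (perm_tm (ren 0) (abs_tm M)) N)"
    by (rule eval_tm_cases[OF ok])
  show "\<exists>v. eval (arg 0 (code_subst s) 0 c) = Some v" using v(1) by blast
  show "w \<noteq> 0 \<longleftrightarrow> (\<exists>M. c = code_tm M \<and> (\<exists>M'. hsub_tm (abs_subst s) (abs_tm M) M'))"
    if "eval (arg 0 (code_subst s) 0 c) = Some w" for w
    using v that by simp
qed (rule decides_pos)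

lemma decidable_ty: "decidable code_ty abs_ty (\<lambda>\<theta> A. \<exists>A'. hsub_ty \<theta> A A')"
proof (rule decides_eval[where m = 3 and P = "\<lambda>v. v \<noteq> 0"])
  fix s :: rsubst and c assume "distinct (map fst s)"
  then obtain k where "ok_subst k s" using ok_subst_exists by blast
  note eval = eval_ty_result[OF this refl, of 0 c]
  show "\<exists>v. eval (arg 3 (code_subst s) 0 c) = Some v" using eval by blast
  show "v \<noteq> 0 \<longleftrightarrow> (\<exists>A. c = code_ty A \<and> (\<exists>A'. hsub_ty (abs_subst s) (abs_ty A) A'))"
    if "eval (arg 3 (code_subst s) 0 c) = Some v" for v
    using eval that by (simp split: if_splits)
qed (rule decides_pos)

lemma decidable_kind: "decidable code_kind abs_kind (\<lambda>\<theta> K. \<exists>K'. hsub_kind \<theta> K K')"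
proof (rule decides_eval[where m = 4 and P = "\<lambda>v. v \<noteq> 0"])
  fix s :: rsubst and c assume "distinct (map fst s)"
  then obtain k where "ok_subst k s" using ok_subst_exists by blast
  note eval = eval_kind_result[OF this refl, of 0 c]
  show "\<exists>v. eval (arg 4 (code_subst s) 0 c) = Some v" using eval by blast
  show "v \<noteq> 0 \<longleftrightarrow> (\<exists>K. c = code_kind K \<and> (\<exists>K'. hsub_kind (abs_subst s) (abs_kind K) K'))"
    if "eval (arg 4 (code_subst s) 0 c) = Some v" for v
    using eval that by (simp split: if_splits)
qed (rule decides_pos)

text \<open>The tag shows which judgement was found derivable. Mutual exclusion and injectivity of
  \<open>code_atm\<close> then refute the other judgement for the only expression with code
  \<open>c\<close>.\<close>

lemma eval_atm_cases:
  assumes "distinct (map fst s)" "eval (arg 1 (code_subst s) 0 c) = Some v"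
  shows "v \<noteq> 0 \<and> pfst (v - 1) = 0 \<longleftrightarrow>
      (\<exists>R. c = code_atm R \<and> (\<exists>R'. hsub_atm (abs_subst s) (abs_atm R) R'))"
    and "v \<noteq> 0 \<and> pfst (v - 1) \<noteq> 0 \<longleftrightarrow>
      (\<exists>R. c = code_atm R \<and> (\<exists>M' \<alpha>'. hsub_can (abs_subst s) (abs_atm R) M' \<alpha>'))"
proof -
  obtain k where ok: "ok_subst k s" using ok_subst_exists[OF assms(1)] by blast
  note subst = is_subst_ok[OF ok]
  have "atm_result k s 0 c v" using eval_tm_atm_result(2)[OF ok, of 0 c] assms(2) by auto
  then consider
    (none) "v = 0" "\<And>R. c = code_atm R \<Longrightarrow> (\<forall>R'. \<not> hsub_atm (abs_subst s) (abs_atm R) R') \<and>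
      (\<forall>N \<alpha>. \<not> hsub_can (abs_subst s) (abs_atm R) N \<alpha>)"
    | (atm) R R' where "c = code_atm R" "v = Suc (prod_encode (0, R'))"
      "\<exists>R'. hsub_atm (abs_subst s) (abs_atm R) R'"
    | (can) R N where "c = code_atm R" "v = Suc (prod_encode (1, N))"
      "\<exists>M \<alpha>. hsub_can (abs_subst s) (abs_atm R) M \<alpha>"
    unfolding atm_result_def ren_0 perm_id by blast
  note cases = this
  show "v \<noteq> 0 \<and> pfst (v - 1) = 0 \<longleftrightarrow>
      (\<exists>R. c = code_atm R \<and> (\<exists>R'. hsub_atm (abs_subst s) (abs_atm R) R'))"
    using cases hsub_deterministic(2)[OF _ subst]
    by cases (auto simp: code_atm_inject)
  show "v \<noteq> 0 \<and> pfst (v - 1) \<noteq> 0 \<longleftrightarrow>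
      (\<exists>R. c = code_atm R \<and> (\<exists>M' \<alpha>'. hsub_can (abs_subst s) (abs_atm R) M' \<alpha>'))"
    using cases hsub_deterministic(3)[OF _ subst]
    by cases (auto simp: code_atm_inject)
qed

lemma eval_atm_total:
  "distinct (map fst s) \<Longrightarrow> \<exists>v. eval (arg 1 (code_subst s) 0 c) = Some v"
  using ok_subst_exists eval_tm_atm_result(2) by metis

lemma decidable_atm: "decidable code_atm abs_atm (\<lambda>\<theta> R. \<exists>R'. hsub_atm \<theta> R R')"
  by (rule decides_eval[where m = 1 and P = "\<lambda>v. v \<noteq> 0 \<and> pfst (v - 1) = 0"])
    (simp_all only: eval_atm_total eval_atm_cases(1), intro recursive_intros, simp_all)

lemma decidable_can: "decidable code_atm abs_atm (\<lambda>\<theta> R. \<exists>M' \<alpha>'. hsub_can \<theta> R M' \<alpha>')"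
  by (rule decides_eval[where m = 1 and P = "\<lambda>v. v \<noteq> 0 \<and> pfst (v - 1) \<noteq> 0"])
    (simp_all only: eval_atm_total eval_atm_cases(2), intro recursive_intros, simp_all)

lemma decidable_atm_or_can: "decidable code_atm abs_atm
    (\<lambda>\<theta> R. (\<exists>R'. hsub_atm \<theta> R R') \<or> (\<exists>M' \<alpha>'. hsub_can \<theta> R M' \<alpha>'))"
proof (rule decides_eval[where m = 1 and P = "\<lambda>v. v \<noteq> 0"])
  show "v \<noteq> 0 \<longleftrightarrow> (\<exists>R. c = code_atm R \<and> ((\<exists>R'. hsub_atm (abs_subst s) (abs_atm R) R') \<or>
      (\<exists>M' \<alpha>'. hsub_can (abs_subst s) (abs_atm R) M' \<alpha>')))"
    if "distinct (map fst s)" "eval (arg 1 (code_subst s) 0 c) = Some v" for s c v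
    using eval_atm_cases[OF that] by blast
qed (rule eval_atm_total decides_pos; assumption)+

text \<open>A context does not bind its variables, and every declaration is substituted by the same
  \<open>\<theta>\<close>, so the declarations can be tested independently of each other.\<close>

lemma hsub_ctx_exists_iff:
  "(\<exists>\<Gamma>'. hsub_ctx \<theta> \<Gamma> \<Gamma>') \<longleftrightarrow> (\<forall>(x, A)\<in>set \<Gamma>. sfresh x \<theta> \<and> (\<exists>A'. hsub_ty \<theta> A A'))"
proof (induction \<Gamma>)
  case Nil
  then show ?case by (auto intro: hsub_ctx_Nil)
next
  case (Cons xA \<Gamma>)
  obtain x A where xA: "xA = (x, A)" by fastforce
  have "(\<exists>\<Gamma>'. hsub_ctx \<theta> ((x, A) # \<Gamma>) \<Gamma>') \<longleftrightarrow>
      sfresh x \<theta> \<and> (\<exists>A'. hsub_ty \<theta> A A') \<and> (\<exists>\<Gamma>'. hsub_ctx \<theta> \<Gamma> \<Gamma>')"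
    by (auto intro: hsub_ctx_Cons elim: hsub_ctx.cases)
  then show ?case using Cons by (auto simp: xA)
qed

lemma decidable_ctx: "decidable code_ctx abs_ctx (\<lambda>\<theta> \<Gamma>. \<exists>\<Gamma>'. hsub_ctx \<theta> \<Gamma> \<Gamma>')"
proof (rule decidableI)
  \<comment> \<open>The evaluation of the type enters together with its guard, because
    \<open>recursive1_eval\<close> makes the guarded function recursive.\<close>
  define ok where "ok a n \<longleftrightarrow> fresh_code (pfst a) (pfst n) \<and>
      (if valid_subst (pfst n) then the (eval (arg 3 (pfst n) 0 (psnd a))) else 0) \<noteq> 0" for a n
  have total: "\<exists>v. eval (arg 3 (code_subst s) 0 c) = Some v" if "distinct (map fst s)" for s c
    using ok_subst_exists[OF that] eval_ty_result[OF _ refl] by blast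
  have ty: "recursive n (\<lambda>xs. if valid_subst (f xs) then the (eval (arg 3 (f xs) 0 (g xs))) else 0)"
    if "recursive n f" "recursive n g" for n f g
    using recursive1_comp[OF recursive1_eval[OF total] recursive_pair[OF that]] by (simp only: pfst_pair psnd_pair)
  have "decides 1 (\<lambda>xs. ok (pfst (xs ! 0)) (psnd (xs ! 0)))"
    unfolding ok_def
    by (intro decides_conj decides_fresh_code decides_not decides_eq ty recursive_const
        recursive_pfst recursive_psnd rec_proj) simp_all
  then show "decides 1 (\<lambda>xs. \<forall>a\<in>set (list_decode (psnd (xs ! 0))). ok a (xs ! 0))"
    by (rule decides_Ball_list) (intro recursive_intros, simp)
  fix s :: rsubst and c assume s: "distinct (map fst s)"
  obtain k where "ok_subst k s" using ok_subst_exists[OF s] by blast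
  note eval = eval_ty_result[OF this refl]
  have "valid_subst (code_subst s)" using s unfolding valid_subst_def by blast
  then have ok: "ok a (prod_encode (code_subst s, c)) \<longleftrightarrow> sfresh (pfst a) (abs_subst s) \<and>
      (\<exists>A. psnd a = code_ty A \<and> (\<exists>A'. hsub_ty (abs_subst s) (abs_ty A) A'))" for a
    by (simp add: ok_def fresh_code_iff eval)
  show "(\<forall>a\<in>set (list_decode (psnd (prod_encode (code_subst s, c)))).
      ok a (prod_encode (code_subst s, c))) \<longleftrightarrow>
      (\<exists>\<Gamma>. c = code_ctx \<Gamma> \<and> (\<exists>\<Gamma>'. hsub_ctx (abs_subst s) (abs_ctx \<Gamma>) \<Gamma>'))" (is "?l \<longleftrightarrow> ?r")
  proof
    assume l: ?l
    \<comment> \<open>Success of the evaluation shows that the second component of each entry codes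
      a type; together the entries make \<open>c\<close> the code of a raw context.\<close>
    have "\<exists>e. a = (\<lambda>(x, A). prod_encode (x, code_ty A)) e"
      if mem: "a \<in> set (list_decode c)" for a
    proof -
      obtain A where "psnd a = code_ty A" using l mem ok by auto
      then show ?thesis by (intro exI[of _ "(pfst a, A)"]) (simp flip: \<open>psnd a = code_ty A\<close>)
    qed
    then have "\<exists>\<Gamma>. list_decode c = map (\<lambda>(x, A). prod_encode (x, code_ty A)) \<Gamma>"
      unfolding ex_map_conv by blast
    then obtain \<Gamma> where \<Gamma>: "list_decode c = map (\<lambda>(x, A). prod_encode (x, code_ty A)) \<Gamma>" ..
    then have "c = code_ctx \<Gamma>" unfolding code_ctx_def by (metis list_decode_inverse)
    moreover have "sfresh x (abs_subst s) \<and> (\<exists>A'. hsub_ty (abs_subst s) (abs_ty A) A')"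
      if "(x, A) \<in> set \<Gamma>" for x A
    proof -
      have "prod_encode (x, code_ty A) \<in> set (list_decode c)" using that by (force simp: \<Gamma>)
      then show ?thesis using l ok[of "prod_encode (x, code_ty A)"] by (auto simp: code_ty_inject)
    qed
    then have "\<exists>\<Gamma>'. hsub_ctx (abs_subst s) (abs_ctx \<Gamma>) \<Gamma>'"
      unfolding hsub_ctx_exists_iff abs_ctx_def by auto
    ultimately show ?r by blast
  next
    assume ?r
    then obtain \<Gamma> where \<Gamma>: "c = code_ctx \<Gamma>" and
      all: "\<forall>(x, A)\<in>set (abs_ctx \<Gamma>). sfresh x (abs_subst s) \<and> (\<exists>A'. hsub_ty (abs_subst s) A A')"
      unfolding hsub_ctx_exists_iff by blast
    have "ok (prod_encode (x, code_ty A)) (prod_encode (code_subst s, c))" if "(x, A) \<in> set \<Gamma>" for x A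
    proof -
      have "(x, abs_ty A) \<in> set (abs_ctx \<Gamma>)" using that by (force simp: abs_ctx_def)
      with all show ?thesis unfolding ok by auto
    qed
    then show ?l by (auto simp: \<Gamma> code_ctx_def)
  qed
qed

theorem theorem2p4:
  shows
    "decidable code_ctx abs_ctx (\<lambda>\<theta> \<Gamma>. \<exists>\<Gamma>'. hsub_ctx \<theta> \<Gamma> \<Gamma>') \<and>
     decidable code_kind abs_kind (\<lambda>\<theta> K. \<exists>K'. hsub_kind \<theta> K K') \<and>
     decidable code_ty abs_ty (\<lambda>\<theta> A. \<exists>A'. hsub_ty \<theta> A A') \<and>
     decidable code_tm abs_tm (\<lambda>\<theta> M. \<exists>M'. hsub_tm \<theta> M M') \<and>
     (\<forall>\<theta>. is_subst \<theta> \<longrightarrow>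
        (\<forall>\<Gamma>. \<exists>\<^sub>\<le>\<^sub>1 \<Gamma>'. hsub_ctx \<theta> \<Gamma> \<Gamma>') \<and>
        (\<forall>K. \<exists>\<^sub>\<le>\<^sub>1 K'. hsub_kind \<theta> K K') \<and>
        (\<forall>A. \<exists>\<^sub>\<le>\<^sub>1 A'. hsub_ty \<theta> A A') \<and>
        (\<forall>M. \<exists>\<^sub>\<le>\<^sub>1 M'. hsub_tm \<theta> M M')) \<and>
     decidable code_atm abs_atm (\<lambda>\<theta> R. \<exists>R'. hsub_atm \<theta> R R') \<and>
     decidable code_atm abs_atm (\<lambda>\<theta> R. \<exists>M' \<alpha>'. hsub_can \<theta> R M' \<alpha>') \<and>
     decidable code_atm abs_atm
       (\<lambda>\<theta> R. (\<exists>R'. hsub_atm \<theta> R R') \<or> (\<exists>M' \<alpha>'. hsub_can \<theta> R M' \<alpha>')) \<and>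
     (\<forall>\<theta> R. is_subst \<theta> \<longrightarrow>
        \<not> ((\<exists>R'. hsub_atm \<theta> R R') \<and> (\<exists>M' \<alpha>'. hsub_can \<theta> R M' \<alpha>')) \<and>
        (\<exists>\<^sub>\<le>\<^sub>1 R'. hsub_atm \<theta> R R') \<and>
        (\<exists>\<^sub>\<le>\<^sub>1 (M', \<alpha>'). hsub_can \<theta> R M' \<alpha>'))"
proof (intro conjI allI impI)
  fix \<theta> \<Gamma> assume "is_subst \<theta>"
  then show "\<exists>\<^sub>\<le>\<^sub>1 \<Gamma>'. hsub_ctx \<theta> \<Gamma> \<Gamma>'" by (intro Uniq_I) (rule hsub_ctx_deterministic)
next
  fix \<theta> K assume "is_subst \<theta>"
  then show "\<exists>\<^sub>\<le>\<^sub>1 K'. hsub_kind \<theta> K K'" by (intro Uniq_I) (rule hsub_kind_deterministic)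
next
  fix \<theta> A assume "is_subst \<theta>"
  then show "\<exists>\<^sub>\<le>\<^sub>1 A'. hsub_ty \<theta> A A'" by (intro Uniq_I) (rule hsub_ty_deterministic)
next
  fix \<theta> M assume "is_subst \<theta>"
  then show "\<exists>\<^sub>\<le>\<^sub>1 M'. hsub_tm \<theta> M M'" by (intro Uniq_I) (rule hsub_deterministic(1))
next
  fix \<theta> R assume \<theta>: "is_subst \<theta>"
  show "\<not> ((\<exists>R'. hsub_atm \<theta> R R') \<and> (\<exists>M' \<alpha>'. hsub_can \<theta> R M' \<alpha>'))"
    using hsub_deterministic(2)[OF _ \<theta>] by blast
  show "\<exists>\<^sub>\<le>\<^sub>1 R'. hsub_atm \<theta> R R'"
    using hsub_deterministic(3)[OF _ \<theta>] by (intro Uniq_I) blast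
  show "\<exists>\<^sub>\<le>\<^sub>1 (M', \<alpha>'). hsub_can \<theta> R M' \<alpha>'"
    using hsub_deterministic(2)[OF _ \<theta>] by (intro Uniq_I) fastforce
qed (rule decidable_ctx decidable_kind decidable_ty decidable_tm decidable_atm decidable_can
  decidable_atm_or_can)+

end
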